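(* Let $G$ be a group that is algorithmically stackable over the finite symmetric generating set $A$, via a stacking $(\mathcal N,c)$ with $S_c$ recursive, and let $\langle A\mid R_c\rangle$ be the associated stacking presentation. Then there is an algorithm which, upon input of a word $w\in A^*$ that represents the identity in $G$, constructs a van Kampen diagram for $w$ over the stacking presentation $\langle A\mid R_c\rangle$.
   Context: Conventions. $A$ is a finite symmetric generating set of a group $G$ (closed under inversion: each $a\in A$ has a formal inverse $a^{-1}\in A$), and no element of $A$ represents the identity $\epsilon$ of $G$. $A^*$ is the set of words over $A$; $1$ is the empty word; $v=w$ means equality as words and $v=_G w$ means equality in $G$. $\Gamma$ is the Cayley graph of $G$ with respect to $A$, with set of directed edges $\vec E(\Gamma)$. For $g\in G$, $a\in A$, $e_{g,a}$ is the directed edge labeled $a$ from $g$ to $ga$; for $x\in A^*$ representing $g$, $e_{x,a}:=e_{g,a}$. A set of normal forms $\mathcal N=\{y_g\mid g\in G\}\subseteq A^*$ contains exactly one word $y_g$ representing each $g\in G$. The degenerate edges are $\vec E_d:=\{e_{g,a}\mid y_ga=y_{ga}\text{ or }y_g=y_{ga}a^{-1}\text{ as words}\}$; the recursive edges are $\vec E_r:=\vec E(\Gamma)\setminus\vec E_d$. For a function $c:\vec E_r\to A^*$, let $<_c$ be the transitive closure of the relation: $e'<_c e$ whenever $e,e'\in\vec E_r$ and $e'$ lies (with the direction of the path) on the path in $\Gamma$ starting at the initial vertex of $e$ and labeled $c(e)$. A stacking for $G$ with respect to $A$ is a pair $(\mathcal N,c)$ where $\mathcal N$ is a set of normal forms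 with $y_\epsilon=1$ and $c:\vec E_r\to A^*$ satisfies: (S1) $c(e_{g,a})=_G a$ for each $e_{g,a}\in\vec E_r$; (S2) $<_c$ is a strict partial ordering on $\vec E_r$ such that for each $e\in\vec E_r$ there are only finitely many $e''\in\vec E_r$ with $e''<_c e$; (S3) the image $c(\vec E_r)\subset A^*$ is finite. Let $c'(e):=c(e)$ for $e\in\vec E_r$ and $c'(e):=a$ for $e\in\vec E_d$ with label $a$, and let $S_c:=\{(w,a,c'(e_{w,a}))\mid w\in A^*,a\in A\}\subseteq A^*\times A\times A^*$. $G$ is algorithmically stackable over $A$ if it has a stacking $(\mathcal N,c)$ with respect to $A$ such that $S_c$ is recursive (computable). The stacking relation set $R_c$ is the closure of $\{c(e_{g,a})a^{-1}\mid e_{g,a}\in\vec E_r\}$ under inversion, cyclic conjugation and free reduction (excluding the empty word); $\langle A\mid R_c\rangle$ (with $a,a^{-1}\in A$ mutually inverse) is a finite presentation of $G$, called the stacking presentation. A van Kampen diagram over a presentation $\langle A\mid R\rangle$ for a word $w\in A^*$ with $w=_G\epsilon$ is a finite, planar, contractible combinatorial 2-complex with edges directed and labeled by elements of $A$, whose boundary is an edge path labeled by $w$ starting at a basepoint vertex $*$ and reading counterclockwise, and such that every 2-cell has boundary labeled by an element of $R$ (diagrams need not be reduced). *)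

theory Defs
  imports
    "HOL-Algebra.Generated_Groups"
    "HOL-Library.Nat_Bijection"
    "HOL-Complex_Analysis.Complex_Analysis"
begin

section \<open>Groups with a finite symmetric generating set\<close>

text \<open>
  The generators are formal letters: \<open>A\<close> is a finite alphabet, \<open>\<iota>\<close> is the formal inversion of
  letters and \<open>\<pi>\<close> maps a letter to the group element it represents.  The case of a subset of the
  group is the one where \<open>\<pi>\<close> is the identity and \<open>\<iota>\<close> is the group inversion.
\<close>

definition symmetric_generating_set ::
  "('g, 'm) monoid_scheme \<Rightarrow> 'a set \<Rightarrow> ('a \<Rightarrow> 'a) \<Rightarrow> ('a \<Rightarrow> 'g) \<Rightarrow> bool" where
  "symmetric_generating_set G A \<iota> \<pi> \<longleftrightarrow>
     finite A \<and>
     (\<forall>a\<in>A. \<iota> a \<in> A \<and> \<iota> (\<iota> a) = a) \<and>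
     (\<forall>a\<in>A. \<pi> a \<in> carrier G \<and> \<pi> (\<iota> a) = inv\<^bsub>G\<^esub> (\<pi> a) \<and> \<pi> a \<noteq> \<one>\<^bsub>G\<^esub>) \<and>
     generate G (\<pi> ` A) = carrier G"

definition word_value :: "('g, 'm) monoid_scheme \<Rightarrow> ('a \<Rightarrow> 'g) \<Rightarrow> 'a list \<Rightarrow> 'g" where
  "word_value G \<pi> w = foldr (\<lambda>a g. \<pi> a \<otimes>\<^bsub>G\<^esub> g) w \<one>\<^bsub>G\<^esub>"

definition word_inverse :: "('a \<Rightarrow> 'a) \<Rightarrow> 'a list \<Rightarrow> 'a list" where
  "word_inverse \<iota> w = rev (map \<iota> w)"


section \<open>Stackings\<close>

definition normal_form_set ::
  "('g, 'm) monoid_scheme \<Rightarrow> 'a set \<Rightarrow> ('a \<Rightarrow> 'g) \<Rightarrow> 'a list set \<Rightarrow> bool" where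
  "normal_form_set G A \<pi> N \<longleftrightarrow>
     N \<subseteq> lists A \<and> (\<forall>g\<in>carrier G. \<exists>!y. y \<in> N \<and> word_value G \<pi> y = g)"

definition normal_form ::
  "('g, 'm) monoid_scheme \<Rightarrow> ('a \<Rightarrow> 'g) \<Rightarrow> 'a list set \<Rightarrow> 'g \<Rightarrow> 'a list" where
  "normal_form G \<pi> N g = (THE y. y \<in> N \<and> word_value G \<pi> y = g)"

text \<open>The directed edge \<open>e\<^bsub>g,a\<^esub>\<close> of the Cayley graph is the pair \<open>(g, a)\<close>.\<close>

definition cayley_edges :: "('g, 'm) monoid_scheme \<Rightarrow> 'a set \<Rightarrow> ('g \<times> 'a) set" where
  "cayley_edges G A = carrier G \<times> A"

definition degenerate_edges ::
  "('g, 'm) monoid_scheme \<Rightarrow> 'a set \<Rightarrow> ('a \<Rightarrow> 'a) \<Rightarrow> ('a \<Rightarrow> 'g) \<Rightarrow> 'a list set \<Rightarrow> ('g \<times> 'a) set" where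
  "degenerate_edges G A \<iota> \<pi> N =
     {(g, a) \<in> cayley_edges G A.
        normal_form G \<pi> N g @ [a] = normal_form G \<pi> N (g \<otimes>\<^bsub>G\<^esub> \<pi> a) \<or>
        normal_form G \<pi> N g = normal_form G \<pi> N (g \<otimes>\<^bsub>G\<^esub> \<pi> a) @ [\<iota> a]}"

definition recursive_edges ::
  "('g, 'm) monoid_scheme \<Rightarrow> 'a set \<Rightarrow> ('a \<Rightarrow> 'a) \<Rightarrow> ('a \<Rightarrow> 'g) \<Rightarrow> 'a list set \<Rightarrow> ('g \<times> 'a) set" where
  "recursive_edges G A \<iota> \<pi> N = cayley_edges G A - degenerate_edges G A \<iota> \<pi> N"

definition path_edges ::
  "('g, 'm) monoid_scheme \<Rightarrow> ('a \<Rightarrow> 'g) \<Rightarrow> 'g \<Rightarrow> 'a list \<Rightarrow> ('g \<times> 'a) set" where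
  "path_edges G \<pi> g w = {(g \<otimes>\<^bsub>G\<^esub> word_value G \<pi> (take i w), w ! i) | i. i < length w}"

text \<open>\<open>(e', e) \<in> stacking_order\<close> means \<open>e' <\<^sub>c e\<close>.\<close>

definition stacking_order ::
  "('g, 'm) monoid_scheme \<Rightarrow> 'a set \<Rightarrow> ('a \<Rightarrow> 'a) \<Rightarrow> ('a \<Rightarrow> 'g) \<Rightarrow> 'a list set \<Rightarrow>
   ('g \<times> 'a \<Rightarrow> 'a list) \<Rightarrow> (('g \<times> 'a) \<times> ('g \<times> 'a)) set" where
  "stacking_order G A \<iota> \<pi> N c =
     {(e', e). e' \<in> recursive_edges G A \<iota> \<pi> N \<and> e \<in> recursive_edges G A \<iota> \<pi> N \<and>
               e' \<in> path_edges G \<pi> (fst e) (c e)}\<^sup>+"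

definition stacking ::
  "('g, 'm) monoid_scheme \<Rightarrow> 'a set \<Rightarrow> ('a \<Rightarrow> 'a) \<Rightarrow> ('a \<Rightarrow> 'g) \<Rightarrow> 'a list set \<Rightarrow>
   ('g \<times> 'a \<Rightarrow> 'a list) \<Rightarrow> bool" where
  "stacking G A \<iota> \<pi> N c \<longleftrightarrow>
     normal_form_set G A \<pi> N \<and> normal_form G \<pi> N \<one>\<^bsub>G\<^esub> = [] \<and>
     c ` recursive_edges G A \<iota> \<pi> N \<subseteq> lists A \<and>
     (\<forall>(g, a) \<in> recursive_edges G A \<iota> \<pi> N. word_value G \<pi> (c (g, a)) = \<pi> a) \<and>
     irrefl (stacking_order G A \<iota> \<pi> N c) \<and> trans (stacking_order G A \<iota> \<pi> N c) \<and>
     (\<forall>e \<in> recursive_edges G A \<iota> \<pi> N. finite {e''. (e'', e) \<in> stacking_order G A \<iota> \<pi> N c}) \<and>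
     finite (c ` recursive_edges G A \<iota> \<pi> N)"

definition extended_stacking_map ::
  "('g, 'm) monoid_scheme \<Rightarrow> 'a set \<Rightarrow> ('a \<Rightarrow> 'a) \<Rightarrow> ('a \<Rightarrow> 'g) \<Rightarrow> 'a list set \<Rightarrow>
   ('g \<times> 'a \<Rightarrow> 'a list) \<Rightarrow> 'g \<times> 'a \<Rightarrow> 'a list" where
  "extended_stacking_map G A \<iota> \<pi> N c e =
     (if e \<in> recursive_edges G A \<iota> \<pi> N then c e else [snd e])"

definition stacking_graph ::
  "('g, 'm) monoid_scheme \<Rightarrow> 'a set \<Rightarrow> ('a \<Rightarrow> 'a) \<Rightarrow> ('a \<Rightarrow> 'g) \<Rightarrow> 'a list set \<Rightarrow>
   ('g \<times> 'a \<Rightarrow> 'a list) \<Rightarrow> ('a list \<times> 'a \<times> 'a list) set" where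
  "stacking_graph G A \<iota> \<pi> N c =
     {(w, a, extended_stacking_map G A \<iota> \<pi> N c (word_value G \<pi> w, a)) | w a. w \<in> lists A \<and> a \<in> A}"

inductive_set stacking_relators ::
  "('g, 'm) monoid_scheme \<Rightarrow> 'a set \<Rightarrow> ('a \<Rightarrow> 'a) \<Rightarrow> ('a \<Rightarrow> 'g) \<Rightarrow> 'a list set \<Rightarrow>
   ('g \<times> 'a \<Rightarrow> 'a list) \<Rightarrow> 'a list set"
  for G A \<iota> \<pi> N c where
  relator: "(g, a) \<in> recursive_edges G A \<iota> \<pi> N \<Longrightarrow>
              c (g, a) @ [\<iota> a] \<in> stacking_relators G A \<iota> \<pi> N c"
| inversion: "w \<in> stacking_relators G A \<iota> \<pi> N c \<Longrightarrow>
              word_inverse \<iota> w \<in> stacking_relators G A \<iota> \<pi> N c"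
| conjugation: "u @ v \<in> stacking_relators G A \<iota> \<pi> N c \<Longrightarrow>
              v @ u \<in> stacking_relators G A \<iota> \<pi> N c"
| free_reduction: "u @ [a, \<iota> a] @ v \<in> stacking_relators G A \<iota> \<pi> N c \<Longrightarrow> u @ v \<noteq> [] \<Longrightarrow>
              u @ v \<in> stacking_relators G A \<iota> \<pi> N c"


section \<open>Computability\<close>

text \<open>
  Programs for the partial recursive functions, and the relation that the program \<open>p\<close> halts on the
  arguments \<open>xs\<close> with result \<open>y\<close>.
\<close>

datatype program =
    Zero
  | Succ
  | Proj nat
  | Comp program "program list"
  | PrimRec program program
  | Mu program

inductive computes :: "program \<Rightarrow> nat list \<Rightarrow> nat \<Rightarrow> bool" where
  "computes Zero xs 0"
| "computes Succ [x] (Suc x)"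
| "i < length xs \<Longrightarrow> computes (Proj i) xs (xs ! i)"
| "list_all2 (\<lambda>p y. computes p xs y) ps ys \<Longrightarrow> computes p ys z \<Longrightarrow> computes (Comp p ps) xs z"
| "computes p xs z \<Longrightarrow> computes (PrimRec p q) (0 # xs) z"
| "computes (PrimRec p q) (n # xs) y \<Longrightarrow> computes q (n # y # xs) z \<Longrightarrow>
     computes (PrimRec p q) (Suc n # xs) z"
| "computes p (n # xs) 0 \<Longrightarrow> (\<forall>m<n. \<exists>y. computes p (m # xs) (Suc y)) \<Longrightarrow> computes (Mu p) xs n"

definition recursive_set :: "nat set \<Rightarrow> bool" where
  "recursive_set X \<longleftrightarrow> (\<exists>p. \<forall>n. computes p [n] (if n \<in> X then 1 else 0))"

text \<open>
  Words are coded by natural numbers through a numbering \<open>enc\<close> of the alphabet.  The alphabet is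
  finite, so any two numberings are translated into each other by a recursive function.
\<close>

definition encode_word :: "('a \<Rightarrow> nat) \<Rightarrow> 'a list \<Rightarrow> nat" where
  "encode_word enc w = list_encode (map enc w)"

definition encode_triple :: "('a \<Rightarrow> nat) \<Rightarrow> 'a list \<times> 'a \<times> 'a list \<Rightarrow> nat" where
  "encode_triple enc = (\<lambda>(w, a, u).
     prod_encode (encode_word enc w, prod_encode (enc a, encode_word enc u)))"

definition algorithmic_stacking ::
  "('a \<Rightarrow> nat) \<Rightarrow> ('g, 'm) monoid_scheme \<Rightarrow> 'a set \<Rightarrow> ('a \<Rightarrow> 'a) \<Rightarrow> ('a \<Rightarrow> 'g) \<Rightarrow> 'a list set \<Rightarrow>
   ('g \<times> 'a \<Rightarrow> 'a list) \<Rightarrow> bool" where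
  "algorithmic_stacking enc G A \<iota> \<pi> N c \<longleftrightarrow>
     stacking G A \<iota> \<pi> N c \<and> recursive_set (encode_triple enc ` stacking_graph G A \<iota> \<pi> N c)"


section \<open>Combinatorial 2-complexes\<close>

text \<open>
  The vertices are the numbers below \<open>nverts\<close>.  An entry \<open>(s, a, t)\<close> of \<open>edges\<close> is an edge from
  \<open>s\<close> to \<open>t\<close> labeled \<open>a\<close>; it gives rise to two directed edges \<open>(i, True)\<close> and \<open>(i, False)\<close>,
  where \<open>i\<close> is its index and the second one runs backwards and is labeled \<open>\<iota> a\<close>.  Each 2-cell is
  given by the closed edge path along which it is attached.
\<close>

type_synonym dart = "nat \<times> bool"

record 'a diagram =
  nverts :: nat
  edges :: "(nat \<times> 'a \<times> nat) list"
  cells :: "dart list list"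
  basepoint :: nat
  boundary :: "dart list"

definition dart_source :: "'a diagram \<Rightarrow> dart \<Rightarrow> nat" where
  "dart_source D = (\<lambda>(i, b). case edges D ! i of (s, a, t) \<Rightarrow> if b then s else t)"

definition dart_target :: "'a diagram \<Rightarrow> dart \<Rightarrow> nat" where
  "dart_target D = (\<lambda>(i, b). case edges D ! i of (s, a, t) \<Rightarrow> if b then t else s)"

definition dart_label :: "('a \<Rightarrow> 'a) \<Rightarrow> 'a diagram \<Rightarrow> dart \<Rightarrow> 'a" where
  "dart_label \<iota> D = (\<lambda>(i, b). case edges D ! i of (s, a, t) \<Rightarrow> if b then a else \<iota> a)"

fun edge_path :: "'a diagram \<Rightarrow> nat \<Rightarrow> dart list \<Rightarrow> nat \<Rightarrow> bool" where
  "edge_path D u [] v \<longleftrightarrow> u < nverts D \<and> u = v"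
| "edge_path D u (d # ds) v \<longleftrightarrow>
     fst d < length (edges D) \<and> dart_source D d = u \<and> edge_path D (dart_target D d) ds v"

definition labeled_complex :: "'a set \<Rightarrow> 'a diagram \<Rightarrow> bool" where
  "labeled_complex A D \<longleftrightarrow>
     (\<forall>(s, a, t) \<in> set (edges D). s < nverts D \<and> a \<in> A \<and> t < nverts D) \<and>
     (\<forall>ds \<in> set (cells D). ds \<noteq> [] \<and> (\<exists>v. edge_path D v ds v)) \<and>
     edge_path D (basepoint D) (boundary D) (basepoint D)"


section \<open>Realizations in the plane\<close>

text \<open>
  A realization places the vertices at the points \<open>pt\<close>, the edges along the arcs (or simple closed
  curves, in the case of loops) \<open>ar\<close>, and the 2-cells through the characteristic maps \<open>ch\<close>,
  which are defined on the closed unit disc.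
\<close>

definition dart_arc :: "(nat \<Rightarrow> real \<Rightarrow> complex) \<Rightarrow> dart \<Rightarrow> real \<Rightarrow> complex" where
  "dart_arc ar = (\<lambda>(i, b). if b then ar i else reversepath (ar i))"

text \<open>The unit circle, cut into \<open>length ds\<close> equal parts starting from 1, is sent along \<open>ds\<close>.\<close>

definition traces ::
  "(nat \<Rightarrow> real \<Rightarrow> complex) \<Rightarrow> (complex \<Rightarrow> complex) \<Rightarrow> dart list \<Rightarrow> bool" where
  "traces ar h ds \<longleftrightarrow>
     (\<forall>j < length ds. \<forall>t \<in> {0..1}.
        h (cis (2 * pi * (real j + t) / real (length ds))) = dart_arc ar (ds ! j) t)"

definition skeleton_image ::
  "'a diagram \<Rightarrow> (nat \<Rightarrow> complex) \<Rightarrow> (nat \<Rightarrow> real \<Rightarrow> complex) \<Rightarrow> complex set" where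
  "skeleton_image D pt ar = pt ` {..<nverts D} \<union> (\<Union>i<length (edges D). path_image (ar i))"

definition complex_image ::
  "'a diagram \<Rightarrow> (nat \<Rightarrow> complex) \<Rightarrow> (nat \<Rightarrow> real \<Rightarrow> complex) \<Rightarrow> (nat \<Rightarrow> complex \<Rightarrow> complex) \<Rightarrow>
   complex set" where
  "complex_image D pt ar ch =
     skeleton_image D pt ar \<union> (\<Union>j<length (cells D). ch j ` cball 0 1)"

definition plane_realization ::
  "'a diagram \<Rightarrow> (nat \<Rightarrow> complex) \<Rightarrow> (nat \<Rightarrow> real \<Rightarrow> complex) \<Rightarrow> (nat \<Rightarrow> complex \<Rightarrow> complex) \<Rightarrow>
   bool" where
  "plane_realization D pt ar ch \<longleftrightarrow>
     inj_on pt {..<nverts D} \<and>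
     (\<forall>i < length (edges D).
        simple_path (ar i) \<and>
        pathstart (ar i) = pt (dart_source D (i, True)) \<and>
        pathfinish (ar i) = pt (dart_target D (i, True)) \<and>
        ar i ` {0<..<1} \<inter> pt ` {..<nverts D} = {}) \<and>
     disjoint_family_on (\<lambda>i. ar i ` {0<..<1}) {..<length (edges D)} \<and>
     (\<forall>j < length (cells D).
        continuous_on (cball 0 1) (ch j) \<and> inj_on (ch j) (ball 0 1) \<and>
        traces ar (ch j) (cells D ! j) \<and>
        ch j ` ball 0 1 \<inter> skeleton_image D pt ar = {}) \<and>
     disjoint_family_on (\<lambda>j. ch j ` ball 0 1) {..<length (cells D)}"

text \<open>
  The boundary path of a compact contractible set \<open>K\<close> in the plane is the path followed by loops
  around \<open>K\<close> as they shrink onto \<open>K\<close>: the map \<open>\<psi>\<close> is a homeomorphism from the exterior of the unit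
  disc onto the complement of \<open>K\<close>, extended to the unit circle, on which it runs along the path
  \<open>ds\<close> from the point \<open>p\<close>.  The winding number expresses that this is counterclockwise.
  (\<open>ds\<close> is empty only if \<open>K\<close> is a point.)
\<close>

definition counterclockwise_boundary ::
  "complex set \<Rightarrow> (nat \<Rightarrow> real \<Rightarrow> complex) \<Rightarrow> complex \<Rightarrow> dart list \<Rightarrow> bool" where
  "counterclockwise_boundary K ar p ds \<longleftrightarrow>
     (\<exists>\<psi>. continuous_on {z. 1 \<le> norm z} \<psi> \<and>
          inj_on \<psi> {z. 1 < norm z} \<and> \<psi> ` {z. 1 < norm z} = - K \<and>
          \<psi> 1 = p \<and> traces ar \<psi> ds \<and> (ds = [] \<longrightarrow> \<psi> ` sphere 0 1 = {p}) \<and>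
          winding_number (\<psi> \<circ> circlepath 0 2) p = 1)"


section \<open>Van Kampen diagrams\<close>

definition van_kampen_diagram ::
  "'a set \<Rightarrow> ('a \<Rightarrow> 'a) \<Rightarrow> 'a list set \<Rightarrow> 'a list \<Rightarrow> 'a diagram \<Rightarrow> bool" where
  "van_kampen_diagram A \<iota> R w D \<longleftrightarrow>
     labeled_complex A D \<and>
     (\<forall>ds \<in> set (cells D). map (dart_label \<iota> D) ds \<in> R) \<and>
     map (dart_label \<iota> D) (boundary D) = w \<and>
     (\<exists>pt ar ch. plane_realization D pt ar ch \<and>
        contractible (complex_image D pt ar ch) \<and>
        counterclockwise_boundary (complex_image D pt ar ch) ar (pt (basepoint D)) (boundary D))"

definition encode_dart_path :: "dart list \<Rightarrow> nat" where
  "encode_dart_path ds = list_encode (map (\<lambda>(i, b). prod_encode (i, if b then 1 else 0)) ds)"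

definition encode_diagram :: "('a \<Rightarrow> nat) \<Rightarrow> 'a diagram \<Rightarrow> nat" where
  "encode_diagram enc D = list_encode
     [nverts D,
      list_encode (map (\<lambda>(s, a, t). prod_encode (s, prod_encode (enc a, t))) (edges D)),
      list_encode (map encode_dart_path (cells D)),
      basepoint D,
      encode_dart_path (boundary D)]"

end

theory Submission
  imports Defs
begin

text \<open>
  For an edge from \<open>g\<close> to \<open>h\<close> labeled \<open>a\<close>, Noetherian induction over the stacking order shows that the
  word \<open>y\<^sub>g a v\<close> can be reduced to \<open>y\<^sub>h v\<close>
    by deleting pairs of inverse letters and replacing letters
  \<open>a\<close> on recursive edges by \<open>c(e)\<close>: a recursive edge is replaced
    by its path of smaller edges, and on a
  degenerate edge at most one pair cancels.  Hence every word representing the identity reduces to the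
  empty word, and no pair of inverse letters is ever inserted.

  Read backwards, such a reduction builds a diagram from a point by two operations on its outer
  boundary: attaching a spike, and attaching a 2-cell along a boundary path \<open>c(e)\<close> with a single new
  edge.  No edges are ever identified, so planarity is easy: the exterior of the diagram is
  parametrized by the exterior of the unit disc, and both operations are the precomposition of this
  parametrization with an explicit map between domains in the exterior of the disc.  Contractibility
  follows from the parametrization as well, since it retracts the plane to the diagram.

  A program decides whether a list of operations is legal, which only needs a decision procedure for
  \<open>S\<^sub>c\<close>, so an unbounded search finds one that produces the given word.
\<close>

text \<open>Diagrams are topological here, so every operation has to carry a planar realization
  along. What is carried is a map of the closed exterior of the unit disc, injective only off the
  circle: a boundary edge with no cell beside it is traced twice. Its closeness to z/2 at infinity
  stands in for contractibility and orientation, which are extracted only at the end. Since the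
  circle is cut into equal parts, a boundary of new length needs a reparametrized circle; beyond
  radius 2 these reparametrizations are rotations. The program computes no normal forms and compares
  no edges: the boundary word before a letter names the start of its edge. A path c(e) is nonempty,
  since no letter represents the identity, and is never the label of e alone, since the stacking
  order is irreflexive. So the triples in S_c whose last entry is not the letter itself are exactly
  those of recursive edges. The search ends because words reduce; its output is correct because
  every legal list of operations preserves the realization.\<close>

section \<open>Polar coordinates\<close>

text \<open>Angles are measured in turns.\<close>

definition polar :: "real \<Rightarrow> real \<Rightarrow> complex" where
  "polar s r = of_real r * cis (2 * pi * s)"

definition turn :: "complex \<Rightarrow> real" where
  "turn z = Arg2pi z / (2 * pi)"

lemma norm_polar: "0 \<le> r \<Longrightarrow> norm (polar s r) = r"
  by (simp add: polar_def norm_mult)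

lemma polar_add_one: "polar (s + 1) r = polar s r"
  by (simp add: polar_def distrib_left flip: cis_mult)

lemma polar_diff_one: "polar (s - 1) r = polar s r"
  using polar_add_one[of "s - 1"] by simp

lemma polar_0 [simp]: "polar 0 r = of_real r"
  by (simp add: polar_def)

lemma polar_1 [simp]: "polar 1 r = of_real r"
  using polar_add_one[of 0] by simp

lemma cis_mult_polar: "cis (2 * pi * a) * polar s r = polar (a + s) r"
  by (simp add: polar_def distrib_left flip: cis_mult)

lemma continuous_on_polar [continuous_intros]:
  "continuous_on S f \<Longrightarrow> continuous_on S g \<Longrightarrow> continuous_on S (\<lambda>x. polar (f x) (g x))"
  unfolding polar_def cis_conv_exp by (intro continuous_intros)

lemma turn_bounds: "0 \<le> turn z" "turn z < 1" "turn z \<in> {0..1}"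
  using Arg2pi[of z] by (auto simp: turn_def field_simps)

lemma polar_turn: "polar (turn z) (norm z) = z"
  using Arg2pi_eq[of z] by (simp add: polar_def turn_def cis_conv_exp)

lemma turn_polar: "0 \<le> s \<Longrightarrow> s < 1 \<Longrightarrow> 0 < r \<Longrightarrow> turn (polar s r) = s"
  using Arg2pi_unique[of r "2 * pi * s" "polar s r"]
  by (simp add: turn_def polar_def cis_conv_exp)

lemma polar_eq_iff:
  assumes "0 \<le> s" "s < 1" "0 \<le> s'" "s' < 1" "0 < r" "0 < r'"
  shows "polar s r = polar s' r' \<longleftrightarrow> s = s' \<and> r = r'"
  using turn_polar assms norm_polar by (metis less_imp_le)

lemma polar_eq_imp_int:
  assumes "polar s r = polar s' r" "0 < r" shows "\<exists>n::int. s - s' = of_int n"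
proof -
  have "cis (2 * pi * s) = cis (2 * pi * s')"
    using assms by (simp add: polar_def)
  then have "exp (\<i> * of_real (2 * pi * s)) = exp (\<i> * of_real (2 * pi * s'))"
    by (simp add: cis_conv_exp)
  then obtain n :: int where "\<i> * of_real (2 * pi * s) = \<i> * of_real (2 * pi * s') + of_int (2 * n) * pi * \<i>"
    unfolding exp_eq by blast
  then have "2 * pi * s = 2 * pi * s' + 2 * n * pi"
    by (auto simp: complex_eq_iff)
  then have "2 * pi * (s - s') = 2 * pi * of_int n" by (simp add: algebra_simps)
  then show ?thesis by (metis mult_left_cancel pi_neq_zero zero_neq_numeral mult_eq_0_iff)
qed

text \<open>\<open>turn\<close> jumps at the positive real axis. Off the axis it is continuous; on
  the right half plane the function is rewritten with the principal argument, shifted by one turn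
  below the axis, and \<open>seam\<close> makes the two formulas agree on it.\<close>

lemma continuous_on_polar_coordinates:
  fixes g :: "real \<Rightarrow> real \<Rightarrow> complex"
  assumes g: "continuous_on ({0..1} \<times> R) (\<lambda>x. g (fst x) (snd x))"
    and seam: "\<And>r. r \<in> R \<Longrightarrow> g 1 r = g 0 r" and R: "R \<subseteq> {0<..}"
  shows "continuous_on {z. norm z \<in> R} (\<lambda>z. g (turn z) (norm z))"
proof -
  let ?S = "{z::complex. norm z \<in> R}"
  let ?f = "\<lambda>z. g (turn z) (norm z)"
  have comp: "continuous_on T (\<lambda>z. g (h z) (norm z))"
    if "continuous_on T h" "\<And>z. z \<in> T \<Longrightarrow> h z \<in> {0..1} \<and> norm z \<in> R" for T and h :: "complex \<Rightarrow> real"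
    using continuous_on_compose2[OF g, of T "\<lambda>z. (h z, norm z)"] that
    by (force intro!: continuous_intros)
  have 1: "continuous_on (?S \<inter> - \<real>\<^sub>\<ge>\<^sub>0) ?f"
  proof (rule comp)
    show "continuous_on (?S \<inter> - \<real>\<^sub>\<ge>\<^sub>0) turn"
      unfolding turn_def
      by (intro continuous_intros continuous_at_imp_continuous_on ballI continuous_at_Arg2pi) auto
  qed (use turn_bounds in auto)
  let ?h1 = "\<lambda>z. Arg z / (2 * pi)" and ?h2 = "\<lambda>z. Arg z / (2 * pi) + 1"
  let ?T = "?S \<inter> {z. 0 < Re z}"
  have Arg: "continuous_on ?T Arg"
    by (rule continuous_on_subset[OF continuous_on_Arg]) (auto simp: complex_nonpos_Reals_iff)
  have turn1: "turn z = ?h1 z" if "0 \<le> Im z" "z \<noteq> 0" for z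
  proof -
    have "0 \<le> Arg z" "Arg z < 2 * pi"
      using that Arg_less_0 Arg_le_pi[of z] pi_gt_zero by (auto intro: order.strict_trans1)
    then have "Arg2pi z = Arg z"
      using Arg_eq[of z] that by (intro Arg2pi_unique[of "norm z"]) auto
    then show ?thesis by (simp add: turn_def)
  qed
  have turn2: "turn z = ?h2 z" if "Im z < 0" for z
  proof -
    have "Arg z < 0" "- pi < Arg z"
      using that Arg_less_0[of z] mpi_less_Arg by auto
    moreover have "z \<noteq> 0" using that by auto
    moreover have "exp (\<i> * complex_of_real (Arg z + 2 * pi)) = exp (\<i> * Arg z)"
      by (simp add: algebra_simps exp_add)
    ultimately have "Arg2pi z = Arg z + 2 * pi"
      using Arg_eq[of z] that pi_gt_zero by (intro Arg2pi_unique[of "norm z"]) (auto simp del: of_real_add)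
    then show ?thesis by (simp add: turn_def field_simps)
  qed
  have "continuous_on ?T (\<lambda>z. if Im z \<le> 0 then g (?h2 z) (norm z) else g (?h1 z) (norm z))"
  proof (rule continuous_on_cases_le)
    show "continuous_on {z \<in> ?T. Im z \<le> 0} (\<lambda>z. g (?h2 z) (norm z))"
    proof (rule comp)
      show "continuous_on {z \<in> ?T. Im z \<le> 0} ?h2"
        by (intro continuous_intros continuous_on_subset[OF Arg]) auto
      fix z assume z: "z \<in> {z \<in> ?T. Im z \<le> 0}"
      have "Arg z \<le> 0"
        using z Arg_lt_pi[of z] Arg_less_0[of z] Arg_eq_pi[of z] mpi_less_Arg[of z] Arg_le_pi[of z]
        by fastforce
      then show "?h2 z \<in> {0..1} \<and> norm z \<in> R"
        using z mpi_less_Arg[of z] by (auto simp: field_simps)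
    qed
    show "continuous_on {z \<in> ?T. 0 \<le> Im z} (\<lambda>z. g (?h1 z) (norm z))"
    proof (rule comp)
      show "continuous_on {z \<in> ?T. 0 \<le> Im z} ?h1"
        by (intro continuous_intros continuous_on_subset[OF Arg]) auto
      fix z assume z: "z \<in> {z \<in> ?T. 0 \<le> Im z}"
      then show "?h1 z \<in> {0..1} \<and> norm z \<in> R"
        using Arg_less_0 Arg_le_pi[of z] pi_gt_zero by (auto simp: field_simps intro: order_trans)
    qed
    fix z assume "z \<in> ?T" "Im z = 0"
    moreover from this have "Arg z = 0"
      by (simp add: Arg_eq_0 complex_is_Real_iff)
    ultimately show "g (?h2 z) (norm z) = g (?h1 z) (norm z)"
      by (simp add: seam)
  qed (intro continuous_intros)
  moreover have "(if Im z \<le> 0 then g (?h2 z) (norm z) else g (?h1 z) (norm z)) = ?f z" if "z \<in> ?T" for z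
  proof (cases "Im z = 0")
    case True
    with that have "Arg z = 0" "z \<noteq> 0"
      by (auto simp: Arg_eq_0 complex_is_Real_iff)
    with True have "turn z = 0"
      using turn1[of z] by simp
    then show ?thesis
      using that True \<open>Arg z = 0\<close> by (simp add: seam)
  next
    case False
    then show ?thesis using turn1[of z] turn2[of z] by (cases "z = 0") auto
  qed
  ultimately have 2: "continuous_on ?T ?f"
    by (rule continuous_on_eq)
  \<comment> \<open>A nonnegative real whose modulus lies in \<open>R\<close> is positive, so the
    two relatively open pieces cover everything.\<close>
  have eq: "?S \<inter> - \<real>\<^sub>\<ge>\<^sub>0 \<union> ?T = ?S"
    using R by (auto simp: complex_nonneg_Reals_iff) (metis cmod_eq_Re greaterThan_iff in_mono less_eq_real_def norm_zero zero_less_norm_iff abs_0 less_irrefl)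
  have "continuous_on (?S \<inter> - \<real>\<^sub>\<ge>\<^sub>0 \<union> ?T) ?f"
  proof (rule continuous_on_Un_local_open[OF _ _ 1 2]; unfold eq)
    show "openin (top_of_set ?S) (?S \<inter> - \<real>\<^sub>\<ge>\<^sub>0)"
      by (intro openin_open_Int) (simp add: open_Compl)
    show "openin (top_of_set ?S) ?T"
      by (intro openin_open_Int open_halfspace_Re_gt)
  qed
  then show ?thesis unfolding eq .
qed


section \<open>Reparametrization of circles\<close>

definition rotate_circles :: "(real \<Rightarrow> real \<Rightarrow> real) \<Rightarrow> complex \<Rightarrow> complex" where
  "rotate_circles F z = polar (F (turn z) (norm z)) (norm z)"

text \<open>For fixed \<open>r\<close>, \<open>F\<close> is one period of the lift to the real line
  of an orientation preserving homeomorphism of a circle. Its values need not lie in [0,1], as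
  \<open>polar\<close> is periodic in the angle.\<close>

locale circle_rotation =
  fixes F :: "real \<Rightarrow> real \<Rightarrow> real"
  assumes continuous: "continuous_on ({0..1} \<times> {0<..}) (\<lambda>x. F (fst x) (snd x))"
    and strict: "\<And>r s t. 0 < r \<Longrightarrow> 0 \<le> s \<Longrightarrow> s < t \<Longrightarrow> t \<le> 1 \<Longrightarrow> F s r < F t r"
    and degree: "\<And>r. 0 < r \<Longrightarrow> F 1 r = F 0 r + 1"
begin

lemma norm_rotate_circles [simp]: "norm (rotate_circles F z) = norm z"
  by (simp add: rotate_circles_def norm_polar)

lemma rotate_circles_polar:
  assumes "0 \<le> s" "s \<le> 1" "0 < r"
  shows "rotate_circles F (polar s r) = polar (F s r) r"
proof (cases "s = 1")
  case True
  have "turn (of_real r) = 0"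
    using turn_polar[of 0 r] assms by simp
  then show ?thesis
    using True assms by (simp add: rotate_circles_def degree polar_add_one)
next
  case False
  with assms show ?thesis
    by (simp add: rotate_circles_def turn_polar norm_polar)
qed

lemma continuous_on_rotate_circles: "continuous_on (- {0}) (rotate_circles F)"
proof -
  have "continuous_on {z. norm z \<in> {0<..}} (\<lambda>z. (\<lambda>s r. polar (F s r) r) (turn z) (norm z))"
    by (rule continuous_on_polar_coordinates)
      (auto intro!: continuous_intros continuous simp: degree polar_add_one)
  moreover have "{z::complex. norm z \<in> {0<..}} = - {0}" by auto
  ultimately show ?thesis by (simp add: rotate_circles_def[abs_def])
qed

text \<open>Angles with equal images differ by an integer, and the values of \<open>F\<close> on one
  circle lie in a half-open interval of length 1. So the integer is 0, and strict monotonicity does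
  the rest.\<close>

lemma inj_on_rotate_circles: "inj_on (rotate_circles F) (- {0})"
proof (rule inj_onI)
  fix z w assume zw: "z \<in> - {0}" "w \<in> - {0}" and eq: "rotate_circles F z = rotate_circles F w"
  have n: "norm z = norm w"
    using eq norm_rotate_circles by metis
  have pos: "0 < norm z" using zw by simp
  obtain k :: int where k: "F (turn z) (norm z) - F (turn w) (norm z) = of_int k"
    using polar_eq_imp_int[OF _ pos, of "F (turn z) (norm z)" "F (turn w) (norm z)"] eq n
    by (auto simp: rotate_circles_def)
  have range: "F 0 (norm z) \<le> F (turn x) (norm z)" "F (turn x) (norm z) < F 0 (norm z) + 1" for x
    using strict[OF pos, of 0 "turn x"] strict[OF pos, of "turn x" 1] turn_bounds[of x] degree[OF pos]
    by (cases "turn x = 0", auto)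
  have "\<bar>real_of_int k\<bar> < 1"
    using k range[of z] range[of w] by linarith
  then have "k = 0" by linarith
  then have "turn z = turn w"
    using k strict[OF pos, of "turn z" "turn w"] strict[OF pos, of "turn w" "turn z"]
      turn_bounds[of z] turn_bounds[of w]
        by (metis diff_eq_eq add_0 less_irrefl less_imp_le linorder_neqE_linordered_idom of_int_0)
  then show "z = w"
    using n polar_turn by metis
qed

lemma rotate_circles_surj:
  assumes "w \<noteq> 0" shows "\<exists>z. norm z = norm w \<and> rotate_circles F z = w"
proof -
  let ?r = "norm w"
  have pos: "0 < ?r" using assms by simp
  \<comment> \<open>The number of whole turns that moves the angle of \<open>w\<close> into the
    range of \<open>F\<close> on this circle, where the intermediate value theorem applies.\<close>
  define k where "k = \<lceil>F 0 ?r - turn w\<rceil>"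
  have k: "F 0 ?r \<le> turn w + of_int k" "turn w + of_int k \<le> F 1 ?r"
    unfolding k_def degree[OF pos] by linarith+
  have "continuous_on {0..1} (\<lambda>s. F s ?r)"
    using continuous_on_compose2[OF continuous, of "{0..1}" "\<lambda>s. (s, ?r)"] pos
    by (force intro!: continuous_intros)
  then obtain s where s: "0 \<le> s" "s \<le> 1" "F s ?r = turn w + of_int k"
    using IVT'[of "\<lambda>s. F s ?r" 0 "turn w + of_int k" 1] k by auto
  have "polar (turn w + of_int k) ?r = polar (turn w) ?r"
    by (simp add: polar_def distrib_left cis_multiple_2pi flip: cis_mult)
  with s pos show ?thesis
    by (intro exI[of _ "polar s ?r"]) (simp add: norm_polar rotate_circles_polar polar_turn)
qed

lemma rotate_circles_image:
  assumes "R \<subseteq> {0<..}" shows "rotate_circles F ` {z. norm z \<in> R} = {z::complex. norm z \<in> R}"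
proof (intro subset_antisym subsetI)
  fix w :: complex assume w: "w \<in> {z. norm z \<in> R}"
  then have "w \<noteq> 0" using assms by auto
  then show "w \<in> rotate_circles F ` {z. norm z \<in> R}"
    using w rotate_circles_surj[of w] by (metis (mono_tags, lifting) image_eqI mem_Collect_eq)
qed auto

end


section \<open>Piecewise linear functions\<close>

definition clamp01 :: "real \<Rightarrow> real" where
  "clamp01 x = max 0 (min 1 x)"

lemma clamp01_simps: "x \<le> 0 \<Longrightarrow> clamp01 x = 0" "1 \<le> x \<Longrightarrow> clamp01 x = 1"
    "0 \<le> x \<Longrightarrow> x \<le> 1 \<Longrightarrow> clamp01 x = x"
  by (auto simp: clamp01_def)

lemma clamp01_mono: "x \<le> y \<Longrightarrow> clamp01 x \<le> clamp01 y"
  by (auto simp: clamp01_def)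

lemma clamp01_range: "0 \<le> clamp01 x" "clamp01 x \<le> 1"
  by (auto simp: clamp01_def)

lemma continuous_on_clamp01 [continuous_intros]:
  "continuous_on S f \<Longrightarrow> continuous_on S (\<lambda>x. clamp01 (f x))"
  unfolding clamp01_def by (intro continuous_intros)

text \<open>The piecewise linear function with value \<open>v j\<close> at j/n, written as a sum of
  clamped ramps: continuity is then immediate, and no piece has to be selected.\<close>

definition interpolate :: "nat \<Rightarrow> (nat \<Rightarrow> real) \<Rightarrow> real \<Rightarrow> real" where
  "interpolate n v s = v 0 + (\<Sum>j<n. (v (Suc j) - v j) * clamp01 (real n * s - real j))"

lemma continuous_on_interpolate [continuous_intros]:
  "continuous_on S f \<Longrightarrow> continuous_on S (\<lambda>x. interpolate n v (f x))"
  unfolding interpolate_def by (intro continuous_intros)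

lemma interpolate_piece:
  assumes "j < n" "0 \<le> t" "t \<le> 1"
  shows "interpolate n v ((real j + t) / real n) = v j + t * (v (Suc j) - v j)"
proof -
  have "(\<Sum>i<n. (v (Suc i) - v i) * clamp01 (real n * ((real j + t) / real n) - real i)) =
        (\<Sum>i<n. if i < j then v (Suc i) - v i else if i = j then (v (Suc j) - v j) * t else 0)"
  proof (rule sum.cong)
    fix i assume "i \<in> {..<n}"
    consider "i < j" | "i = j" | "j < i" by linarith
    then show "(v (Suc i) - v i) * clamp01 (real n * ((real j + t) / real n) - real i) =
      (if i < j then v (Suc i) - v i else if i = j then (v (Suc j) - v j) * t else 0)"
      using assms by cases (auto simp: clamp01_simps)
  qed simp
  also have "\<dots> = (\<Sum>i<n. (if i < j then v (Suc i) - v i else 0) + (if i = j then (v (Suc j) - v j) * t else 0))"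
    by (rule sum.cong) auto
  also have "\<dots> = (\<Sum>i | i < n \<and> i < j. v (Suc i) - v i) + (v (Suc j) - v j) * t"
    using assms by (simp add: sum.distrib sum.If_cases Int_def)
  also have "{i. i < n \<and> i < j} = {..<j}"
    using assms by auto
  also have "(\<Sum>i<j. v (Suc i) - v i) = v j - v 0"
    by (rule sum_lessThan_telescope)
  finally show ?thesis
    by (simp add: interpolate_def)
qed

lemma interpolate_strict_mono:
  assumes v: "\<And>j. j < n \<Longrightarrow> v j < v (Suc j)" and s: "0 \<le> s" "s < t" "t \<le> 1" and n: "0 < n"
  shows "interpolate n v s < interpolate n v t"
proof -
  \<comment> \<open>The piece that contains \<open>s\<close>: its ramp grows strictly from
    \<open>s\<close> to \<open>t\<close>, while no other ramp decreases.\<close>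
  define j where "j = nat \<lfloor>real n * s\<rfloor>"
  have "real n * s < real n" using s n by (simp add: mult_less_cancel_left)
  then have j: "real j \<le> real n * s" "real n * s < real j + 1" "j < n"
    using s unfolding j_def by (auto simp: nat_less_iff floor_less_iff)
  have "real n * s < real n * t" using s n by simp
  have "clamp01 (real n * s - real j) < clamp01 (real n * t - real j)"
    using j \<open>real n * s < real n * t\<close> unfolding clamp01_def by linarith
  then have "(v (Suc j) - v j) * clamp01 (real n * s - real j) < (v (Suc j) - v j) * clamp01 (real n * t - real j)"
    using v[OF j(3)] by simp
  moreover have "(v (Suc i) - v i) * clamp01 (real n * s - real i) \<le> (v (Suc i) - v i) * clamp01 (real n * t - real i)"
    if "i < n" for i
    using v[OF that] \<open>real n * s < real n * t\<close> by (intro mult_left_mono clamp01_mono) auto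
  ultimately show ?thesis
    unfolding interpolate_def using j(3) by (auto intro!: sum_strict_mono_ex1)
qed

lemma interpolate_0:
  assumes "0 < n" shows "interpolate n v 0 = v 0"
  using interpolate_piece[of 0 n 0 v] assms by simp

lemma interpolate_1:
  assumes "0 < n" shows "interpolate n v 1 = v n"
  using interpolate_piece[of "n - 1" n 1 v] assms by (simp add: of_nat_diff)

section \<open>Exterior maps\<close>

text \<open>
  The last condition makes \<open>\<psi>\<close> proper and determines its winding numbers; it survives composition with
  maps at bounded distance from the identity.  The factor 1/2 is that of the Joukowski map below.
\<close>

definition exterior_map :: "complex set \<Rightarrow> (complex \<Rightarrow> complex) \<Rightarrow> bool" where
  "exterior_map K \<psi> \<longleftrightarrow>
     continuous_on {z. 1 \<le> norm z} \<psi> \<and> inj_on \<psi> {z. 1 < norm z} \<and> \<psi> ` {z. 1 < norm z} = - K \<and>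
     (\<exists>B. \<forall>z. 1 \<le> norm z \<longrightarrow> norm (\<psi> z - z / 2) \<le> B)"

section \<open>Topological consequences of an exterior map\<close>

lemma closed_exterior: "closed {z::complex. 1 \<le> norm z}"
  by (intro closed_Collect_le continuous_intros)

lemma open_exterior: "open {z::complex. 1 < norm z}"
  by (intro open_Collect_less continuous_intros)

text \<open>By the bound \<open>B\<close>, only points of modulus at most 2 (|y| + 1 + B) are mapped
  into the unit ball around \<open>y\<close>. Near \<open>y\<close> the image of \<open>C\<close> is
  therefore the image of a compact set.\<close>

lemma exterior_map_closed_image:
  assumes "exterior_map K \<psi>" "closed C" "C \<subseteq> {z. 1 \<le> norm z}"
  shows "closed (\<psi> ` C)"
proof -
  obtain B where B: "\<And>z. 1 \<le> norm z \<Longrightarrow> norm (\<psi> z - z / 2) \<le> B"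
    using assms(1) unfolding exterior_map_def by blast
  have "y \<in> \<psi> ` C" if "y \<in> closure (\<psi> ` C)" for y
  proof -
    let ?D = "C \<inter> cball 0 (2 * (norm y + 1 + B))"
    have "\<psi> ` C \<inter> ball y 1 \<subseteq> \<psi> ` ?D"
    proof clarify
      fix z assume z: "z \<in> C" "\<psi> z \<in> ball y 1"
      have "norm (z / 2) \<le> norm (\<psi> z) + norm (\<psi> z - z / 2)"
        using norm_triangle_ineq4[of "\<psi> z" "\<psi> z - z / 2"] by simp
      moreover have "norm (\<psi> z) \<le> norm y + 1"
        using z(2) norm_triangle_ineq3[of y "\<psi> z"] by (simp add: dist_norm)
      ultimately have "norm (z / 2) \<le> norm y + 1 + B"
        using B[of z] z assms(3) by force
      then have "z \<in> ?D" using z(1) by (simp add: norm_divide)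
      then show "\<psi> z \<in> \<psi> ` ?D" by blast
    qed
    moreover have "compact (\<psi> ` ?D)"
    proof (rule compact_continuous_image)
      show "continuous_on ?D \<psi>"
        using assms(1,3) unfolding exterior_map_def by (meson continuous_on_subset inf.coboundedI1)
      show "compact ?D"
        using assms(2) by (intro closed_Int_compact compact_cball)
    qed
    ultimately have "closure (ball y 1 \<inter> \<psi> ` C) \<subseteq> \<psi> ` ?D"
      by (intro closure_minimal compact_imp_closed) auto
    moreover have "y \<in> ball y 1 \<inter> closure (\<psi> ` C)"
      using that by simp
    then have "y \<in> closure (ball y 1 \<inter> \<psi> ` C)"
      using open_Int_closure_subset[OF open_ball] by blast
    ultimately show ?thesis by blast
  qed
  then show ?thesis
    by (metis closure_subset_eq subsetI)
qed

text \<open>Invariance of domain makes the complement of \<open>K\<close> open.\<close>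

lemma exterior_map_closed:
  assumes "exterior_map K \<psi>" shows "closed K"
proof -
  have "open (\<psi> ` {z. 1 < norm z})"
    using assms open_exterior unfolding exterior_map_def
    by (intro invariance_of_domain) (auto intro: continuous_on_subset)
  then show ?thesis using assms by (simp add: exterior_map_def closed_def)
qed

text \<open>Pushing the exterior radially onto the unit circle retracts the plane to \<open>K\<close>.\<close>

lemma exterior_map_contractible:
  assumes \<psi>: "exterior_map K \<psi>" and sphere: "\<psi> ` sphere 0 1 \<subseteq> K"
  shows "contractible K"
proof -
  let ?E = "{z::complex. 1 \<le> norm z}"
  \<comment> \<open>Off \<open>K\<close> the preimage is unique. On the unit circle
    \<open>\<psi>\<close> may identify points, but its values lie in \<open>K\<close>, where
    \<open>r\<close> is the identity. In both cases \<open>r\<close> after \<open>\<psi>\<close> is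
    \<open>\<psi>\<close> after \<open>sgn\<close>.\<close>
  define r where "r w = (if w \<in> K then w else \<psi> (sgn (inv_into {z. 1 < norm z} \<psi> w)))" for w
  have r: "r (\<psi> z) = \<psi> (sgn z)" if "z \<in> ?E" for z
  proof (cases "norm z = 1")
    case True
    then have "\<psi> z \<in> K" using sphere by auto
    with True show ?thesis by (simp add: r_def sgn_div_norm)
  next
    case False
    then have z: "z \<in> {z. 1 < norm z}" using that by simp
    then have "\<psi> z \<notin> K" using \<psi> unfolding exterior_map_def by blast
    then show ?thesis
      using z \<psi> unfolding exterior_map_def r_def by (auto simp: inv_into_f_f)
  qed
  have sgn: "continuous_on ?E (\<lambda>z. \<psi> (sgn z))"
  proof (rule continuous_on_compose2[of ?E \<psi> ?E sgn])
    show "continuous_on ?E \<psi>" using \<psi> unfolding exterior_map_def by blast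
    show "continuous_on ?E sgn" by (intro continuous_on_sgn continuous_on_id) auto
  qed (auto simp: norm_sgn)
  \<comment> \<open>\<open>\<psi>\<close> maps closed subsets of the closed exterior to closed sets,
    so a closed preimage in the exterior descends to a closed preimage under
    \<open>r\<close>.\<close>
  have "continuous_on (\<psi> ` ?E) r"
    unfolding continuous_on_closed_invariant
  proof (intro allI impI)
    fix B :: "complex set" assume "closed B"
    then have "closed (?E \<inter> (\<lambda>z. \<psi> (sgn z)) -` B)"
      by (intro continuous_closed_preimage sgn closed_exterior)
    then have "closed (\<psi> ` (?E \<inter> (\<lambda>z. \<psi> (sgn z)) -` B))"
      by (rule exterior_map_closed_image[OF \<psi>]) auto
    moreover have "\<psi> ` (?E \<inter> (\<lambda>z. \<psi> (sgn z)) -` B) \<inter> \<psi> ` ?E = r -` B \<inter> \<psi> ` ?E"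
      using r by (auto simp: image_iff)
    ultimately show "\<exists>A. closed A \<and> A \<inter> \<psi> ` ?E = r -` B \<inter> \<psi> ` ?E"
      by blast
  qed
  moreover have "continuous_on K r"
    by (rule continuous_on_eq[of _ id]) (auto simp: r_def)
  moreover have "closed (\<psi> ` ?E)"
    using \<psi> closed_exterior by (rule exterior_map_closed_image) simp
  ultimately have "continuous_on (\<psi> ` ?E \<union> K) r"
    using exterior_map_closed[OF \<psi>] by (intro continuous_on_closed_Un)
  moreover have "- K \<subseteq> \<psi> ` ?E"
    using \<psi> unfolding exterior_map_def
    by (metis (no_types, lifting) Collect_mono image_mono less_imp_le)
  then have UNIV: "\<psi> ` ?E \<union> K = UNIV" by blast
  ultimately have "continuous_on UNIV r" by simp
  moreover have "r w \<in> K" for w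
  proof (cases "w \<in> K")
    case False
    then obtain z where "z \<in> ?E" "w = \<psi> z" using UNIV by blast
    moreover from this have "norm (sgn z) = 1" by (auto simp: norm_sgn)
    ultimately show ?thesis using r sphere by auto
  qed (simp add: r_def)
  moreover have "r w = w" if "w \<in> K" for w
    using that by (simp add: r_def)
  ultimately have "K retract_of UNIV"
    unfolding retract_of_def retraction_def by auto
  then show ?thesis
    using retract_of_contractible contractible_UNIV by blast
qed

text \<open>The circle of radius 2 is moved outwards, its image avoiding \<open>p\<close>
  throughout, until the bound \<open>B\<close> allows \<open>\<psi>\<close> to be replaced by z/2.
  What remains is the winding number of a round circle.\<close>

lemma exterior_map_winding_number:
  assumes \<psi>: "exterior_map K \<psi>" and p: "p \<in> K"
  shows "winding_number (\<psi> \<circ> circlepath 0 2) p = 1"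
proof -
  obtain B where B: "\<And>z. 1 \<le> norm z \<Longrightarrow> norm (\<psi> z - z / 2) \<le> B"
    using \<psi> unfolding exterior_map_def by blast
  have cont: "continuous_on {z. 1 \<le> norm z} \<psi>"
    using \<psi> unfolding exterior_map_def by blast
  have p': "\<psi> z \<noteq> p" if "1 < norm z" for z
    using \<psi> p that unfolding exterior_map_def by blast
  have "0 \<le> B" using B[of 1] order_trans[OF norm_ge_zero] by fastforce
  \<comment> \<open>Half of \<open>R\<close> exceeds B + |p|, so the image of the circle of radius
    \<open>R\<close> is nearer to the circle of radius R/2 than that circle is to
    \<open>p\<close>.\<close>
  define R where "R = 2 * (B + norm p + 1)"
  have R: "2 \<le> R" "B + norm p < R / 2" using \<open>0 \<le> B\<close> by (auto simp: R_def)
  have norm_circle: "norm (circlepath 0 r x) = r" if "0 \<le> r" for r x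
    using that by (simp add: circlepath norm_mult)
  have "homotopic_loops (- {p}) (\<psi> \<circ> circlepath 0 2) (\<psi> \<circ> circlepath 0 R)"
    unfolding homotopic_loops
  proof (intro exI[of _ "\<lambda>y. \<psi> (circlepath 0 ((1 - fst y) * 2 + fst y * R) (snd y))"] conjI ballI)
    let ?h = "\<lambda>y::real\<times>real. circlepath 0 ((1 - fst y) * 2 + fst y * R) (snd y)"
    have ge: "2 \<le> (1 - t) * 2 + t * R" if "t \<in> {0..1}" for t
      using that R(1) mult_left_mono[of 2 R t] by (simp add: algebra_simps)
    have h: "1 < norm (?h y)" if "y \<in> {0..1} \<times> {0..1}" for y
      using that ge[of "fst y"] by (subst norm_circle) auto
    show "continuous_on ({0..1} \<times> {0..1}) (\<lambda>y. \<psi> (?h y))"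
      using h by (intro continuous_on_compose2[OF cont]) (auto simp: circlepath less_imp_le intro!: continuous_intros)
    show "(\<lambda>y. \<psi> (?h y)) \<in> {0..1} \<times> {0..1} \<rightarrow> - {p}"
      using h p' by blast
    fix t :: real assume t: "t \<in> {0..1}"
    show "pathfinish ((\<lambda>y. \<psi> (?h y)) \<circ> Pair t) = pathstart ((\<lambda>y. \<psi> (?h y)) \<circ> Pair t)"
      by (simp add: pathfinish_def pathstart_def circlepath exp_eq_1)
  qed auto
  then have "winding_number (\<psi> \<circ> circlepath 0 2) p = winding_number (\<psi> \<circ> circlepath 0 R) p"
    by (rule winding_number_homotopic_loops)
  also have "\<dots> = winding_number (circlepath 0 (R / 2)) p"
  proof (rule winding_number_nearby_loops_eq)
    show "path (\<psi> \<circ> circlepath 0 R)"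
      using R norm_circle[of R]
      by (intro path_continuous_image continuous_on_subset[OF cont]) (auto simp: path_image_def)
    show "pathfinish (\<psi> \<circ> circlepath 0 R) = pathstart (\<psi> \<circ> circlepath 0 R)"
      by (simp add: pathfinish_compose pathstart_compose)
    fix x :: real
    have half: "circlepath 0 (R / 2) x = circlepath 0 R x / 2"
      by (simp add: circlepath)
    have "norm (\<psi> (circlepath 0 R x) - circlepath 0 R x / 2) \<le> B"
      using B norm_circle[of R x] R by auto
    moreover have "R / 2 - norm p \<le> norm (circlepath 0 R x / 2 - p)"
      using norm_triangle_ineq2[of "circlepath 0 R x / 2" p] norm_circle[of R x] R
      by (simp add: norm_divide)
    ultimately show "norm ((\<psi> \<circ> circlepath 0 R) x - circlepath 0 (R / 2) x) < norm (circlepath 0 (R / 2) x - p)"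
      using R(2) unfolding half o_def by linarith
  qed auto
  also have "\<dots> = 1"
    using R \<open>0 \<le> B\<close> by (intro winding_number_circlepath) auto
  finally show ?thesis .
qed

text \<open>Attaching something to \<open>K\<close> amounts to shrinking the parameter domain: the
  part of the exterior that \<open>\<theta>\<close> misses is what \<open>\<psi>\<close> adds to
  \<open>K\<close>. The displacement \<open>C\<close> of \<open>\<theta>\<close> enters the new
  bound with the factor 1/2.\<close>

lemma exterior_map_compose:
  assumes \<psi>: "exterior_map K \<psi>"
    and cont: "continuous_on {z. 1 \<le> norm z} \<theta>" and ge: "\<And>z. 1 \<le> norm z \<Longrightarrow> 1 \<le> norm (\<theta> z)"
    and inj: "inj_on \<theta> {z. 1 < norm z}" and gt: "\<And>z. 1 < norm z \<Longrightarrow> 1 < norm (\<theta> z)"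
    and bound: "\<And>z. 1 \<le> norm z \<Longrightarrow> norm (\<theta> z - z) \<le> C"
  shows "exterior_map (K \<union> \<psi> ` ({z. 1 < norm z} - \<theta> ` {z. 1 < norm z})) (\<psi> \<circ> \<theta>)"
proof -
  let ?E = "{z::complex. 1 < norm z}"
  obtain B where B: "\<And>z. 1 \<le> norm z \<Longrightarrow> norm (\<psi> z - z / 2) \<le> B"
    using \<psi> unfolding exterior_map_def by blast
  have "continuous_on {z. 1 \<le> norm z} (\<psi> \<circ> \<theta>)"
  proof (rule continuous_on_compose[OF cont])
    show "continuous_on (\<theta> ` {z. 1 \<le> norm z}) \<psi>"
      using \<psi> unfolding exterior_map_def
      by (rule_tac continuous_on_subset[of "{z. 1 \<le> norm z}"]) (use ge in auto)
  qed
  moreover have "inj_on (\<psi> \<circ> \<theta>) ?E"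
  proof (rule comp_inj_on[OF inj])
    show "inj_on \<psi> (\<theta> ` ?E)"
      using \<psi> unfolding exterior_map_def by (rule_tac inj_on_subset[of _ ?E]) (use gt in auto)
  qed
  moreover have "(\<psi> \<circ> \<theta>) ` ?E = - (K \<union> \<psi> ` (?E - \<theta> ` ?E))"
  proof -
    have sub: "\<theta> ` ?E \<subseteq> ?E" using gt by auto
    have \<psi>': "\<psi> ` ?E = - K" "inj_on \<psi> ?E" using \<psi> unfolding exterior_map_def by auto
    have "\<psi> ` (?E - \<theta> ` ?E) = \<psi> ` ?E - \<psi> ` (\<theta> ` ?E)"
      using \<psi>' sub by (intro inj_on_image_set_diff[OF \<psi>'(2)]) auto
    then show ?thesis
      using \<psi>' image_mono[OF sub, of \<psi>] by (auto simp: image_comp)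
  qed
  moreover have "norm ((\<psi> \<circ> \<theta>) z - z / 2) \<le> B + C / 2" if "1 \<le> norm z" for z
  proof -
    have "(\<psi> \<circ> \<theta>) z - z / 2 = (\<psi> (\<theta> z) - \<theta> z / 2) + (\<theta> z - z) / 2"
      by (simp add: field_simps)
    also have "norm \<dots> \<le> norm (\<psi> (\<theta> z) - \<theta> z / 2) + norm ((\<theta> z - z) / 2)"
      by (rule norm_triangle_ineq)
    also have "\<dots> \<le> B + C / 2"
      using B[OF ge[OF that]] bound[OF that] by (simp add: norm_divide)
    finally show ?thesis .
  qed
  ultimately show ?thesis unfolding exterior_map_def by blast
qed

section \<open>Exterior maps of a point and of a segment\<close>

lemma exterior_map_point:
  "exterior_map {0} (\<lambda>z. of_real ((norm z - 1) / (2 * norm z)) * z)"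
proof -
  let ?\<psi> = "\<lambda>z::complex. complex_of_real ((norm z - 1) / (2 * norm z)) * z"
  have n: "norm (?\<psi> z) = (norm z - 1) / 2" if "1 \<le> norm z" for z
  proof -
    have "z \<noteq> 0" using that by auto
    with that show ?thesis by (simp add: norm_mult del: of_real_divide of_real_mult of_real_diff)
  qed
  have "continuous_on {z. 1 \<le> norm z} ?\<psi>"
    by (intro continuous_intros) auto
  moreover have "inj_on ?\<psi> {z. 1 < norm z}"
  proof (rule inj_onI)
    fix z w :: complex
    assume zw: "z \<in> {z. 1 < norm z}" "w \<in> {z. 1 < norm z}" "?\<psi> z = ?\<psi> w"
    then have "norm z = norm w"
      using n[of z] n[of w] by auto
    with zw show "z = w" by auto
  qed
  moreover have "?\<psi> ` {z. 1 < norm z} = - {0}"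
  proof (intro subset_antisym subsetI)
    fix w assume "w \<in> ?\<psi> ` {z. 1 < norm z}"
    then obtain z where "1 < norm z" "w = ?\<psi> z" by auto
    then show "w \<in> - {0}" using n[of z] by auto
  next
    fix w :: complex assume "w \<in> - {0}"
    then have w: "0 < norm w" by simp
    \<comment> \<open>A modulus r is sent to (r - 1)/2, so the preimage of \<open>w\<close> has
      modulus 2|w| + 1 and the same argument.\<close>
    define z where "z = of_real ((2 * norm w + 1) / norm w) * w"
    have nz: "norm z = 2 * norm w + 1"
      using w by (simp add: z_def norm_mult del: of_real_divide of_real_mult of_real_add)
    have "?\<psi> z = of_real (((norm z - 1) / (2 * norm z)) * ((2 * norm w + 1) / norm w)) * w"
      by (simp add: z_def)
    also have "((norm z - 1) / (2 * norm z)) * ((2 * norm w + 1) / norm w) = 1"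
      using w unfolding nz by (simp add: field_simps add_nonneg_eq_0_iff)
    finally show "w \<in> ?\<psi> ` {z. 1 < norm z}"
      using w nz by (intro image_eqI[of _ _ z]) auto
  qed
  moreover have "norm (?\<psi> z - z / 2) \<le> 1 / 2" if "1 \<le> norm z" for z
  proof -
    have z: "norm z \<noteq> 0" using that by auto
    have "?\<psi> z - z / 2 = of_real ((norm z - 1) / (2 * norm z) - 1 / 2) * z"
      by (simp add: algebra_simps)
    also have "(norm z - 1) / (2 * norm z) - 1 / 2 = - 1 / (2 * norm z)"
      using z by (simp add: field_simps)
    finally show ?thesis
      using z by (simp add: norm_mult norm_divide)
  qed
  ultimately show ?thesis unfolding exterior_map_def by blast
qed

text \<open>The Joukowski map opens a segment into a circle.\<close>

lemma exterior_map_segment: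
  "exterior_map (of_real ` {-1..1}) (\<lambda>z. (z + inverse z) / 2)"
proof -
  let ?\<psi> = "\<lambda>z::complex. (z + inverse z) / 2"
  have eq: "z = w \<or> z * w = 1" if "?\<psi> z = ?\<psi> w" "z \<noteq> 0" "w \<noteq> 0" for z w
  proof -
    \<comment> \<open>Each value is taken at a point and at its inverse, of which at most one lies
      outside the disc.\<close>
    have "(z - w) * (z * w - 1) = 0"
      using that by (simp add: field_simps) algebra
    then show ?thesis by auto
  qed
  have cos: "?\<psi> (cis t) = of_real (cos t)" for t
    by (simp add: complex_eq_iff)
  have "continuous_on {z. 1 \<le> norm z} ?\<psi>"
    by (intro continuous_intros) auto
  moreover have "inj_on ?\<psi> {z. 1 < norm z}"
  proof (rule inj_onI)
    fix z w :: complex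
    assume zw: "z \<in> {z. 1 < norm z}" "w \<in> {z. 1 < norm z}" "?\<psi> z = ?\<psi> w"
    have "1 < norm z * norm w"
      using zw(1,2) by (simp add: less_1_mult)
    then have "z * w \<noteq> 1" by (metis norm_mult norm_one less_irrefl)
    moreover have "z \<noteq> 0" "w \<noteq> 0" using zw by auto
    ultimately show "z = w" using eq[OF zw(3)] by auto
  qed
  moreover have "?\<psi> ` {z. 1 < norm z} = - of_real ` {-1..1}"
  proof (intro subset_antisym subsetI)
    fix w assume "w \<in> ?\<psi> ` {z. 1 < norm z}"
    then obtain z where z: "1 < norm z" "w = ?\<psi> z" by auto
    show "w \<in> - of_real ` {-1..1}"
    proof
      assume "w \<in> of_real ` {-1..1}"
      then obtain x where "w = of_real x" "-1 \<le> x" "x \<le> 1" by auto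
      then have "w = ?\<psi> (cis (arccos x))" unfolding cos by (simp add: cos_arccos)
      then have "?\<psi> z = ?\<psi> (cis (arccos x))" using z(2) by simp
      moreover have "z \<noteq> 0" using z by auto
      ultimately have "z = cis (arccos x) \<or> z * cis (arccos x) = 1"
        using eq[of z "cis (arccos x)"] by auto
      then have "norm z = 1"
        by (metis mult.right_neutral norm_cis norm_mult norm_one)
      with z show False by simp
    qed
  next
    fix w :: complex assume w: "w \<in> - of_real ` {-1..1}"
    \<comment> \<open>A root of z^2 - 2wz + 1; the other root is its inverse. Neither lies on the
      unit circle, as that would put \<open>w\<close> on the segment.\<close>
    define z where "z = w + csqrt (w\<^sup>2 - 1)"
    have sq: "(csqrt (w\<^sup>2 - 1))\<^sup>2 = w\<^sup>2 - 1" by simp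
    have prod: "z * (w - csqrt (w\<^sup>2 - 1)) = 1"
      unfolding z_def using sq by (simp add: algebra_simps power2_eq_square)
    then have z0: "z \<noteq> 0" by auto
    have inv: "inverse z = w - csqrt (w\<^sup>2 - 1)"
      using prod by (simp add: inverse_unique)
    have wz: "w = ?\<psi> z" unfolding inv by (simp add: z_def)
    have "norm z \<noteq> 1"
    proof
      assume "norm z = 1"
      then have "z = cis (Arg z)"
        using rcis_cmod_Arg[of z] by (simp add: rcis_def)
      then have "w = of_real (cos (Arg z))" using wz cos by metis
      then show False using w by auto
    qed
    then consider "1 < norm z" | "1 < norm (inverse z)"
      using z0 by (auto simp: norm_inverse one_less_inverse_iff linorder_neq_iff)
    then show "w \<in> ?\<psi> ` {z. 1 < norm z}"
    proof cases
      case 2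
      moreover have "w = ?\<psi> (inverse z)" using wz by (simp add: add.commute)
      ultimately show ?thesis by blast
    qed (use wz in blast)
  qed
  moreover have "norm (?\<psi> z - z / 2) \<le> 1 / 2" if "1 \<le> norm z" for z
    using that by (simp add: add_divide_distrib norm_divide norm_inverse inverse_le_1_iff)
  ultimately show ?thesis unfolding exterior_map_def by blast
qed

text \<open>Continuity at the origin follows from the preservation of norms. The origin matters
  because the characteristic map of a cell starts with such a rotation of the whole closed
  disc.\<close>

lemma continuous_on_UNIV_rotate_circles:
  assumes "circle_rotation F" shows "continuous_on UNIV (rotate_circles F)"
proof -
  interpret circle_rotation F by fact
  have "isCont (rotate_circles F) z" for z
  proof (cases "z = 0")
    case True
    have "((\<lambda>z. norm (rotate_circles F z)) \<longlongrightarrow> 0) (at 0)"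
      unfolding norm_rotate_circles by (rule tendsto_norm_zero) (rule tendsto_ident_at)
    then have "(rotate_circles F \<longlongrightarrow> 0) (at 0)"
      by (rule tendsto_norm_zero_cancel)
    moreover have "rotate_circles F 0 = 0"
      by (simp add: rotate_circles_def polar_def)
    ultimately show ?thesis using True by (simp add: isCont_def)
  next
    case False
    then show ?thesis
      using continuous_on_rotate_circles by (simp add: continuous_on_eq_continuous_at open_Compl)
  qed
  then show ?thesis by (simp add: continuous_at_imp_continuous_on)
qed

lemma inj_rotate_circles:
  assumes "circle_rotation F" shows "inj (rotate_circles F)"
proof -
  interpret circle_rotation F by fact
  have "rotate_circles F z = 0 \<longleftrightarrow> z = 0" for z
    using norm_rotate_circles[of z] by (metis norm_eq_zero)
  then show ?thesis
    using inj_on_rotate_circles unfolding inj_on_def by (metis ComplI singletonD UNIV_I)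
qed

text \<open>
  The boundary circle is reparametrized by \<open>F\<close>.  Passing to a rotation outside the circle of
  radius 2 keeps the map at bounded distance from this rotation.
\<close>

definition blend :: "(real \<Rightarrow> real) \<Rightarrow> real \<Rightarrow> real \<Rightarrow> real \<Rightarrow> real" where
  "blend F \<delta> s r = (1 - clamp01 (r - 1)) * F s + clamp01 (r - 1) * (s + \<delta>)"

lemma blend_1 [simp]: "blend F \<delta> s 1 = F s"
  by (simp add: blend_def clamp01_simps)

lemma circle_rotation_blend:
  assumes "continuous_on {0..1} F" "\<And>s t. 0 \<le> s \<Longrightarrow> s < t \<Longrightarrow> t \<le> 1 \<Longrightarrow> F s < F t" "F 1 = F 0 + 1"
  shows "circle_rotation (blend F \<delta>)"
proof
  show "continuous_on ({0..1} \<times> {0<..}) (\<lambda>x. blend F \<delta> (fst x) (snd x))"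
    unfolding blend_def
    by (intro continuous_intros continuous_on_compose2[OF assms(1)]) auto
  show "blend F \<delta> s r < blend F \<delta> t r" if "0 \<le> s" "s < t" "t \<le> 1" for r s t
  proof (cases "clamp01 (r - 1) = 1")
    case True
    then show ?thesis using that by (simp add: blend_def)
  next
    case False
    then have "(1 - clamp01 (r - 1)) * F s < (1 - clamp01 (r - 1)) * F t"
      using assms(2)[OF that] clamp01_range(2)[of "r - 1"] by simp
    moreover have "clamp01 (r - 1) * (s + \<delta>) \<le> clamp01 (r - 1) * (t + \<delta>)"
      using that clamp01_range(1)[of "r - 1"] by (intro mult_left_mono) auto
    ultimately show ?thesis by (simp add: blend_def)
  qed
  show "blend F \<delta> 1 r = blend F \<delta> 0 r + 1" for r
    by (simp add: blend_def assms(3) algebra_simps)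
qed

text \<open>Up to radius 2 both terms have modulus at most 2; beyond it the blend has become the
  rotation.\<close>

lemma norm_rotate_circles_blend_diff:
  assumes "circle_rotation (blend F \<delta>)"
  shows "norm (rotate_circles (blend F \<delta>) z - cis (2 * pi * \<delta>) * z) \<le> 4"
proof -
  interpret circle_rotation "blend F \<delta>" by fact
  show ?thesis
  proof (cases "norm z \<le> 2")
    case True
    have "norm (rotate_circles (blend F \<delta>) z - cis (2 * pi * \<delta>) * z) \<le> norm z + norm z"
      using norm_triangle_ineq4[of "rotate_circles (blend F \<delta>) z" "cis (2 * pi * \<delta>) * z"]
      by (simp add: norm_mult)
    with True show ?thesis by simp
  next
    case False
    then have "blend F \<delta> (turn z) (norm z) = \<delta> + turn z"
      by (simp add: blend_def clamp01_simps)
    then have "rotate_circles (blend F \<delta>) z = cis (2 * pi * \<delta>) * polar (turn z) (norm z)"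
      by (simp add: rotate_circles_def cis_mult_polar)
    then show ?thesis by (simp add: polar_turn)
  qed
qed


section \<open>Attaching a cell in the exterior of the disc\<close>

definition raise :: "(real \<Rightarrow> real) \<Rightarrow> complex \<Rightarrow> complex" where
  "raise \<beta> z = polar (turn z) (norm z + \<beta> (turn z))"

text \<open>\<open>seam\<close> lets the height close up around the circle, and the bound 1 keeps
  \<open>raise\<close> at bounded distance from the identity.\<close>

locale bump =
  fixes \<beta> :: "real \<Rightarrow> real"
  assumes continuous: "continuous_on {0..1} \<beta>" and nonneg: "\<And>s. 0 \<le> \<beta> s"
    and le_1: "\<And>s. \<beta> s \<le> 1" and seam: "\<beta> 1 = \<beta> 0"
begin

lemma raise_polar:
  assumes "0 \<le> s" "s \<le> 1" "0 < r" shows "raise \<beta> (polar s r) = polar s (r + \<beta> s)"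
proof (cases "s = 1")
  case True
  then show ?thesis using assms turn_polar[of 0 r] by (simp add: raise_def seam)
next
  case False
  then show ?thesis using assms by (simp add: raise_def turn_polar norm_polar)
qed

lemma norm_raise: "norm (raise \<beta> z) = norm z + \<beta> (turn z)"
  using nonneg by (simp add: raise_def norm_polar)

lemma continuous_on_raise: "continuous_on {z. 1 \<le> norm z} (raise \<beta>)"
proof -
  have "continuous_on {z. norm z \<in> {1..}} (\<lambda>z. (\<lambda>s r. polar s (r + \<beta> s)) (turn z) (norm z))"
    by (rule continuous_on_polar_coordinates)
      (auto intro!: continuous_intros continuous_on_compose2[OF continuous] simp: seam)
  then show ?thesis by (simp add: raise_def[abs_def])
qed

lemma turn_raise:
  assumes "0 < norm z" shows "turn (raise \<beta> z) = turn z"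
  unfolding raise_def
  using turn_bounds[of z] add_pos_nonneg[OF assms nonneg] by (intro turn_polar)

lemma inj_on_raise: "inj_on (raise \<beta>) {z. 1 < norm z}"
proof (rule inj_onI)
  fix z w assume zw: "z \<in> {z. 1 < norm z}" "w \<in> {z. 1 < norm z}" and eq: "raise \<beta> z = raise \<beta> w"
  have "turn z = turn w"
    using turn_raise[of z] turn_raise[of w] zw eq by force
  moreover from this have "norm z = norm w"
    using norm_raise[of z] norm_raise[of w] eq by simp
  ultimately show "z = w" using polar_turn by metis
qed

lemma norm_raise_diff: "norm (raise \<beta> z - z) \<le> 1"
proof -
  have "raise \<beta> z - polar (turn z) (norm z) = polar (turn z) (\<beta> (turn z))"
    by (simp add: raise_def polar_def algebra_simps)
  then show ?thesis using nonneg le_1 by (simp add: polar_turn norm_polar)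
qed

text \<open>On the ray at angle s, \<open>raise\<close> is a translation by
  \<open>\<beta> s\<close>; it misses exactly the first piece of that length.\<close>

lemma raise_image:
  "{z. 1 < norm z} - raise \<beta> ` {z. 1 < norm z} = {polar s r |s r. 0 \<le> s \<and> s < 1 \<and> 1 < r \<and> r \<le> 1 + \<beta> s}"
  (is "?L = ?R")
proof (intro subset_antisym subsetI)
  fix w assume w: "w \<in> ?L"
  have "\<not> 1 < norm w - \<beta> (turn w)"
  proof
    assume *: "1 < norm w - \<beta> (turn w)"
    then have "raise \<beta> (polar (turn w) (norm w - \<beta> (turn w))) = w"
      using turn_bounds[of w] by (subst raise_polar) (auto simp: polar_turn)
    moreover have "1 < norm (polar (turn w) (norm w - \<beta> (turn w)))"
      using * by (simp add: norm_polar)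
    ultimately show False using w by (metis (mono_tags, lifting) DiffD2 image_eqI mem_Collect_eq)
  qed
  then show "w \<in> ?R"
    using w turn_bounds[of w] polar_turn[of w]
    by (intro CollectI exI[of _ "turn w"] exI[of _ "norm w"]) auto
next
  fix w assume "w \<in> ?R"
  then obtain s r where w: "w = polar s r" "0 \<le> s" "s < 1" "1 < r" "r \<le> 1 + \<beta> s" by auto
  then have turn: "turn w = s" and norm: "norm w = r" by (auto simp: turn_polar norm_polar)
  have "w \<notin> raise \<beta> ` {z. 1 < norm z}"
  proof
    assume "w \<in> raise \<beta> ` {z. 1 < norm z}"
    then obtain z where z: "1 < norm z" "w = raise \<beta> z" by auto
    then have "turn z = s" using turn turn_raise[of z] by force
    then have "r = norm z + \<beta> s" using norm norm_raise[of z] z by simp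
    then show False using w z by simp
  qed
  then show "w \<in> ?L" using norm w by simp
qed

end

text \<open>Only \<open>raise\<close> changes the image. The preceding rotation maps every circle
  onto itself and serves to distribute the darts of the new boundary evenly. The displacements are
  at most 1 and 4.\<close>

lemma exterior_map_raise:
  assumes \<psi>: "exterior_map K \<psi>" and \<beta>: "bump \<beta>" and F: "circle_rotation (blend F 0)"
  shows "exterior_map (K \<union> \<psi> ` {polar s r |s r. 0 \<le> s \<and> s < 1 \<and> 1 < r \<and> r \<le> 1 + \<beta> s})
           (\<psi> \<circ> (raise \<beta> \<circ> rotate_circles (blend F 0)))"
proof -
  interpret bump \<beta> by fact
  interpret F: circle_rotation "blend F 0" by fact
  let ?R = "rotate_circles (blend F 0)"
  have im: "?R ` {z. 1 < norm z} = {z. 1 < norm z}" "?R ` {z. 1 \<le> norm z} = {z. 1 \<le> norm z}"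
    using F.rotate_circles_image[of "{1<..}"] F.rotate_circles_image[of "{1..}"]
    by (simp_all add: subset_eq)
  have ge: "norm z \<le> norm ((raise \<beta> \<circ> ?R) z)" for z
    using nonneg by (simp add: norm_raise)
  have "exterior_map (K \<union> \<psi> ` ({z. 1 < norm z} - (raise \<beta> \<circ> ?R) ` {z. 1 < norm z})) (\<psi> \<circ> (raise \<beta> \<circ> ?R))"
  proof (rule exterior_map_compose[OF \<psi>, where C = 5])
    show "continuous_on {z. 1 \<le> norm z} (raise \<beta> \<circ> ?R)"
      by (intro continuous_on_compose continuous_on_subset[OF continuous_on_UNIV_rotate_circles[OF F]])
        (simp_all add: im continuous_on_raise)
    show "inj_on (raise \<beta> \<circ> ?R) {z. 1 < norm z}"
      by (intro comp_inj_on inj_on_subset[OF inj_rotate_circles[OF F]]) (simp_all add: im inj_on_raise)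
    fix z :: complex
    show "norm ((raise \<beta> \<circ> ?R) z - z) \<le> 5"
      using norm_raise_diff[of "?R z"] norm_rotate_circles_blend_diff[OF F, of z]
        norm_triangle_ineq[of "raise \<beta> (?R z) - ?R z" "?R z - z"] by simp
  qed (use ge order_trans order.strict_trans2 in blast)+
  moreover have "(raise \<beta> \<circ> ?R) ` {z. 1 < norm z} = raise \<beta> ` {z. 1 < norm z}"
    by (metis im(1) image_comp)
  ultimately show ?thesis by (simp only: raise_image)
qed


section \<open>Attaching a segment in the exterior of the disc\<close>

text \<open>
  The half of the unit circle around 1 is first lifted to a tent of height 1 over the point 1, then the
  circles are stretched away from -1 until the two sides of the tent become the two sides of the
  segment from 1 to 2.
\<close>

definition slit_radius :: "real \<Rightarrow> real \<Rightarrow> real" where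
  "slit_radius s r = r + max 0 (2 * \<bar>2 * s - 1\<bar> - 1)"

text \<open>Above the tent, a circle of radius \<rho> between 1 and 2 keeps only the angles with |2s
  - 1| < \<rho>/2. Dividing by \<rho>/2 opens this arc to a full circle about -1, whose two ends
  meet at the positive real axis. From radius 2 on nothing is stretched.\<close>

definition slit_angle :: "real \<Rightarrow> real \<Rightarrow> real" where
  "slit_angle s r = ((2 * s - 1) / min 1 (slit_radius s r / 2) + 1) / 2"

definition slit :: "complex \<Rightarrow> complex" where
  "slit z = polar (slit_angle (turn z) (norm z)) (slit_radius (turn z) (norm z))"

lemma slit_radius_ge: "r \<le> slit_radius s r"
  by (simp add: slit_radius_def)

lemma slit_seam: "1 \<le> r \<Longrightarrow> slit_angle 0 r = 0" "1 \<le> r \<Longrightarrow> slit_angle 1 r = 1"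
    "slit_radius 0 r = r + 1" "slit_radius 1 r = r + 1"
  by (auto simp: slit_angle_def slit_radius_def)

lemma slit_polar:
  assumes "0 \<le> s" "s \<le> 1" "1 \<le> r" shows "slit (polar s r) = polar (slit_angle s r) (slit_radius s r)"
proof (cases "s = 1")
  case True
  then show ?thesis using assms turn_polar[of 0 r] by (simp add: slit_def slit_seam)
next
  case False
  then show ?thesis using assms by (simp add: slit_def turn_polar norm_polar)
qed

lemma norm_slit: "norm (slit z) = slit_radius (turn z) (norm z)"
  unfolding slit_def by (rule norm_polar) (rule order_trans[OF norm_ge_zero slit_radius_ge])

lemma continuous_on_slit: "continuous_on {z. 1 \<le> norm z} slit"
proof -
  have "continuous_on {z. norm z \<in> {1..}} (\<lambda>z. (\<lambda>s r. polar (slit_angle s r) (slit_radius s r)) (turn z) (norm z))"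
  proof (rule continuous_on_polar_coordinates)
    have rad: "continuous_on ({0..1} \<times> {1..}) (\<lambda>x::real\<times>real. slit_radius (fst x) (snd x))"
      unfolding slit_radius_def by (intro continuous_intros)
    have "min 1 (slit_radius s r / 2) \<noteq> 0" if "1 \<le> r" for s r
      using that slit_radius_ge[of r s] by (simp add: min_def)
    then show "continuous_on ({0..1} \<times> {1..})
      (\<lambda>x. polar (slit_angle (fst x) (snd x)) (slit_radius (fst x) (snd x)))"
      unfolding slit_angle_def by (intro continuous_intros rad) auto
  qed (auto simp: slit_seam)
  then show ?thesis by (simp add: slit_def[abs_def])
qed

lemma slit_angle_range:
  assumes "0 \<le> s" "s < 1" "1 < r"
  shows "0 \<le> slit_angle s r" "slit_angle s r < 1"
proof -
  let ?m = "min 1 (slit_radius s r / 2)"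
  have m: "0 < ?m" "\<bar>2 * s - 1\<bar> \<le> ?m" "2 * s - 1 < ?m"
    using assms by (auto simp: slit_radius_def min_def max_def abs_if split: if_splits)
  have "-1 \<le> (2 * s - 1) / ?m" using m(2) unfolding pos_le_divide_eq[OF m(1)] by linarith
  then show "0 \<le> slit_angle s r" by (simp add: slit_angle_def)
  have "(2 * s - 1) / ?m < 1" using m(3) unfolding pos_divide_less_eq[OF m(1)] by linarith
  then show "slit_angle s r < 1" by (simp add: slit_angle_def)
qed

lemma turn_slit: "1 < norm z \<Longrightarrow> turn (slit z) = slit_angle (turn z) (norm z)"
  unfolding slit_def
  using slit_angle_range[of "turn z" "norm z"] turn_bounds[of z] slit_radius_ge[of "norm z" "turn z"]
  by (intro turn_polar) auto

lemma inj_on_slit: "inj_on slit {z. 1 < norm z}"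
proof (rule inj_onI)
  fix z w assume zw: "z \<in> {z. 1 < norm z}" "w \<in> {z. 1 < norm z}" and eq: "slit z = slit w"
  have rad: "slit_radius (turn z) (norm z) = slit_radius (turn w) (norm w)"
    using eq norm_slit by metis
  have "slit_angle (turn z) (norm z) = slit_angle (turn w) (norm w)"
    using eq turn_slit zw by (metis mem_Collect_eq)
  moreover have "0 < min 1 (slit_radius (turn w) (norm w) / 2)"
    using slit_radius_ge[of "norm w" "turn w"] zw by auto
  ultimately have "turn z = turn w"
    unfolding slit_angle_def rad by (auto simp: field_simps)
  moreover from this have "norm z = norm w"
    using rad by (simp add: slit_radius_def)
  ultimately show "z = w" using polar_turn by metis
qed

text \<open>Up to radius 2 the moduli are at most 2 and 3; beyond it the angle is unchanged and the
  radius grows by at most 1.\<close>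

lemma norm_slit_diff:
  assumes "1 \<le> norm z" shows "norm (slit z - z) \<le> 5"
proof -
  have rad: "slit_radius (turn z) (norm z) \<le> norm z + 1"
    using turn_bounds[of z] by (auto simp: slit_radius_def)
  show ?thesis
  proof (cases "norm z \<le> 2")
    case True
    then show ?thesis
      using norm_triangle_ineq4[of "slit z" z] rad norm_slit[of z] by simp
  next
    case False
    then have "min 1 (slit_radius (turn z) (norm z) / 2) = 1"
      using slit_radius_ge[of "norm z" "turn z"] by simp
    then have "slit_angle (turn z) (norm z) = turn z"
      unfolding slit_angle_def by simp
    then have "slit z - polar (turn z) (norm z) = polar (turn z) (slit_radius (turn z) (norm z) - norm z)"
      by (simp add: slit_def polar_def algebra_simps)
    then have "norm (slit z - z) = slit_radius (turn z) (norm z) - norm z"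
      using slit_radius_ge[of "norm z" "turn z"] by (simp add: polar_turn norm_polar)
    then show ?thesis using rad by simp
  qed
qed

lemma slit_image:
  "{z. 1 < norm z} - slit ` {z. 1 < norm z} = {of_real r |r. 1 < r \<and> r \<le> 2}" (is "?L = ?R")
proof (intro subset_antisym subsetI)
  fix w assume w: "w \<in> ?L"
  define y where "y = norm w"
  define x where "x = 2 * turn w - 1"
  have y: "1 < y" using w by (simp add: y_def)
  have x: "- 1 \<le> x" "x < 1" using turn_bounds[of w] by (auto simp: x_def)
  show "w \<in> ?R"
  proof (cases "x = - 1 \<and> y \<le> 2")
    case True
    then have "turn w = 0" by (simp add: x_def)
    then have "w = of_real y" using polar_turn[of w] by (simp add: y_def)
    then show ?thesis using True y by auto
  next
    case False
    \<comment> \<open>The stretching factor depends on the final radius alone, so it can be undone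
      from \<open>w\<close>. This gives the angle \<open>s\<close>, and the tent height there gives
      the initial radius \<open>r\<close>, which exceeds 1 unless \<open>w\<close> lies on the
      slit.\<close>
    define m where "m = min 1 (y / 2)"
    define s where "s = (x * m + 1) / 2"
    define r where "r = y - max 0 (2 * \<bar>x * m\<bar> - 1)"
    have m: "1 / 2 < m" "m \<le> 1" "m \<le> y / 2" using y by (auto simp: m_def)
    have xm: "\<bar>x * m\<bar> \<le> m" "\<bar>x * m\<bar> \<le> \<bar>x\<bar>" "x * m < m"
      using x m mult_left_le[of m "\<bar>x\<bar>"] by (auto simp: abs_mult mult_le_cancel_right1)
    have r: "1 < r"
    proof (cases "\<bar>x * m\<bar> \<le> 1 / 2")
      case True
      then show ?thesis using y by (simp add: r_def)
    next
      case f: False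
      have "2 * \<bar>x * m\<bar> < y"
      proof (cases "y \<le> 2")
        case True
        then have "\<bar>x\<bar> < 1" using False x by auto
        then have "\<bar>x * m\<bar> < m" using m by (simp add: abs_mult)
        then show ?thesis using m by linarith
      next
        case False
        then show ?thesis using xm(2) x by linarith
      qed
      then show ?thesis using f by (simp add: r_def)
    qed
    have s: "0 \<le> s" "s < 1"
      using xm m less_le_trans[OF xm(3) m(2)] by (auto simp: s_def abs_le_iff)
    have sx: "2 * s - 1 = x * m" by (simp add: s_def field_simps)
    have "slit_radius s r = y" by (simp add: slit_radius_def sx r_def)
    moreover have "slit_angle s r = turn w"
      unfolding slit_angle_def \<open>slit_radius s r = y\<close> m_def[symmetric] sx using m
      by (simp add: x_def)
    ultimately have "slit (polar s r) = w"
      using s r by (simp add: slit_polar y_def polar_turn)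
    moreover have "1 < norm (polar s r)" using r by (simp add: norm_polar)
    ultimately show ?thesis using w by blast
  qed
next
  fix w assume "w \<in> ?R"
  then obtain y where y: "1 < y" "y \<le> 2" "w = of_real y" by auto
  have "w \<notin> slit ` {z. 1 < norm z}"
  proof
    assume "w \<in> slit ` {z. 1 < norm z}"
    then obtain z where z: "1 < norm z" "w = slit z" by auto
    have "turn w = 0" using turn_polar[of 0 y] y by simp
    then have "slit_angle (turn z) (norm z) = 0" using z turn_slit[of z] by simp
    moreover have "norm w = y" using y by simp
    then have rad: "slit_radius (turn z) (norm z) = y" using z norm_slit[of z] by simp
    ultimately have "(2 * turn z - 1) / min 1 (y / 2) = - 1"
      by (simp add: slit_angle_def)
    then have "1 - 2 * turn z = min 1 (y / 2)" using y by (simp add: field_simps split: if_splits)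
    then have "slit_radius (turn z) (norm z) = norm z + (y - 1)"
      using y by (simp add: slit_radius_def abs_if min_def split: if_splits)
    then show False using rad z by simp
  qed
  then show "w \<in> ?L" using y by simp
qed

text \<open>This half of the circle is the tent: it runs from 1 to the tip 2, reached at angle 0,
  and back on the other side of the segment.\<close>

lemma slit_circle_spike:
  assumes "\<bar>s\<bar> \<le> 1 / 4" shows "slit (polar s 1) = of_real (2 - 4 * \<bar>s\<bar>)"
proof (cases "0 \<le> s")
  case True
  then have "slit_radius s 1 = 2 - 4 * s" using assms by (simp add: slit_radius_def)
  moreover have "slit_angle s 1 = 0"
    unfolding slit_angle_def \<open>slit_radius s 1 = 2 - 4 * s\<close> using True assms
    by (simp add: min_def field_simps)
  ultimately show ?thesis using True assms by (simp add: slit_polar)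
next
  case False
  then have "slit_radius (s + 1) 1 = 2 + 4 * s" using assms by (simp add: slit_radius_def)
  moreover have "slit_angle (s + 1) 1 = 1"
    unfolding slit_angle_def \<open>slit_radius (s + 1) 1 = 2 + 4 * s\<close> using False assms
    by (simp add: min_def field_simps)
  ultimately have "slit (polar (s + 1) 1) = of_real (2 + 4 * s)" using False assms
    by (subst slit_polar) auto
  then show ?thesis using False by (simp add: polar_add_one)
qed

text \<open>The other half of the circle is opened to a full circle, hence the doubled angle, which
  is 0 for s = 1/4. A negative s is first raised by one turn, which changes the doubled angle by
  two.\<close>

lemma slit_circle:
  assumes "1 / 4 \<le> \<bar>s\<bar>" "\<bar>s\<bar> \<le> 3 / 4" shows "slit (polar s 1) = polar (2 * s - 1 / 2) 1"
proof -
  have *: "slit (polar s 1) = polar (2 * s - 1 / 2) 1" if "1 / 4 \<le> s" "s \<le> 3 / 4" for s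
  proof -
    have "slit_radius s 1 = 1" using that by (simp add: slit_radius_def abs_if)
    moreover have "slit_angle s 1 = 2 * s - 1 / 2"
      unfolding slit_angle_def \<open>slit_radius s 1 = 1\<close> by (simp add: field_simps)
    ultimately show ?thesis using that by (simp add: slit_polar)
  qed
  show ?thesis
  proof (cases "0 \<le> s")
    case True
    then show ?thesis using assms * by simp
  next
    case False
    then have "slit (polar (s + 1) 1) = polar (2 * (s + 1) - 1 / 2) 1" using assms by (intro *) auto
    also have "2 * (s + 1) - 1 / 2 = 2 * s - 1 / 2 + 1 + 1" by simp
    finally show ?thesis by (simp only: polar_add_one)
  qed
qed

text \<open>A slit at angle \<alpha> is the slit at angle 0 conjugated by a rotation. The rotation
  by -\<alpha> is taken as the rigid end of \<open>blend\<close>, so that the composite stays near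
  the identity: the displacement is at most 5 for the slit and 4 for the blend.\<close>

lemma exterior_map_slit:
  assumes \<psi>: "exterior_map K \<psi>" and F: "circle_rotation (blend F (- \<alpha>))"
  shows "exterior_map (K \<union> \<psi> ` {polar \<alpha> r |r. 1 < r \<and> r \<le> 2})
           (\<psi> \<circ> (\<lambda>z. cis (2 * pi * \<alpha>) * slit (rotate_circles (blend F (- \<alpha>)) z)))"
proof -
  interpret F: circle_rotation "blend F (- \<alpha>)" by fact
  let ?R = "rotate_circles (blend F (- \<alpha>))"
  let ?c = "cis (2 * pi * \<alpha>)"
  let ?\<theta> = "\<lambda>z. ?c * slit (?R z)"
  have im: "?R ` {z. 1 < norm z} = {z. 1 < norm z}" "?R ` {z. 1 \<le> norm z} = {z. 1 \<le> norm z}"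
    using F.rotate_circles_image[of "{1<..}"] F.rotate_circles_image[of "{1..}"]
    by (simp_all add: subset_eq)
  have c: "inj ((*) ?c)" "?c * cis (2 * pi * - \<alpha>) = 1"
    by (auto simp: inj_on_def cis_mult)
  have ge: "norm z \<le> norm (?\<theta> z)" for z
    using slit_radius_ge[of "norm (?R z)" "turn (?R z)"] by (simp add: norm_slit norm_mult)
  have "exterior_map (K \<union> \<psi> ` ({z. 1 < norm z} - ?\<theta> ` {z. 1 < norm z})) (\<psi> \<circ> ?\<theta>)"
  proof (rule exterior_map_compose[OF \<psi>, where C = 9])
    have "continuous_on {z. 1 \<le> norm z} (slit \<circ> ?R)"
      by (intro continuous_on_compose continuous_on_subset[OF continuous_on_UNIV_rotate_circles[OF F]])
        (simp_all add: im continuous_on_slit)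
    then show "continuous_on {z. 1 \<le> norm z} ?\<theta>"
      by (auto intro!: continuous_intros simp: o_def)
    have "inj_on ((*) ?c \<circ> (slit \<circ> ?R)) {z. 1 < norm z}"
      by (intro comp_inj_on inj_on_subset[OF inj_rotate_circles[OF F]] inj_on_subset[OF c(1)])
        (simp_all add: im inj_on_slit)
    then show "inj_on ?\<theta> {z. 1 < norm z}" by (simp add: o_def)
    fix z :: complex
    assume z: "1 \<le> norm z"
    have eq: "?\<theta> z - z = ?c * (slit (?R z) - ?R z) + ?c * (?R z - cis (2 * pi * - \<alpha>) * z)"
      using c(2) by (simp add: algebra_simps flip: mult.assoc)
    have "norm (?\<theta> z - z) \<le> norm (slit (?R z) - ?R z) + norm (?R z - cis (2 * pi * - \<alpha>) * z)"
      unfolding eq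
      using norm_triangle_ineq[of "?c * (slit (?R z) - ?R z)" "?c * (?R z - cis (2 * pi * - \<alpha>) * z)"]
      by (simp only: norm_mult norm_cis mult_1)
    moreover have "norm (slit (?R z) - ?R z) \<le> 5"
      using z by (intro norm_slit_diff) simp
    ultimately show "norm (?\<theta> z - z) \<le> 9"
      using norm_rotate_circles_blend_diff[OF F, of z] by linarith
  qed (use ge order_trans order.strict_trans2 in fast)+
  moreover have "{z. 1 < norm z} - ?\<theta> ` {z. 1 < norm z} = {polar \<alpha> r |r. 1 < r \<and> r \<le> 2}"
  proof -
    have "(*) ?c ` {z. 1 < norm z} = {z. 1 < norm z}"
    proof (intro subset_antisym subsetI)
      fix w :: complex assume "w \<in> {z. 1 < norm z}"
      then show "w \<in> (*) ?c ` {z. 1 < norm z}"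
        using c(2)
        by (intro image_eqI[of _ _ "cis (2 * pi * - \<alpha>) * w"]) (auto simp: norm_mult cis_mult simp flip: mult.assoc)
    qed (auto simp: norm_mult)
    moreover have "(*) ?c ` (slit ` (?R ` {z. 1 < norm z})) = ?\<theta> ` {z. 1 < norm z}"
      by (simp only: image_image)
    ultimately have "{z. 1 < norm z} - ?\<theta> ` {z. 1 < norm z} =
        (*) ?c ` {z. 1 < norm z} - (*) ?c ` (slit ` {z. 1 < norm z})"
      by (simp only: im(1))
    also have "\<dots> = (*) ?c ` ({z. 1 < norm z} - slit ` {z. 1 < norm z})"
      by (rule image_set_diff[OF c(1), symmetric])
    also have "\<dots> = {polar \<alpha> r |r. 1 < r \<and> r \<le> 2}"
      unfolding slit_image by (auto simp: polar_def mult.commute)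
    finally show ?thesis .
  qed
  ultimately show ?thesis by simp
qed

section \<open>The characteristic map of the attached cell\<close>

text \<open>
  The cell occupies the angles from \<open>m - h\<close> to \<open>m + h\<close>.  The lower half of the unit circle
  is sent to an arc of the unit circle, the upper half to the graph of \<open>lens_height\<close>.
\<close>

definition lens_height :: "real \<Rightarrow> real \<Rightarrow> real \<Rightarrow> real" where
  "lens_height m h s = sqrt (max 0 (1 - ((s - m) / h)\<^sup>2))"

text \<open>Each vertical chord of the disc goes affinely, at half its length, onto a radial segment
  that starts on the unit circle.\<close>

definition lens :: "real \<Rightarrow> real \<Rightarrow> complex \<Rightarrow> complex" where
  "lens m h w = polar (m + h * Re w) (1 + (Im w + sqrt (1 - (Re w)\<^sup>2)) / 2)"

lemma bump_lens_height:
  assumes "0 < h" "h \<le> m" "m + h \<le> 1" shows "bump (lens_height m h)"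
proof
  have 1: "1 \<le> ((x - m) / h)\<^sup>2" if "h \<le> \<bar>x - m\<bar>" for x
  proof -
    have "1 \<le> \<bar>(x - m) / h\<bar>" using that assms(1) by (simp add: abs_divide)
    then show ?thesis by (metis abs_le_square_iff abs_one one_power2)
  qed
  show "lens_height m h 1 = lens_height m h 0"
    using 1[of 1] 1[of 0] assms by (simp add: lens_height_def)
  show "continuous_on {0..1} (lens_height m h)"
    unfolding lens_height_def using assms by (intro continuous_intros) auto
qed (auto simp: lens_height_def)

lemma lens_height_eq:
  assumes "h \<noteq> 0" "\<bar>x\<bar> \<le> 1" shows "lens_height m h (m + h * x) = sqrt (1 - x\<^sup>2)"
  using assms by (simp add: lens_height_def abs_square_le_1)

lemma abs_Im_le_sqrt:
  assumes "norm w \<le> 1" shows "\<bar>Im w\<bar> \<le> sqrt (1 - (Re w)\<^sup>2)"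
proof -
  have "(Im w)\<^sup>2 \<le> 1 - (Re w)\<^sup>2"
    using cmod_power2[of w] power_le_one[OF norm_ge_zero assms, of 2] by (simp add: algebra_simps)
  then show ?thesis by (metis real_sqrt_abs real_sqrt_le_mono)
qed

lemma abs_Im_less_sqrt:
  assumes "norm w < 1" shows "\<bar>Im w\<bar> < sqrt (1 - (Re w)\<^sup>2)"
proof -
  have "(norm w)\<^sup>2 < 1"
    using assms by (simp add: abs_square_less_1)
  then have "(Im w)\<^sup>2 < 1 - (Re w)\<^sup>2"
    using cmod_power2[of w] by (simp add: algebra_simps)
  then show ?thesis by (metis real_sqrt_abs real_sqrt_less_mono)
qed

lemma continuous_on_lens: "continuous_on S (lens m h)"
  unfolding lens_def by (intro continuous_intros) auto

lemma norm_lens: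
  assumes "norm w \<le> 1" shows "norm (lens m h w) = 1 + (Im w + sqrt (1 - (Re w)\<^sup>2)) / 2"
  unfolding lens_def
  by (rule norm_polar) (use abs_Im_le_sqrt[OF assms] in \<open>simp add: abs_le_iff\<close>)

lemma norm_lens_ge: "norm w \<le> 1 \<Longrightarrow> 1 \<le> norm (lens m h w)"
  using norm_lens[of w] abs_Im_le_sqrt[of w] by (simp add: abs_le_iff)

lemma norm_lens_gt: "norm w < 1 \<Longrightarrow> 1 < norm (lens m h w)"
  using norm_lens[of w] abs_Im_less_sqrt[of w] by (simp add: abs_less_iff)

lemma lens_angle:
  assumes "0 < h" "h \<le> m" "m + h \<le> 1" "norm w < 1"
  shows "0 \<le> m + h * Re w" "m + h * Re w < 1"
proof -
  have "\<bar>Re w\<bar> < 1" using assms(4) abs_Re_le_cmod[of w] by linarith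
  then have "\<bar>h * Re w\<bar> < h" using assms(1) by (simp add: abs_mult)
  then show "0 \<le> m + h * Re w" "m + h * Re w < 1" using assms by auto
qed

lemma inj_on_lens:
  assumes "0 < h" "h \<le> m" "m + h \<le> 1" shows "inj_on (lens m h) (ball 0 1)"
proof (rule inj_onI)
  fix w w' assume w: "w \<in> ball 0 1" "w' \<in> ball 0 1" and eq: "lens m h w = lens m h w'"
  let ?r = "\<lambda>w. 1 + (Im w + sqrt (1 - (Re w)\<^sup>2)) / 2"
  have "0 < ?r w" if "w \<in> ball 0 1" for w
  proof -
    have "0 < Im w + sqrt (1 - (Re w)\<^sup>2)"
      using abs_Im_less_sqrt[of w] that by (simp add: abs_less_iff)
    then show ?thesis by (rule add_pos_pos[OF zero_less_one half_gt_zero])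
  qed
  then have "0 < ?r w" "0 < ?r w'" using w by auto
  then have "m + h * Re w = m + h * Re w' \<and> ?r w = ?r w'"
    using eq lens_angle[OF assms, of w] lens_angle[OF assms, of w'] w unfolding lens_def
    by (subst (asm) polar_eq_iff) auto
  then have "Re w = Re w'" and "?r w = ?r w'" using assms(1) by auto
  then show "w = w'" by (simp add: complex_eq_iff)
qed

lemma lens_cases:
  assumes h: "0 < h" "h \<le> m" "m + h \<le> 1" and w: "norm w \<le> 1"
  shows "norm (lens m h w) = 1 \<or>
    lens m h w \<in> {polar s r |s r. 0 \<le> s \<and> s < 1 \<and> 1 < r \<and> r \<le> 1 + lens_height m h s}"
proof (cases "norm (lens m h w) = 1")
  case False
  let ?s = "m + h * Re w"
  let ?r = "1 + (Im w + sqrt (1 - (Re w)\<^sup>2)) / 2"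
  have Re: "\<bar>Re w\<bar> \<le> 1" using w abs_Re_le_cmod[of w] by linarith
  have r: "1 < ?r" using False norm_lens_ge[OF w, of m h] norm_lens[OF w] by simp
  moreover have "?r \<le> 1 + lens_height m h ?s"
    using abs_Im_le_sqrt[OF w] h Re by (simp add: lens_height_eq)
  moreover have "\<bar>h * Re w\<bar> \<le> h" using Re h by (simp add: abs_mult mult_left_le)
  then have "0 \<le> ?s" "?s \<le> 1" using h by auto
  \<comment> \<open>The region uses angles in [0,1). The angle 1 could be reached only at the right
    end of the disc, where the lens has height 0.\<close>
  moreover have "?s \<noteq> 1"
  proof
    assume "?s = 1"
    then have "h * 1 \<le> h * Re w" using h by linarith
    then have "1 \<le> Re w" using h(1) by (simp only: mult_le_cancel_left_pos)
    then have "Re w = 1" using Re by simp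
    then show False using r abs_Im_le_sqrt[OF w] by simp
  qed
  ultimately show ?thesis unfolding lens_def by fastforce
qed simp

lemma lens_onto:
  assumes h: "0 < h" and s: "1 < r" "r \<le> 1 + lens_height m h s"
  shows "\<exists>w. norm w \<le> 1 \<and> lens m h w = polar s r"
proof -
  define x where "x = (s - m) / h"
  have s_eq: "s = m + h * x" using h by (simp add: x_def)
  have "0 < lens_height m h s" using s by simp
  then have "x\<^sup>2 < 1" by (auto simp: lens_height_def x_def max_def split: if_splits)
  then have x: "\<bar>x\<bar> \<le> 1" by (simp add: abs_square_less_1 less_imp_le)
  have height: "lens_height m h s = sqrt (1 - x\<^sup>2)"
    unfolding s_eq using h x by (simp add: lens_height_eq)
  \<comment> \<open>Solves the equation for the radius in \<open>lens\<close>; the positive height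
    has already forced |x| < 1.\<close>
  define y where "y = 2 * (r - 1) - sqrt (1 - x\<^sup>2)"
  have "\<bar>y\<bar> \<le> sqrt (1 - x\<^sup>2)" using s height by (simp add: y_def)
  then have "y\<^sup>2 \<le> 1 - x\<^sup>2" using \<open>x\<^sup>2 < 1\<close>
    by (metis abs_ge_zero less_imp_le diff_ge_0_iff_ge power2_abs power_mono real_sqrt_pow2)
  then have "norm (Complex x y) \<le> 1" by (simp add: cmod_def)
  moreover have "lens m h (Complex x y) = polar s r"
    by (simp add: lens_def s_eq y_def diff_divide_distrib)
  ultimately show ?thesis by blast
qed

text \<open>
  Parametrizes the unit circle such that \<open>k\<close> of \<open>k + 1\<close> equal parts are sent, at constant
  horizontal speed, to the lower half circle from -1 to 1, and the last one to the upper half.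
\<close>

definition half_circles :: "nat \<Rightarrow> real \<Rightarrow> real" where
  "half_circles k s =
     1 / 2 + (arccos (1 - 2 * clamp01 (s * (real k + 1) / real k)) / pi +
              arccos (1 - 2 * clamp01 ((real k + 1) * s - real k)) / pi) / 2"

lemma arccos_strict: "0 \<le> s \<Longrightarrow> s < t \<Longrightarrow> t \<le> 1 \<Longrightarrow> arccos (1 - 2 * s) < arccos (1 - 2 * t)"
  by (intro arccos_less_arccos) auto

lemma arccos_clamp_mono: "s \<le> t \<Longrightarrow> arccos (1 - 2 * clamp01 s) \<le> arccos (1 - 2 * clamp01 t)"
  using clamp01_range[of s] clamp01_range[of t] clamp01_mono[of s t] by (intro arccos_le_arccos) auto

lemma circle_rotation_half_circles:
  assumes k: "0 < k" shows "circle_rotation (\<lambda>s r. half_circles k s)"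
proof
  have "continuous_on UNIV (\<lambda>s. half_circles k s)"
    unfolding half_circles_def
  proof (intro continuous_intros ballI conjI)
    fix x :: real
    show "- 1 \<le> 1 - 2 * clamp01 (x * (real k + 1) / real k)" "1 - 2 * clamp01 (x * (real k + 1) / real k) \<le> 1"
      "- 1 \<le> 1 - 2 * clamp01 ((real k + 1) * x - real k)" "1 - 2 * clamp01 ((real k + 1) * x - real k) \<le> 1"
      using clamp01_range by auto
  qed (use k in auto)
  then show "continuous_on ({0..1} \<times> {0<..}) (\<lambda>x::real\<times>real. half_circles k (fst x))"
    by (rule continuous_on_compose2) (auto intro!: continuous_intros)
  show "half_circles k s < half_circles k t" if st: "0 \<le> s" "s < t" "t \<le> 1" for s t
  proof -
    let ?f = "\<lambda>s. s * (real k + 1) / real k" and ?g = "\<lambda>s. (real k + 1) * s - real k"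
    let ?A = "\<lambda>x. arccos (1 - 2 * clamp01 x)"
    have fg: "?f s < ?f t" "?g s < ?g t" using st k by (auto simp: divide_strict_right_mono)
    have "?A (?f s) + ?A (?g s) < ?A (?f t) + ?A (?g t)"
    proof (cases "?f s < 1")
      case True
      have "0 \<le> ?f s" using st by simp
      have "clamp01 (?f s) < clamp01 (?f t)"
        using True \<open>0 \<le> ?f s\<close> fg unfolding clamp01_def by linarith
      then have "?A (?f s) < ?A (?f t)"
        by (intro arccos_strict clamp01_range)
      moreover have "?A (?g s) \<le> ?A (?g t)" using fg by (intro arccos_clamp_mono) simp
      ultimately show ?thesis by simp
    next
      case False
      then have "0 \<le> ?g s" using k by (simp add: field_simps)
      moreover have "(real k + 1) * t \<le> (real k + 1) * 1"
        using st(3) by (intro mult_left_mono) auto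
      then have "?g t \<le> 1" by (simp only: diff_le_eq mult_1_right add.commute)
      ultimately have "clamp01 (?g s) < clamp01 (?g t)"
        using fg unfolding clamp01_def by linarith
      then have "?A (?g s) < ?A (?g t)"
        by (intro arccos_strict clamp01_range)
      moreover have "?A (?f s) \<le> ?A (?f t)" using fg by (intro arccos_clamp_mono) simp
      ultimately show ?thesis by simp
    qed
    then show ?thesis by (simp add: half_circles_def add_divide_distrib[symmetric] divide_strict_right_mono)
  qed
  show "half_circles k 1 = half_circles k 0 + 1"
    using k by (simp add: half_circles_def clamp01_simps field_simps)
qed

text \<open>The boundary path below the cell is traced at constant angular speed, so the lower half
  circle has to be traversed at constant horizontal speed. This is the origin of the arccosine in
  \<open>half_circles\<close>.\<close>

lemma half_circles_lower:
  assumes "j < k" "0 \<le> t" "t \<le> 1" and h: "h \<noteq> 0"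
  shows "lens m h (polar (half_circles k ((real j + t) / (real k + 1))) 1) =
     polar (m + h * (2 * ((real j + t) / real k) - 1)) 1"
proof -
  define \<tau> where "\<tau> = (real j + t) / real k"
  have k: "0 < k" using assms by simp
  have jt: "real j + t \<le> real k" using assms by linarith
  have \<tau>: "0 \<le> \<tau>" "\<tau> \<le> 1" using assms k jt by (auto simp: \<tau>_def field_simps)
  have "half_circles k ((real j + t) / (real k + 1)) = 1 / 2 + arccos (1 - 2 * \<tau>) / pi / 2"
    using \<tau> jt k unfolding half_circles_def
    by (simp add: clamp01_simps \<tau>_def[symmetric] add_pos_pos)
  then have "polar (half_circles k ((real j + t) / (real k + 1))) 1 = cis (pi + arccos (1 - 2 * \<tau>))"
    by (simp add: polar_def field_simps)
  also have "\<dots> = Complex (2 * \<tau> - 1) (- sqrt (1 - (2 * \<tau> - 1)\<^sup>2))"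
    using \<tau> by (simp add: complex_eq_iff cos_arccos sin_arccos power2_commute)
  finally show ?thesis by (simp add: lens_def \<tau>_def)
qed

text \<open>The upper half runs from right to left, as required by a cell boundary that ends with
  the reversed new edge.\<close>

lemma half_circles_upper:
  assumes "0 < k" "0 \<le> t" "t \<le> 1" and h: "h \<noteq> 0"
  shows "lens m h (polar (half_circles k ((real k + t) / (real k + 1))) 1) =
     polar (m + h * (1 - 2 * t)) (1 + lens_height m h (m + h * (1 - 2 * t)))"
proof -
  have "half_circles k ((real k + t) / (real k + 1)) = 1 + arccos (1 - 2 * t) / pi / 2"
  proof -
    have "(real k + t) / (real k + 1) * (real k + 1) / real k = 1 + t / real k"
    proof -
      have "real k + 1 \<noteq> 0" by linarith
      then show ?thesis using assms(1)
        by (simp only: nonzero_eq_divide_eq nonzero_divide_eq_eq times_divide_eq_left nonzero_mult_div_cancel_right) (simp add: field_simps)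
    qed
    moreover have "(real k + 1) * ((real k + t) / (real k + 1)) - real k = t"
      by (simp add: field_simps)
    ultimately show ?thesis
      using assms unfolding half_circles_def
      by (simp only: clamp01_simps) (simp add: clamp01_simps field_simps)
  qed
  then have "polar (half_circles k ((real k + t) / (real k + 1))) 1 = cis (2 * pi + arccos (1 - 2 * t))"
    by (simp add: polar_def field_simps)
  also have "\<dots> = Complex (1 - 2 * t) (sqrt (1 - (1 - 2 * t)\<^sup>2))"
    using assms by (simp add: complex_eq_iff cos_arccos sin_arccos flip: cis_mult)
  finally show ?thesis using assms by (simp add: lens_def lens_height_eq)
qed

section \<open>Extending diagrams\<close>

lemma cis_eq_polar: "cis (2 * pi * x / n) = polar (x / n) 1"
  by (simp add: polar_def)

lemma traces_iff:
  "traces ar h ds \<longleftrightarrow>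
     (\<forall>j<length ds. \<forall>t\<in>{0..1}. h (polar ((real j + t) / real (length ds)) 1) = dart_arc ar (ds ! j) t)"
  unfolding traces_def cis_eq_polar ..

lemma circle_position:
  assumes "norm z = 1" "0 < n"
  obtains j t where "j < n" "0 \<le> t" "t \<le> 1" "z = polar ((real j + t) / real n) 1"
proof
  define j where "j = nat \<lfloor>real n * turn z\<rfloor>"
  have n: "0 \<le> real n * turn z" "real n * turn z < real n"
    using turn_bounds[of z] assms(2) by auto
  then have j: "real j \<le> real n * turn z" "real n * turn z < real j + 1"
    unfolding j_def by linarith+
  then show "j < n" "0 \<le> real n * turn z - real j" "real n * turn z - real j \<le> 1"
    using n by auto
  show "z = polar ((real j + (real n * turn z - real j)) / real n) 1"
    using polar_turn[of z] assms by simp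
qed

lemma dart_arc_in_path_image: "t \<in> {0..1} \<Longrightarrow> dart_arc ar d t \<in> path_image (ar (fst d))"
  by (auto simp: dart_arc_def path_image_def reversepath_def split: prod.splits)

lemma traces_sphere:
  assumes "traces ar h ds" "ds \<noteq> []" "norm z = 1"
  shows "h z \<in> (\<Union>d\<in>set ds. path_image (ar (fst d)))"
proof -
  obtain j t where j: "j < length ds" "0 \<le> t" "t \<le> 1" "z = polar ((real j + t) / real (length ds)) 1"
    using circle_position[OF assms(3), of "length ds"] assms(2) by auto
  then have "h z = dart_arc ar (ds ! j) t"
    using assms(1) by (auto simp: traces_iff)
  then show ?thesis
    using j dart_arc_in_path_image[of t ar "ds ! j"] by (metis UN_I atLeastAtMost_iff nth_mem)
qed

lemma traces_cong:
  "(\<And>d. d \<in> set ds \<Longrightarrow> ar (fst d) = ar' (fst d)) \<Longrightarrow> traces ar h ds \<longleftrightarrow> traces ar' h ds"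
  unfolding traces_def dart_arc_def by (auto split: prod.splits) (metis fst_conv nth_mem)+

lemma dart_ends_less:
  assumes "\<forall>(s, a, t) \<in> set (edges D). s < nverts D \<and> t < nverts D" "fst d < length (edges D)"
  shows "dart_source D d < nverts D" "dart_target D d < nverts D"
proof -
  obtain s a t where "edges D ! fst d = (s, a, t)" by (cases "edges D ! fst d")
  moreover from this have "s < nverts D" "t < nverts D"
    using assms nth_mem[OF assms(2)] by auto
  ultimately show "dart_source D d < nverts D" "dart_target D d < nverts D"
    by (auto simp: dart_source_def dart_target_def split: prod.splits)
qed

lemma labeled_complex_edges:
  "labeled_complex A D \<Longrightarrow> \<forall>(s, a, t) \<in> set (edges D). s < nverts D \<and> t < nverts D"
  by (auto simp: labeled_complex_def)

lemma edge_path_append: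
  assumes "\<forall>(s, a, t) \<in> set (edges D). s < nverts D \<and> t < nverts D"
  shows "edge_path D u (ds @ es) v \<longleftrightarrow> (\<exists>w. edge_path D u ds w \<and> edge_path D w es v)"
proof (induction ds arbitrary: u)
  case Nil
  have "u < nverts D" if "edge_path D u es v"
    using that dart_ends_less[OF assms] by (cases es) auto
  then show ?case by auto
qed auto

lemma edge_path_darts: "edge_path D u ds v \<Longrightarrow> d \<in> set ds \<Longrightarrow> fst d < length (edges D)"
  by (induction ds arbitrary: u) auto

lemma edge_path_end: "edge_path D u ds v \<Longrightarrow> v < nverts D"
  by (induction ds arbitrary: u) auto

lemma dart_simps_append:
  assumes "fst d < length (edges D)" "edges D' = edges D @ es"
  shows "dart_source D' d = dart_source D d" "dart_target D' d = dart_target D d"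
    "dart_label \<iota> D' d = dart_label \<iota> D d"
  using assms by (auto simp: dart_source_def dart_target_def dart_label_def nth_append split: prod.splits)

lemma edge_path_extend:
  assumes "edge_path D u ds v" "edges D' = edges D @ es" "nverts D \<le> nverts D'"
  shows "edge_path D' u ds v"
  using assms(1)
proof (induction ds arbitrary: u)
  case (Cons d ds)
  then show ?case using dart_simps_append[OF _ assms(2)] assms(2) by auto
qed (use assms(3) in auto)

lemma labeled_complex_extend:
  assumes D: "labeled_complex A D"
    and D': "nverts D \<le> nverts D'" "edges D' = edges D @ es" "cells D' = cells D @ cs"
    and es: "\<forall>(s, a, t) \<in> set es. s < nverts D' \<and> a \<in> A \<and> t < nverts D'"
    and cs: "\<forall>ds \<in> set cs. ds \<noteq> [] \<and> (\<exists>v. edge_path D' v ds v)"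
    and bd: "edge_path D' (basepoint D') (boundary D') (basepoint D')"
  shows "labeled_complex A D'"
proof -
  have "s < nverts D' \<and> a \<in> A \<and> t < nverts D'" if "(s, a, t) \<in> set (edges D)" for s a t
    using that D D'(1) unfolding labeled_complex_def by fastforce
  moreover have "ds \<noteq> [] \<and> (\<exists>v. edge_path D' v ds v)" if "ds \<in> set (cells D)" for ds
  proof -
    have "ds \<noteq> []" "\<exists>v. edge_path D v ds v"
      using D that unfolding labeled_complex_def by auto
    then show ?thesis using edge_path_extend[OF _ D'(2,1)] by blast
  qed
  ultimately show ?thesis
    using es cs bd unfolding labeled_complex_def D' by (auto simp: ball_Un)
qed

lemma disjoint_mono: "A \<inter> B = {} \<Longrightarrow> A' \<subseteq> A \<Longrightarrow> B' \<subseteq> B \<Longrightarrow> A' \<inter> B' = {}"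
  by blast

lemma ch_subset_complex_image: "j < length (cells D) \<Longrightarrow> ch j ` cball 0 1 \<subseteq> complex_image D pt ar ch"
  by (auto simp: complex_image_def)

lemma ch_ball_subset_complex_image:
  "j < length (cells D) \<Longrightarrow> ch j ` ball 0 1 \<subseteq> complex_image D pt ar ch"
  by (rule order_trans[OF image_mono[OF ball_subset_cball] ch_subset_complex_image])

section \<open>Adding a vertex, an edge or a 2-cell to a plane realization\<close>

lemma plane_realization_add_vertex:
  assumes D: "labeled_complex A D" and r: "plane_realization D pt ar ch"
    and q: "q \<notin> complex_image D pt ar ch"
  defines "D' \<equiv> D\<lparr>nverts := Suc (nverts D)\<rparr>" and "pt' \<equiv> pt(nverts D := q)"
  shows "plane_realization D' pt' ar ch" "complex_image D' pt' ar ch = insert q (complex_image D pt ar ch)"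
    "labeled_complex A D'"
proof -
  have pt: "pt' ` {..<Suc (nverts D)} = insert q (pt ` {..<nverts D})"
    by (auto simp: pt'_def lessThan_Suc)
  then have sk: "skeleton_image D' pt' ar = insert q (skeleton_image D pt ar)"
    by (simp add: skeleton_image_def D'_def)
  then show "complex_image D' pt' ar ch = insert q (complex_image D pt ar ch)"
    by (simp add: complex_image_def D'_def)
  have q': "q \<notin> pt ` {..<nverts D}" "i < length (edges D) \<Longrightarrow> q \<notin> path_image (ar i)" for i
    using q by (auto simp: complex_image_def skeleton_image_def)
  have q_ch: "q \<notin> ch j ` ball 0 1" if "j < length (cells D)" for j
    using q ch_ball_subset_complex_image[OF that] by blast
  have "inj_on pt' {..<Suc (nverts D)}"
  proof -
    have "inj_on pt' {..<nverts D}"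
      using r unfolding plane_realization_def by (subst inj_on_cong[of _ _ pt]) (auto simp: pt'_def)
    moreover have "pt' ` {..<nverts D} = pt ` {..<nverts D}" by (auto simp: pt'_def)
    ultimately show ?thesis
      using q'(1) unfolding lessThan_Suc inj_on_insert by (auto simp: pt'_def)
  qed
  moreover have "simple_path (ar i) \<and> pathstart (ar i) = pt' (dart_source D' (i, True)) \<and>
      pathfinish (ar i) = pt' (dart_target D' (i, True)) \<and> ar i ` {0<..<1} \<inter> pt' ` {..<Suc (nverts D)} = {}"
    if i: "i < length (edges D)" for i
  proof -
    have "dart_source D (i, True) < nverts D" "dart_target D (i, True) < nverts D"
      using i dart_ends_less[OF labeled_complex_edges[OF D], of "(i, True)"] by simp_all
    moreover have "dart_source D' = dart_source D" "dart_target D' = dart_target D"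
      by (auto simp: D'_def dart_source_def dart_target_def)
    moreover have "q \<notin> ar i ` {0<..<1}"
      using q'(2)[OF i] by (auto simp: path_image_def)
    ultimately show ?thesis
      using r i unfolding pt by (simp add: plane_realization_def pt'_def)
  qed
  ultimately show "plane_realization D' pt' ar ch"
    using r q_ch unfolding plane_realization_def sk by (simp add: D'_def)
  show "labeled_complex A D'"
    using D by (rule labeled_complex_extend[where es = "[]" and cs = "[]"])
      (use D edge_path_extend[of D _ _ _ D' "[]"] in \<open>simp_all add: D'_def labeled_complex_def\<close>)
qed

lemma plane_realization_add_edge:
  assumes D: "labeled_complex A D" and r: "plane_realization D pt ar ch"
    and s: "s < nverts D" "t < nverts D" "a \<in> A"
    and \<gamma>: "simple_path \<gamma>" "pathstart \<gamma> = pt s" "pathfinish \<gamma> = pt t"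
      "\<gamma> ` {0<..<1} \<inter> complex_image D pt ar ch = {}"
  defines "D' \<equiv> D\<lparr>edges := edges D @ [(s, a, t)]\<rparr>" and "ar' \<equiv> ar(length (edges D) := \<gamma>)"
  shows "plane_realization D' pt ar' ch" "complex_image D' pt ar' ch = complex_image D pt ar ch \<union> path_image \<gamma>"
    "labeled_complex A D'"
proof -
  have sk: "skeleton_image D' pt ar' = skeleton_image D pt ar \<union> path_image \<gamma>"
    by (auto simp: skeleton_image_def D'_def ar'_def lessThan_Suc)
  then show "complex_image D' pt ar' ch = complex_image D pt ar ch \<union> path_image \<gamma>"
    by (auto simp: complex_image_def D'_def)
  have \<gamma>_ends: "path_image \<gamma> = \<gamma> ` {0<..<1} \<union> {pt s, pt t}"
  proof -
    have "{0..1::real} = {0<..<1} \<union> {0, 1}" by auto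
    then show ?thesis using \<gamma>(2,3) by (auto simp: path_image_def pathstart_def pathfinish_def)
  qed
  have ends: "pt s \<in> skeleton_image D pt ar" "pt t \<in> skeleton_image D pt ar"
    using s by (auto simp: skeleton_image_def)
  have \<gamma>_ch: "ch j ` ball 0 1 \<inter> path_image \<gamma> = {}" if "j < length (cells D)" for j
  proof -
    have "ch j ` ball 0 1 \<inter> skeleton_image D pt ar = {}"
      using r that by (simp add: plane_realization_def)
    then have "pt s \<notin> ch j ` ball 0 1" "pt t \<notin> ch j ` ball 0 1"
      using ends by (metis IntI empty_iff)+
    moreover have "ch j ` ball 0 1 \<inter> \<gamma> ` {0<..<1} = {}"
      using disjoint_mono[OF \<gamma>(4) order_refl ch_ball_subset_complex_image[OF that]]
      by (simp only: Int_commute)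
    ultimately show ?thesis unfolding \<gamma>_ends by (simp add: Int_Un_distrib)
  qed
  have ar_sub: "ar i ` {0<..<1} \<subseteq> complex_image D pt ar ch" if "i < length (edges D)" for i
    using that by (force simp: complex_image_def skeleton_image_def path_image_def)
  have pt_sub: "pt ` {..<nverts D} \<subseteq> complex_image D pt ar ch"
    by (auto simp: complex_image_def skeleton_image_def)
  have darts: "fst d < length (edges D)" if jd: "j < length (cells D)" "d \<in> set (cells D ! j)" for j d
  proof -
    obtain v where "edge_path D v (cells D ! j) v"
      using D nth_mem[OF jd(1)] unfolding labeled_complex_def by blast
    then show ?thesis using jd(2) by (rule edge_path_darts)
  qed
  have traces: "traces ar' (ch j) (cells D ! j)" if j: "j < length (cells D)" for j
  proof -
    have "traces ar (ch j) (cells D ! j)" using r j by (simp add: plane_realization_def)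
    moreover have "ar (fst d) = ar' (fst d)" if "d \<in> set (cells D ! j)" for d
      using darts[OF j that] by (simp add: ar'_def)
    then have "traces ar (ch j) (cells D ! j) = traces ar' (ch j) (cells D ! j)"
      by (rule traces_cong)
    ultimately show ?thesis by simp
  qed
  have disj: "disjoint_family_on (\<lambda>i. ar' i ` {0<..<1}) {..<Suc (length (edges D))}"
  proof -
    have "\<gamma> ` {0<..<1} \<inter> ar i ` {0<..<1} = {}" if "i < length (edges D)" for i
      using \<gamma>(4) order_refl ar_sub[OF that] by (rule disjoint_mono)
    then show ?thesis
      using r unfolding plane_realization_def lessThan_Suc disjoint_family_on_def ar'_def
      by (simp add: Int_commute)
  qed
  have edge: "simple_path (ar' i) \<and> pathstart (ar' i) = pt (dart_source D' (i, True)) \<and>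
      pathfinish (ar' i) = pt (dart_target D' (i, True)) \<and> ar' i ` {0<..<1} \<inter> pt ` {..<nverts D} = {}"
    if "i < Suc (length (edges D))" for i
  proof (cases "i = length (edges D)")
    case True
    moreover have "\<gamma> ` {0<..<1} \<inter> pt ` {..<nverts D} = {}"
      using \<gamma>(4) order_refl pt_sub by (rule disjoint_mono)
    ultimately show ?thesis
      using \<gamma> by (simp add: ar'_def D'_def dart_source_def dart_target_def)
  next
    case False
    then have i: "i < length (edges D)" using that by simp
    have "dart_source D' (i, True) = dart_source D (i, True)" "dart_target D' (i, True) = dart_target D (i, True)"
      using i by (simp_all add: D'_def dart_source_def dart_target_def nth_append)
    then show ?thesis using r i False by (simp add: plane_realization_def ar'_def)
  qed
  show "plane_realization D' pt ar' ch"
  proof -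
    have "ch j ` ball 0 1 \<inter> skeleton_image D' pt ar' = {}" if "j < length (cells D)" for j
      using r \<gamma>_ch[OF that] that unfolding sk by (simp add: plane_realization_def Int_Un_distrib)
    then show ?thesis
      using r edge disj traces unfolding plane_realization_def by (simp add: D'_def)
  qed
  show "labeled_complex A D'"
    using D by (rule labeled_complex_extend[where es = "[(s, a, t)]" and cs = "[]"])
      (use D s edge_path_extend[of D _ _ _ D' "[(s, a, t)]"] in \<open>simp_all add: D'_def labeled_complex_def\<close>)
qed

lemma plane_realization_add_cell:
  assumes D: "labeled_complex A D" and r: "plane_realization D pt ar ch"
    and ds: "ds \<noteq> []" "edge_path D v ds v"
    and h: "continuous_on (cball 0 1) h" "inj_on h (ball 0 1)" "traces ar h ds"
      "h ` ball 0 1 \<inter> complex_image D pt ar ch = {}"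
  defines "D' \<equiv> D\<lparr>cells := cells D @ [ds]\<rparr>" and "ch' \<equiv> ch(length (cells D) := h)"
  shows "plane_realization D' pt ar ch'" "complex_image D' pt ar ch' = complex_image D pt ar ch \<union> h ` cball 0 1"
    "labeled_complex A D'"
proof -
  have sk: "skeleton_image D' pt ar = skeleton_image D pt ar"
    by (simp add: skeleton_image_def D'_def)
  then show "complex_image D' pt ar ch' = complex_image D pt ar ch \<union> h ` cball 0 1"
    by (auto simp: complex_image_def D'_def ch'_def lessThan_Suc)
  have darts: "dart_source D' = dart_source D" "dart_target D' = dart_target D"
    by (auto simp: D'_def dart_source_def dart_target_def)
  have cell: "continuous_on (cball 0 1) (ch' j) \<and> inj_on (ch' j) (ball 0 1) \<and>
      traces ar (ch' j) (cells D' ! j) \<and> ch' j ` ball 0 1 \<inter> skeleton_image D pt ar = {}"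
    if "j < Suc (length (cells D))" for j
  proof (cases "j = length (cells D)")
    case True
    have "skeleton_image D pt ar \<subseteq> complex_image D pt ar ch" by (simp add: complex_image_def)
    then have "h ` ball 0 1 \<inter> skeleton_image D pt ar = {}"
      by (rule disjoint_mono[OF h(4) order_refl])
    then show ?thesis using True h by (simp add: ch'_def D'_def)
  next
    case False
    then show ?thesis using r that by (simp add: plane_realization_def ch'_def D'_def nth_append)
  qed
  have ch_sub: "ch j ` ball 0 1 \<subseteq> complex_image D pt ar ch" if "j < length (cells D)" for j
    using that by (rule ch_ball_subset_complex_image)
  have "disjoint_family_on (\<lambda>j. ch' j ` ball 0 1) {..<Suc (length (cells D))}"
  proof -
    have "h ` ball 0 1 \<inter> ch j ` ball 0 1 = {}" if "j < length (cells D)" for j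
      using h(4) order_refl ch_sub[OF that] by (rule disjoint_mono)
    then show ?thesis
      using r unfolding plane_realization_def lessThan_Suc disjoint_family_on_def ch'_def
      by (simp add: Int_commute)
  qed
  then show "plane_realization D' pt ar ch'"
    unfolding plane_realization_def sk darts using r cell by (auto simp: D'_def plane_realization_def)
  have "\<exists>v. edge_path D' v ds v"
    using edge_path_extend[OF ds(2), of D' "[]"] by (auto simp: D'_def)
  then have "\<forall>ds \<in> set [ds]. ds \<noteq> [] \<and> (\<exists>v. edge_path D' v ds v)"
    using ds(1) by simp
  then show "labeled_complex A D'"
    by (rule_tac labeled_complex_extend[OF D, where es = "[]" and cs = "[ds]"])
      (use D ds(1) edge_path_extend[of D _ _ _ D' "[]"] in \<open>simp_all add: D'_def labeled_complex_def\<close>)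
qed

section \<open>Growing diagrams\<close>

text \<open>The geometric invariant. An exterior map, normalized at infinity, replaces
  contractibility and winding number because it can be transported through both operations. The
  labels of the cells are tracked separately.\<close>

definition realized :: "'a set \<Rightarrow> 'a diagram \<Rightarrow> bool" where
  "realized A D \<longleftrightarrow> labeled_complex A D \<and>
     (\<exists>pt ar ch \<psi>. plane_realization D pt ar ch \<and> exterior_map (complex_image D pt ar ch) \<psi> \<and>
        \<psi> 1 = pt (basepoint D) \<and> traces ar \<psi> (boundary D) \<and>
        (boundary D = [] \<longrightarrow> \<psi> ` sphere 0 1 = {pt (basepoint D)}))"

lemma basepoint_less: "labeled_complex A D \<Longrightarrow> basepoint D < nverts D"
  using edge_path_end by (auto simp: labeled_complex_def)

lemma realized_imp_van_kampen:
  assumes "realized A D" "\<forall>ds \<in> set (cells D). map (dart_label \<iota> D) ds \<in> R"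
  shows "van_kampen_diagram A \<iota> R (map (dart_label \<iota> D) (boundary D)) D"
proof -
  obtain pt ar ch \<psi> where D: "labeled_complex A D" and r: "plane_realization D pt ar ch"
    and ext: "exterior_map (complex_image D pt ar ch) \<psi>" and \<psi>1: "\<psi> 1 = pt (basepoint D)"
    and tr: "traces ar \<psi> (boundary D)" and nil: "boundary D = [] \<longrightarrow> \<psi> ` sphere 0 1 = {pt (basepoint D)}"
    using assms(1) unfolding realized_def by blast
  let ?K = "complex_image D pt ar ch"
  have p: "pt (basepoint D) \<in> ?K"
    using basepoint_less[OF D] by (auto simp: complex_image_def skeleton_image_def)
  have sphere: "\<psi> ` sphere 0 1 \<subseteq> ?K"
  proof (cases "boundary D = []")
    case True
    then show ?thesis using nil p by simp
  next
    case False
    have "fst d < length (edges D)" if "d \<in> set (boundary D)" for d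
      using D that edge_path_darts unfolding labeled_complex_def by blast
    then have "(\<Union>d\<in>set (boundary D). path_image (ar (fst d))) \<subseteq> ?K"
      by (auto simp: complex_image_def skeleton_image_def)
    then show ?thesis using traces_sphere[OF tr False] by auto
  qed
  have "contractible ?K"
    using ext sphere by (rule exterior_map_contractible)
  moreover have "counterclockwise_boundary ?K ar (pt (basepoint D)) (boundary D)"
    unfolding counterclockwise_boundary_def
    using ext \<psi>1 tr nil exterior_map_winding_number[OF ext p]
    by (intro exI[of _ \<psi>]) (auto simp: exterior_map_def)
  ultimately show ?thesis
    using D r assms(2) unfolding van_kampen_diagram_def by blast
qed

lemma dart_arc_ends:
  assumes "plane_realization D pt ar ch" "fst d < length (edges D)"
  shows "dart_arc ar d 0 = pt (dart_source D d)" "dart_arc ar d 1 = pt (dart_target D d)"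
  using assms unfolding plane_realization_def
  by (auto simp: dart_arc_def pathstart_def pathfinish_def reversepath_def dart_source_def dart_target_def
      split: prod.splits)

text \<open>The vertex reached by \<open>u\<close> is the end of its last dart, or the basepoint if
  \<open>u\<close> is empty. It locates the ends of a new edge on the circle.\<close>

lemma traces_vertex:
  assumes D: "labeled_complex A D" and r: "plane_realization D pt ar ch"
    and tr: "traces ar \<psi> (u @ v)" "u @ v \<noteq> []" and \<psi>1: "\<psi> 1 = pt (basepoint D)"
    and u: "edge_path D (basepoint D) u q"
  shows "\<psi> (polar (real (length u) / real (length (u @ v))) 1) = pt q"
proof (cases u rule: rev_cases)
  case Nil
  then show ?thesis using u \<psi>1 by auto
next
  case (snoc u' d)
  then have d: "fst d < length (edges D)" "dart_target D d = q"
    using u edge_path_append[OF labeled_complex_edges[OF D]] by auto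
  have "\<psi> (polar ((real (length u') + 1) / real (length (u @ v))) 1) = dart_arc ar ((u @ v) ! length u') 1"
    using tr(1) snoc unfolding traces_iff by (auto dest!: spec[of _ "length u'"] bspec[of _ _ 1])
  then show ?thesis
    using dart_arc_ends(2)[OF r d(1)] d(2) snoc by (simp add: add.commute)
qed

text \<open>While parts are added, the field \<open>boundary\<close> still holds the old path; it is
  exchanged here at the end. That \<open>\<psi>\<close> starts at the basepoint follows from the
  first dart of the new path.\<close>

lemma realized_boundaryI:
  assumes D: "labeled_complex A D" and r: "plane_realization D pt ar ch"
    and ext: "exterior_map (complex_image D pt ar ch) \<psi>"
    and tr: "traces ar \<psi> ds" "ds \<noteq> []" and ds: "edge_path D (basepoint D) ds (basepoint D)"
  shows "realized A (D\<lparr>boundary := ds\<rparr>)"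
proof -
  let ?D = "D\<lparr>boundary := ds\<rparr>"
  have [simp]: "dart_source ?D = dart_source D" "dart_target ?D = dart_target D"
    by (auto simp: dart_source_def dart_target_def)
  have path: "edge_path ?D = edge_path D"
  proof (intro HOL.ext)
    fix s ds' t show "edge_path ?D s ds' t = edge_path D s ds' t"
      by (induction ds' arbitrary: s) auto
  qed
  have image: "skeleton_image ?D = skeleton_image D" "complex_image ?D = complex_image D"
    by (simp_all add: fun_eq_iff complex_image_def skeleton_image_def)
  obtain d ds' where "ds = d # ds'" using tr(2) by (cases ds) auto
  then have "\<psi> (polar 0 1) = dart_arc ar d 0"
    using tr(1) by (auto simp: traces_iff dest!: spec[of _ 0] bspec[of _ _ 0])
  also have "\<dots> = pt (basepoint D)"
    using ds \<open>ds = d # ds'\<close> dart_arc_ends(1)[OF r] by auto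
  finally have "\<psi> 1 = pt (basepoint D)" by simp
  moreover have "labeled_complex A ?D"
    using D ds unfolding labeled_complex_def path by simp
  moreover have "plane_realization ?D pt ar ch"
    using r unfolding plane_realization_def image by simp
  ultimately show ?thesis
    unfolding realized_def image using ext tr by force
qed

lemma circle_rotation_interpolate:
  assumes "0 < n" "\<And>j. j < n \<Longrightarrow> v j < v (Suc j)" "v n = v 0 + 1"
  shows "circle_rotation (blend (interpolate n v) \<delta>)"
  using assms
  by (intro circle_rotation_blend continuous_on_interpolate continuous_on_id interpolate_strict_mono)
    (simp_all add: interpolate_0 interpolate_1)

lemma rotate_circles_interpolate:
  assumes "circle_rotation (blend (interpolate n v) \<delta>)" "j < n" "0 \<le> t" "t \<le> 1"
  shows "rotate_circles (blend (interpolate n v) \<delta>) (polar ((real j + t) / real n) 1) =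
    polar (v j + t * (v (Suc j) - v j)) 1"
proof -
  have "real j + t \<le> real n" using assms by linarith
  then have "(real j + t) / real n \<le> 1" "0 \<le> (real j + t) / real n"
    using assms by (auto simp: field_simps)
  then show ?thesis
    using assms circle_rotation.rotate_circles_polar[OF assms(1), of "(real j + t) / real n" 1]
    by (simp add: interpolate_piece)
qed

lemma exterior_map_notin:
  "exterior_map K \<psi> \<Longrightarrow> 1 < norm z \<Longrightarrow> \<psi> z \<notin> K"
  unfolding exterior_map_def by blast

text \<open>The new edge is the image of the radial segment of length 1 over the position of
  \<open>q\<close> on the circle. A nonempty boundary is what gives \<open>q\<close> such a
  position.\<close>

lemma realized_spike:
  assumes D: "realized A D" and bd: "boundary D = u @ v" "u @ v \<noteq> []"
    and u: "edge_path D (basepoint D) u q" and v: "edge_path D q v (basepoint D)" and a: "a \<in> A"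
  defines "n \<equiv> nverts D" and "m \<equiv> length (edges D)"
  shows "realized A (D\<lparr>nverts := Suc n, edges := edges D @ [(q, a, n)], boundary := u @ [(m, True), (m, False)] @ v\<rparr>)"
proof -
  obtain pt ar ch \<psi> where D: "labeled_complex A D" and r: "plane_realization D pt ar ch"
    and ext: "exterior_map (complex_image D pt ar ch) \<psi>" and \<psi>1: "\<psi> 1 = pt (basepoint D)"
    and tr: "traces ar \<psi> (u @ v)"
    using D bd unfolding realized_def by metis
  let ?K = "complex_image D pt ar ch"
  define l where "l = length (u @ v)"
  define j0 where "j0 = length u"
  define \<alpha> where "\<alpha> = real j0 / real l"
  have l: "0 < l" "j0 \<le> l" using bd by (auto simp: l_def j0_def)
  have \<alpha>: "0 \<le> \<alpha>" "\<alpha> \<le> 1" using l by (auto simp: \<alpha>_def)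
  define \<gamma> where "\<gamma> t = \<psi> (polar \<alpha> (1 + t))" for t
  have q: "q < n" unfolding n_def using u by (rule edge_path_end)
  have \<gamma>0: "\<gamma> 0 = pt q"
    using traces_vertex[OF D r tr bd(2) \<psi>1 u] by (simp add: \<gamma>_def \<alpha>_def j0_def l_def)
  have \<gamma>_K: "\<gamma> t \<notin> ?K" if "0 < t" for t
    unfolding \<gamma>_def using that by (intro exterior_map_notin[OF ext]) (simp add: norm_polar)
  have "pt q \<in> ?K" using q by (auto simp: complex_image_def skeleton_image_def n_def)
  have \<gamma>_eq: "s = t" if "\<gamma> s = \<gamma> t" "0 < s" "0 < t" for s t
  proof -
    have "polar \<alpha> (1 + s) = polar \<alpha> (1 + t)"
    proof (rule inj_onD[of \<psi> "{z. 1 < norm z}"])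
      show "inj_on \<psi> {z. 1 < norm z}" using ext unfolding exterior_map_def by blast
    qed (use that in \<open>simp_all add: \<gamma>_def norm_polar\<close>)
    then have "norm (polar \<alpha> (1 + s)) = norm (polar \<alpha> (1 + t))" by simp
    then show ?thesis using that by (simp add: norm_polar)
  qed
  have "inj_on \<gamma> {0..1}"
  proof (rule inj_onI)
    fix s t :: real assume st: "s \<in> {0..1}" "t \<in> {0..1}" "\<gamma> s = \<gamma> t"
    show "s = t"
    proof (cases "0 < s \<and> 0 < t")
      case True
      then show ?thesis using \<gamma>_eq[OF st(3)] by blast
    next
      case False
      then have "s = 0 \<or> t = 0" using st(1,2) by auto
      then have "\<gamma> s \<in> ?K" "\<gamma> t \<in> ?K"
        using st(3) \<gamma>0 \<open>pt q \<in> ?K\<close> by auto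
      then have "\<not> 0 < s" "\<not> 0 < t" using \<gamma>_K by blast+
      then show ?thesis using st(1,2) by simp
    qed
  qed
  moreover have "continuous_on {0..1} \<gamma>"
    unfolding \<gamma>_def
  proof (rule continuous_on_compose2[of "{z. 1 \<le> norm z}" \<psi> _ "\<lambda>t. polar \<alpha> (1 + t)"])
    show "continuous_on {z. 1 \<le> norm z} \<psi>" using ext unfolding exterior_map_def by blast
    show "continuous_on {0..1} (\<lambda>t. polar \<alpha> (1 + t))" by (intro continuous_intros)
  qed (auto simp: norm_polar)
  ultimately have \<gamma>: "simple_path \<gamma>"
    by (intro arc_imp_simple_path) (simp add: arc_def path_def)

  define D1 where "D1 = D\<lparr>nverts := Suc (nverts D)\<rparr>"
  define pt1 where "pt1 = pt(nverts D := \<gamma> 1)"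
  note 1 = plane_realization_add_vertex[OF D r \<gamma>_K[OF zero_less_one], folded D1_def pt1_def]
  define D2 where "D2 = D1\<lparr>edges := edges D1 @ [(q, a, n)]\<rparr>"
  define ar2 where "ar2 = ar(m := \<gamma>)"
  have m: "m = length (edges D1)" by (simp add: m_def D1_def)
  have 2: "plane_realization D2 pt1 ar2 ch" "complex_image D2 pt1 ar2 ch = insert (\<gamma> 1) ?K \<union> path_image \<gamma>"
    "labeled_complex A D2"
  proof -
    have "\<gamma> ` {0<..<1} \<inter> insert (\<gamma> 1) ?K = {}"
    proof -
      have "\<gamma> t \<notin> insert (\<gamma> 1) ?K" if "t \<in> {0<..<1}" for t
        using \<gamma>_K[of t] \<gamma>_eq[of t 1] that by auto
      then show ?thesis by blast
    qed
    then show "plane_realization D2 pt1 ar2 ch" "complex_image D2 pt1 ar2 ch = insert (\<gamma> 1) ?K \<union> path_image \<gamma>"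
      "labeled_complex A D2"
      using plane_realization_add_edge[OF 1(3,1), of q n a \<gamma>] q a \<gamma> \<gamma>0
      unfolding 1(2) D2_def ar2_def m
      by (simp_all add: D1_def pt1_def n_def pathstart_def pathfinish_def)
  qed

  \<comment> \<open>Breakpoints for the l + 2 new darts. The two sides of the spike take the angles
    from -1/4 to 1/4, with the tip at 0; the old darts share the other half turn at half speed,
    which \<open>slit\<close> doubles again.\<close>
  define w where "w j = (if j \<le> j0 then real j / (2 * real l) - 1 / 4 - \<alpha> / 2
    else if j = Suc j0 then 0 else 1 / 4 + ((real j - 2) / real l - \<alpha>) / 2)" for j
  define F where "F = interpolate (l + 2) w"
  have w: "w j0 = - 1 / 4" "w (Suc j0) = 0" "w (Suc (Suc j0)) = 1 / 4"
    using l by (auto simp: w_def \<alpha>_def field_simps)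
  have diff: "w (Suc j) - w j = 1 / (2 * real l)" if "j < j0 \<or> Suc j0 < j" for j
    using that l by (auto simp: w_def field_simps)
  have rot: "circle_rotation (blend F (- \<alpha>))"
    unfolding F_def
  proof (rule circle_rotation_interpolate)
    fix j
    consider "j < j0 \<or> Suc j0 < j" | "j = j0" | "j = Suc j0" by linarith
    then show "w j < w (Suc j)"
    proof cases
      case 1
      have "0 < 1 / (2 * real l)" using l by simp
      then show ?thesis using diff[OF 1] by linarith
    qed (use w in auto)
    show "w (l + 2) = w 0 + 1" using l by (auto simp: w_def field_simps)
  qed auto
  define \<theta> where "\<theta> z = cis (2 * pi * \<alpha>) * slit (rotate_circles (blend F (- \<alpha>)) z)" for z
  have ext': "exterior_map (?K \<union> \<psi> ` {polar \<alpha> r |r. 1 < r \<and> r \<le> 2}) (\<psi> \<circ> \<theta>)"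
    unfolding \<theta>_def using ext rot by (rule exterior_map_slit)
  moreover have "?K \<union> \<psi> ` {polar \<alpha> r |r. 1 < r \<and> r \<le> 2} = complex_image D2 pt1 ar2 ch"
  proof -
    have "{0..1::real} = insert 0 {0<..1}" by auto
    then have "path_image \<gamma> = insert (pt q) (\<gamma> ` {0<..1})"
      unfolding path_image_def using \<gamma>0 by simp
    also have "\<gamma> ` {0<..1} = \<psi> ` {polar \<alpha> r |r. 1 < r \<and> r \<le> 2}"
    proof (intro subset_antisym subsetI)
      fix w assume "w \<in> \<psi> ` {polar \<alpha> r |r. 1 < r \<and> r \<le> 2}"
      then obtain r where "w = \<gamma> (r - 1)" "1 < r" "r \<le> 2" by (auto simp: \<gamma>_def)
      then show "w \<in> \<gamma> ` {0<..1}" by simp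
    next
      fix w assume "w \<in> \<gamma> ` {0<..1}"
      then obtain t where t: "w = \<psi> (polar \<alpha> (1 + t))" "0 < t" "t \<le> 1"
        by (auto simp: \<gamma>_def)
      then have "polar \<alpha> (1 + t) \<in> {polar \<alpha> r |r. 1 < r \<and> r \<le> 2}" by force
      then show "w \<in> \<psi> ` {polar \<alpha> r |r. 1 < r \<and> r \<le> 2}" using t(1) by blast
    qed
    finally have "path_image \<gamma> = insert (pt q) (\<psi> ` {polar \<alpha> r |r. 1 < r \<and> r \<le> 2})" .
    moreover have "\<gamma> 1 \<in> path_image \<gamma>" by (simp add: path_image_def)
    ultimately show ?thesis using 2(2) \<open>pt q \<in> ?K\<close> by auto
  qed
  ultimately have ext': "exterior_map (complex_image D2 pt1 ar2 ch) (\<psi> \<circ> \<theta>)" by simp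

  let ?ds = "u @ [(m, True), (m, False)] @ v"
  have old: "dart_arc ar2 d = dart_arc ar d" if "d \<in> set (u @ v)" for d
  proof -
    have "fst d < m"
      using that edge_path_darts[OF u, of d] edge_path_darts[OF v, of d] unfolding m_def by auto
    then show ?thesis by (auto simp: ar2_def dart_arc_def split: prod.splits)
  qed
  \<comment> \<open>Before the spike the angles come out one full turn too low, which
    \<open>polar\<close> does not notice; after the spike they come out exactly.\<close>
  have slit1: "slit (polar (y / 2 - 1 / 4 - \<alpha> / 2) 1) = polar (y - \<alpha> - 1) 1" if "0 \<le> y" "y \<le> \<alpha>" for y
  proof -
    let ?e = "y / 2 - 1 / 4 - \<alpha> / 2"
    have "1 / 4 \<le> \<bar>?e\<bar>" "\<bar>?e\<bar> \<le> 3 / 4" using that \<alpha> by auto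
    then have "slit (polar ?e 1) = polar (2 * ?e - 1 / 2) 1" by (rule slit_circle)
    also have "2 * ?e - 1 / 2 = y - \<alpha> - 1" by simp
    finally show ?thesis .
  qed
  have slit2: "slit (polar (1 / 4 + (y - \<alpha>) / 2) 1) = polar (y - \<alpha>) 1" if "\<alpha> \<le> y" "y \<le> 1" for y
  proof -
    let ?e = "1 / 4 + (y - \<alpha>) / 2"
    have "1 / 4 \<le> \<bar>?e\<bar>" "\<bar>?e\<bar> \<le> 3 / 4" using that \<alpha> by auto
    then have "slit (polar ?e 1) = polar (2 * ?e - 1 / 2) 1" by (rule slit_circle)
    also have "2 * ?e - 1 / 2 = y - \<alpha>" by simp
    finally show ?thesis .
  qed
  have tr': "(\<psi> \<circ> \<theta>) (polar ((real j + t) / real (l + 2)) 1) = dart_arc ar2 (?ds ! j) t"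
    if j: "j < l + 2" and t: "0 \<le> t" "t \<le> 1" for j t
  proof -
    have old_edge: "\<psi> (polar ((real i + t) / real l) 1) = dart_arc ar2 ((u @ v) ! i) t" if "i < l" for i
    proof -
      have "dart_arc ar2 ((u @ v) ! i) = dart_arc ar ((u @ v) ! i)"
        using that by (intro old nth_mem) (simp add: l_def)
      then show ?thesis
        using tr that t unfolding traces_iff l_def[symmetric] by simp
    qed
    have \<theta>: "\<theta> (polar ((real j + t) / real (l + 2)) 1) =
        cis (2 * pi * \<alpha>) * slit (polar (w j + t * (w (Suc j) - w j)) 1)"
      unfolding \<theta>_def F_def using rot j t unfolding F_def by (subst rotate_circles_interpolate) auto
    consider "j < j0" | "j = j0" | "j = Suc j0" | "Suc j0 < j" by linarith
    then show ?thesis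
    proof cases
      case 1
      have jt: "0 \<le> (real j + t) / real l" "(real j + t) / real l \<le> \<alpha>"
        using 1 t l by (auto simp: \<alpha>_def divide_le_cancel)
      have "w j + t * (w (Suc j) - w j) = (real j + t) / real l / 2 - 1 / 4 - \<alpha> / 2"
        unfolding diff[OF disjI1[OF 1]] using 1 l by (simp add: w_def field_simps)
      then have "slit (polar (w j + t * (w (Suc j) - w j)) 1) = polar ((real j + t) / real l - \<alpha> - 1) 1"
        using slit1[OF jt] by simp
      then have "\<theta> (polar ((real j + t) / real (l + 2)) 1) = polar ((real j + t) / real l) 1"
        unfolding \<theta> by (simp only: polar_diff_one cis_mult_polar) simp
      moreover have "?ds ! j = (u @ v) ! j" using 1 by (simp add: nth_append j0_def)
      ultimately show ?thesis using old_edge[of j] 1 l by simp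
    next
      case 2
      have "w j + t * (w (Suc j) - w j) = (t - 1) / 4"
        using w 2 by (simp add: field_simps)
      then have "\<theta> (polar ((real j + t) / real (l + 2)) 1) = polar \<alpha> (1 + t)"
      proof -
        have "slit (polar ((t - 1) / 4) 1) = of_real (1 + t)"
        proof -
          have "slit (polar ((t - 1) / 4) 1) = of_real (2 - 4 * \<bar>(t - 1) / 4\<bar>)"
            using t by (intro slit_circle_spike) auto
          also have "2 - 4 * \<bar>(t - 1) / 4\<bar> = 1 + t"
          proof -
            have "\<bar>(t - 1) / 4\<bar> = (1 - t) / 4" using t by (simp add: abs_divide)
            then have "2 - 4 * \<bar>(t - 1) / 4\<bar> = 2 - 4 * ((1 - t) / 4)" by (simp only:)
            also have "\<dots> = 1 + t" by (simp add: field_simps)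
            finally show ?thesis .
          qed
          finally show ?thesis .
        qed
        then show ?thesis unfolding \<theta> \<open>w j + t * (w (Suc j) - w j) = (t - 1) / 4\<close>
          by (simp add: polar_def)
      qed
      then show ?thesis
        using 2 by (simp add: \<gamma>_def nth_append j0_def ar2_def dart_arc_def)
    next
      case 3
      have "w j + t * (w (Suc j) - w j) = t / 4"
        using w 3 by (simp add: field_simps)
      then have "\<theta> (polar ((real j + t) / real (l + 2)) 1) = polar \<alpha> (1 + (1 - t))"
      proof -
        have "slit (polar (t / 4) 1) = of_real (1 + (1 - t))"
        proof -
          have "slit (polar (t / 4) 1) = of_real (2 - 4 * \<bar>t / 4\<bar>)"
            using t by (intro slit_circle_spike) auto
          also have "2 - 4 * \<bar>t / 4\<bar> = 1 + (1 - t)" using t by auto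
          finally show ?thesis .
        qed
        then show ?thesis unfolding \<theta> \<open>w j + t * (w (Suc j) - w j) = t / 4\<close>
          by (simp add: polar_def)
      qed
      then show ?thesis
        using 3 by (simp add: \<gamma>_def nth_append j0_def ar2_def dart_arc_def reversepath_def)
    next
      case 4
      define i where "i = j - 2"
      have i: "j = i + 2" "j0 \<le> i" "i < l" using 4 j by (auto simp: i_def)
      have it: "\<alpha> \<le> (real i + t) / real l" "(real i + t) / real l \<le> 1"
        using i t l by (auto simp: \<alpha>_def divide_le_cancel)
      have "w j + t * (w (Suc j) - w j) = 1 / 4 + ((real i + t) / real l - \<alpha>) / 2"
        unfolding diff[OF disjI2[OF 4]] using i l by (simp add: w_def field_simps)
      then have "slit (polar (w j + t * (w (Suc j) - w j)) 1) = polar ((real i + t) / real l - \<alpha>) 1"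
        using slit2[OF it] by simp
      then have "\<theta> (polar ((real j + t) / real (l + 2)) 1) = polar ((real i + t) / real l) 1"
        unfolding \<theta> by (simp only: cis_mult_polar) simp
      moreover have "?ds ! j = (u @ v) ! i"
        using i by (simp add: nth_append j0_def Suc_diff_le)
      ultimately show ?thesis using old_edge[of i] i by simp
    qed
  qed
  have "length ?ds = l + 2" by (simp add: l_def)
  then have "traces ar2 (\<psi> \<circ> \<theta>) ?ds"
    unfolding traces_iff using tr' by simp
  moreover have "edge_path D2 (basepoint D2) ?ds (basepoint D2)"
  proof -
    have D2: "edges D2 = edges D @ [(q, a, n)]" "nverts D \<le> nverts D2" "basepoint D2 = basepoint D"
      by (simp_all add: D2_def D1_def)
    have "edge_path D2 (basepoint D) u q" "edge_path D2 q v (basepoint D)"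
      using edge_path_extend[OF u D2(1,2)] edge_path_extend[OF v D2(1,2)] by auto
    moreover have "edge_path D2 q [(m, True), (m, False)] q"
      using q by (simp add: D2 dart_source_def dart_target_def m_def nth_append) (simp add: D2_def D1_def n_def)
    ultimately show ?thesis
      unfolding D2(3) edge_path_append[OF labeled_complex_edges[OF 2(3)]] by blast
  qed
  ultimately have "realized A (D2\<lparr>boundary := ?ds\<rparr>)"
    by (intro realized_boundaryI[OF 2(3,1) ext']) auto
  moreover have "D2\<lparr>boundary := ?ds\<rparr> = D\<lparr>nverts := Suc n, edges := edges D @ [(q, a, n)], boundary := ?ds\<rparr>"
    by (simp add: D2_def D1_def n_def)
  ultimately show ?thesis by simp
qed

text \<open>The open cell is the \<open>\<psi>\<close>-image of the open lens over the arc of the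
  circle that traces \<open>x\<close>, and the new edge is the image of the upper rim.
  \<open>\<psi>\<close> is injective there even if it identifies points of the arc below, so
  \<open>x\<close> may pass twice over an edge.\<close>

lemma realized_cell:
  assumes D: "realized A D" and bd: "boundary D = u @ x @ v" "x \<noteq> []"
    and u: "edge_path D (basepoint D) u s" and x: "edge_path D s x t" and v: "edge_path D t v (basepoint D)"
    and a: "a \<in> A"
  defines "m \<equiv> length (edges D)"
  shows "realized A (D\<lparr>edges := edges D @ [(s, a, t)], cells := cells D @ [x @ [(m, False)]],
    boundary := u @ [(m, True)] @ v\<rparr>)"
proof -
  obtain pt ar ch \<psi> where D: "labeled_complex A D" and r: "plane_realization D pt ar ch"
    and ext: "exterior_map (complex_image D pt ar ch) \<psi>" and \<psi>1: "\<psi> 1 = pt (basepoint D)"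
    and tr: "traces ar \<psi> (u @ x @ v)"
    using D bd unfolding realized_def by metis
  let ?K = "complex_image D pt ar ch"
  have inj: "inj_on \<psi> {z. 1 < norm z}" and cont: "continuous_on {z. 1 \<le> norm z} \<psi>"
    using ext unfolding exterior_map_def by auto
  define l where "l = length (u @ x @ v)"
  define j0 where "j0 = length u"
  define k where "k = length x"
  have l: "0 < k" "j0 + k \<le> l" "0 < l" using bd(2) by (auto simp: l_def j0_def k_def)
  \<comment> \<open>Midpoint and half width of the arc from j0/l to (j0 + k)/l.\<close>
  define \<mu> where "\<mu> = (real j0 + real k / 2) / real l"
  define h where "h = real k / (2 * real l)"
  have h: "0 < h" "h \<le> \<mu>" "\<mu> + h \<le> 1"
    using l by (auto simp: h_def \<mu>_def field_simps)
  define \<beta> where "\<beta> = lens_height \<mu> h"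
  have \<beta>: "bump \<beta>" unfolding \<beta>_def using h by (rule bump_lens_height)
  define \<gamma> where "\<gamma> \<tau> = \<psi> (polar (\<mu> + h * (2 * \<tau> - 1)) (1 + sqrt (1 - (2 * \<tau> - 1)\<^sup>2)))" for \<tau>
  have vertices: "s < nverts D" "t < nverts D"
    using edge_path_end u x by blast+
  have sq: "0 < 1 - (2 * \<tau> - 1)\<^sup>2" if "0 < \<tau>" "\<tau> < 1" for \<tau> :: real
  proof -
    have "\<bar>2 * \<tau> - 1\<bar> < 1" using that by auto
    then show ?thesis using abs_square_less_1[of "2 * \<tau> - 1"] by simp
  qed
  have sq': "0 \<le> 1 - (2 * \<tau> - 1)\<^sup>2" if "0 \<le> \<tau>" "\<tau> \<le> 1" for \<tau> :: real
  proof -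
    have "\<bar>2 * \<tau> - 1\<bar> \<le> 1" using that by auto
    then show ?thesis using abs_square_le_1[of "2 * \<tau> - 1"] by simp
  qed
  have \<gamma>0: "\<gamma> 0 = pt s"
  proof -
    have "\<mu> - h = real j0 / real l" using l by (simp add: \<mu>_def h_def field_simps)
    then show ?thesis
      using traces_vertex[OF D r, of \<psi> u "x @ v"] tr bd(2) \<psi>1 u
      by (simp add: \<gamma>_def j0_def l_def)
  qed
  have \<gamma>1: "\<gamma> 1 = pt t"
  proof -
    have "\<mu> + h = real (length (u @ x)) / real l" using l
      by (simp add: \<mu>_def h_def j0_def k_def field_simps)
    moreover have "edge_path D (basepoint D) (u @ x) t"
      using u x edge_path_append[OF labeled_complex_edges[OF D]] by blast
    ultimately show ?thesis
      using traces_vertex[OF D r, of \<psi> "u @ x" v] tr bd(2) \<psi>1 by (simp add: \<gamma>_def l_def)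
  qed
  have angle: "0 \<le> \<mu> + h * (2 * \<tau> - 1)" "\<mu> + h * (2 * \<tau> - 1) < 1" if "0 < \<tau>" "\<tau> < 1" for \<tau>
  proof -
    have "0 < h * \<tau>" "h * \<tau> < h * 1" using h(1) that by auto
    moreover have "h * (2 * \<tau> - 1) = 2 * (h * \<tau>) - h" by (simp add: algebra_simps)
    ultimately show "0 \<le> \<mu> + h * (2 * \<tau> - 1)" "\<mu> + h * (2 * \<tau> - 1) < 1"
      using h by linarith+
  qed
  have \<gamma>_K: "\<gamma> \<tau> \<notin> ?K" if "0 < \<tau>" "\<tau> < 1" for \<tau>
    unfolding \<gamma>_def using sq[OF that]
    by (intro exterior_map_notin[OF ext]) (simp add: norm_polar)
  have ends: "pt s \<in> ?K" "pt t \<in> ?K" using vertices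
    by (auto simp: complex_image_def skeleton_image_def)
  \<comment> \<open>The ends of the new edge may coincide, so only a simple path can be expected and
    not an arc.\<close>
  have "loop_free \<gamma>"
    unfolding loop_free_def
  proof (intro ballI impI)
    fix \<sigma> \<tau> :: real assume st: "\<sigma> \<in> {0..1}" "\<tau> \<in> {0..1}" "\<gamma> \<sigma> = \<gamma> \<tau>"
    show "\<sigma> = \<tau> \<or> \<sigma> = 0 \<and> \<tau> = 1 \<or> \<sigma> = 1 \<and> \<tau> = 0"
    proof (cases "0 < \<sigma> \<and> \<sigma> < 1 \<and> 0 < \<tau> \<and> \<tau> < 1")
      case True
      then have "polar (\<mu> + h * (2 * \<sigma> - 1)) (1 + sqrt (1 - (2 * \<sigma> - 1)\<^sup>2)) =
          polar (\<mu> + h * (2 * \<tau> - 1)) (1 + sqrt (1 - (2 * \<tau> - 1)\<^sup>2))"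
        using st(3) sq[of \<sigma>] sq[of \<tau>] unfolding \<gamma>_def
        by - (rule inj_onD[OF inj], simp_all add: norm_polar)
      then have "\<mu> + h * (2 * \<sigma> - 1) = \<mu> + h * (2 * \<tau> - 1)"
        using True angle[of \<sigma>] angle[of \<tau>] sq[of \<sigma>] sq[of \<tau>]
        by (subst (asm) polar_eq_iff) (auto intro: add_pos_nonneg)
      then show ?thesis using h(1) by simp
    next
      case False
      then have "\<sigma> = 0 \<or> \<sigma> = 1 \<or> \<tau> = 0 \<or> \<tau> = 1" using st(1,2) by auto
      then have "\<gamma> \<sigma> \<in> ?K" "\<gamma> \<tau> \<in> ?K"
        using st(3) \<gamma>0 \<gamma>1 ends by auto
      then have "\<not> (0 < \<sigma> \<and> \<sigma> < 1)" "\<not> (0 < \<tau> \<and> \<tau> < 1)"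
        using \<gamma>_K by blast+
      then show ?thesis using st(1,2) by auto
    qed
  qed
  moreover have "continuous_on {0..1} \<gamma>"
    unfolding \<gamma>_def
  proof (rule continuous_on_compose2[OF cont])
    show "continuous_on {0..1} (\<lambda>\<tau>. polar (\<mu> + h * (2 * \<tau> - 1)) (1 + sqrt (1 - (2 * \<tau> - 1)\<^sup>2)))"
      by (intro continuous_intros)
  qed (use sq' in \<open>auto simp: norm_polar\<close>)
  ultimately have \<gamma>: "simple_path \<gamma>" by (simp add: simple_path_def path_def)

  define D1 where "D1 = D\<lparr>edges := edges D @ [(s, a, t)]\<rparr>"
  define ar1 where "ar1 = ar(m := \<gamma>)"
  have \<gamma>_disj: "\<gamma> ` {0<..<1} \<inter> ?K = {}" using \<gamma>_K by auto
  have 1: "plane_realization D1 pt ar1 ch" "complex_image D1 pt ar1 ch = ?K \<union> path_image \<gamma>"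
    "labeled_complex A D1"
    unfolding D1_def ar1_def m_def
    using plane_realization_add_edge[OF D r vertices a \<gamma> _ _ \<gamma>_disj] \<gamma>0 \<gamma>1
    by (simp_all add: pathstart_def pathfinish_def)
  have D1: "edges D1 = edges D @ [(s, a, t)]" "nverts D \<le> nverts D1" "basepoint D1 = basepoint D"
    by (simp_all add: D1_def)
  have paths: "edge_path D1 (basepoint D) u s" "edge_path D1 s x t" "edge_path D1 t v (basepoint D)"
    using edge_path_extend[OF u D1(1,2)] edge_path_extend[OF x D1(1,2)] edge_path_extend[OF v D1(1,2)]
    by auto
  have new: "edge_path D1 t [(m, False)] s" "edge_path D1 s [(m, True)] t"
    using vertices by (simp_all add: D1_def dart_source_def dart_target_def m_def nth_append)

  have old: "dart_arc ar1 d = dart_arc ar d" if "d \<in> set (u @ x @ v)" for d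
  proof -
    have "fst d < m"
      using that edge_path_darts[OF u, of d] edge_path_darts[OF v, of d] edge_path_darts[OF x, of d]
      unfolding m_def by auto
    then show ?thesis by (auto simp: ar1_def dart_arc_def split: prod.splits)
  qed
  have old_edge: "\<psi> (polar ((real i + \<tau>) / real l) 1) = dart_arc ar1 ((u @ x @ v) ! i) \<tau>"
    if "i < l" "0 \<le> \<tau>" "\<tau> \<le> 1" for i \<tau>
  proof -
    have "dart_arc ar1 ((u @ x @ v) ! i) = dart_arc ar ((u @ x @ v) ! i)"
      using that by (intro old nth_mem) (simp add: l_def)
    then show ?thesis
      using tr that unfolding traces_iff l_def[symmetric] by simp
  qed

  define Q where "Q = rotate_circles (\<lambda>s r. half_circles k s)"
  have rotQ: "circle_rotation (\<lambda>s r. half_circles k s)"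
    using l(1) by (rule circle_rotation_half_circles)
  have normQ: "norm (Q w) = norm w" for w
    unfolding Q_def by (rule circle_rotation.norm_rotate_circles[OF rotQ])
  define H where "H w = \<psi> (lens \<mu> h (Q w))" for w
  have contH: "continuous_on (cball 0 1) H"
    unfolding H_def
  proof (rule continuous_on_compose2[OF cont])
    show "continuous_on (cball 0 1) (\<lambda>w. lens \<mu> h (Q w))"
      by (rule continuous_on_compose2[OF continuous_on_lens[of UNIV]])
        (auto simp: Q_def intro: continuous_on_subset[OF continuous_on_UNIV_rotate_circles[OF rotQ]])
  qed (auto simp: normQ intro: norm_lens_ge)
  have injH: "inj_on H (ball 0 1)"
  proof (rule inj_onI)
    fix w w' assume w: "w \<in> ball 0 1" "w' \<in> ball 0 1" "H w = H w'"
    then have "lens \<mu> h (Q w) = lens \<mu> h (Q w')"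
      unfolding H_def by - (rule inj_onD[OF inj], auto simp: normQ intro: norm_lens_gt)
    then have "Q w = Q w'"
      using w by - (rule inj_onD[OF inj_on_lens[OF h]], auto simp: normQ)
    then show "w = w'"
      using inj_rotate_circles[OF rotQ] unfolding Q_def by (rule injD[rotated])
  qed
  have H_disj: "H ` ball 0 1 \<inter> complex_image D1 pt ar1 ch = {}"
  proof -
    have "H w \<notin> ?K \<union> path_image \<gamma>" if w: "norm w < 1" for w
    proof
      have w': "norm (Q w) < 1" using w by (simp add: normQ)
      have K: "H w \<notin> ?K"
        unfolding H_def using w' by (intro exterior_map_notin[OF ext] norm_lens_gt)
      assume "H w \<in> ?K \<union> path_image \<gamma>"
      then obtain \<tau> where \<tau>: "H w = \<gamma> \<tau>" "0 \<le> \<tau>" "\<tau> \<le> 1" using K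
        by (auto simp: path_image_def)
      then have \<tau>': "0 < \<tau>" "\<tau> < 1" using K \<gamma>0 \<gamma>1 ends by (auto simp: less_le)
      have "lens \<mu> h (Q w) = polar (\<mu> + h * (2 * \<tau> - 1)) (1 + sqrt (1 - (2 * \<tau> - 1)\<^sup>2))"
        using \<tau>(1) sq[OF \<tau>'] norm_lens_gt[OF w'] unfolding H_def \<gamma>_def
        by - (rule inj_onD[OF inj], simp_all add: norm_polar)
      then have "\<mu> + h * Re (Q w) = \<mu> + h * (2 * \<tau> - 1) \<and>
          1 + (Im (Q w) + sqrt (1 - (Re (Q w))\<^sup>2)) / 2 = 1 + sqrt (1 - (2 * \<tau> - 1)\<^sup>2)"
        using lens_angle[OF h w'] angle[OF \<tau>'] sq[OF \<tau>'] norm_lens_gt[OF w', of \<mu> h] norm_lens[of "Q w" \<mu> h] w'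
        unfolding lens_def by (subst (asm) polar_eq_iff) (auto intro: add_pos_nonneg)
      \<comment> \<open>An interior point of the disc that is sent to the new edge would have to lie
        on the upper half circle.\<close>
      then have "Re (Q w) = 2 * \<tau> - 1" "Im (Q w) = sqrt (1 - (2 * \<tau> - 1)\<^sup>2)"
        using h(1) by auto
      then show False using abs_Im_less_sqrt[OF w'] by simp
    qed
    then show ?thesis unfolding 1(2) by auto
  qed
  have trH: "traces ar1 H (x @ [(m, False)])"
    unfolding traces_iff
  proof (intro allI impI ballI)
    fix j \<tau> assume j: "j < length (x @ [(m, False)])" and "\<tau> \<in> {0..1::real}"
    then have \<tau>: "0 \<le> \<tau>" "\<tau> \<le> 1" by auto
    have len: "real (length (x @ [(m, False)])) = real k + 1" by (simp add: k_def)
    have "real j + \<tau> \<le> real k + 1" using j \<tau> by (simp add: k_def)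
    then have "Q (polar ((real j + \<tau>) / (real k + 1)) 1) = polar (half_circles k ((real j + \<tau>) / (real k + 1))) 1"
      unfolding Q_def using \<tau>
      by (intro circle_rotation.rotate_circles_polar[OF rotQ]) (auto simp: field_simps)
    then have H: "H (polar ((real j + \<tau>) / (real k + 1)) 1) =
        \<psi> (lens \<mu> h (polar (half_circles k ((real j + \<tau>) / (real k + 1))) 1))"
      by (simp add: H_def)
    show "H (polar ((real j + \<tau>) / real (length (x @ [(m, False)]))) 1) = dart_arc ar1 ((x @ [(m, False)]) ! j) \<tau>"
    proof (cases "j < k")
      case True
      have "\<mu> + h * (2 * ((real j + \<tau>) / real k) - 1) = (real (j0 + j) + \<tau>) / real l"
        using l by (simp add: \<mu>_def h_def field_simps)
      then have "H (polar ((real j + \<tau>) / (real k + 1)) 1) = \<psi> (polar ((real (j0 + j) + \<tau>) / real l) 1)"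
        unfolding H using h by (subst half_circles_lower[OF True \<tau>]) auto
      also have "\<dots> = dart_arc ar1 ((u @ x @ v) ! (j0 + j)) \<tau>"
        using True l \<tau> by (intro old_edge) auto
      also have "(u @ x @ v) ! (j0 + j) = (x @ [(m, False)]) ! j"
        using True by (simp add: nth_append j0_def k_def)
      finally show ?thesis unfolding len .
    next
      case False
      then have j: "j = k" using j by (simp add: k_def)
      have "\<bar>1 - 2 * \<tau>\<bar> \<le> 1" using \<tau> by auto
      then have "H (polar ((real j + \<tau>) / (real k + 1)) 1) = \<gamma> (1 - \<tau>)"
        unfolding H unfolding j using h half_circles_upper[OF l(1) \<tau>, of h \<mu>]
        by (simp add: lens_height_eq \<gamma>_def power2_commute[of 1])
      then show ?thesis
        unfolding len by (simp add: j k_def ar1_def dart_arc_def reversepath_def)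
    qed
  qed
  define D2 where "D2 = D1\<lparr>cells := cells D1 @ [x @ [(m, False)]]\<rparr>"
  define ch2 where "ch2 = ch(length (cells D1) := H)"
  have "edge_path D1 s (x @ [(m, False)]) s"
    using paths(2) new(1) edge_path_append[OF labeled_complex_edges[OF 1(3)]] by blast
  note 2 = plane_realization_add_cell[OF 1(3,1) _ this contH injH trH H_disj, folded D2_def ch2_def, simplified]

  \<comment> \<open>Breakpoints for the l - k + 1 new darts: those before and after the cell keep
    their angles, and the single new dart gets the k parts of \<open>x\<close>.\<close>
  define w where "w j = (if j \<le> j0 then real j / real l else (real j - 1 + real k) / real l)" for j
  define l' where "l' = l - k + 1"
  define F where "F = interpolate l' w"
  have rot: "circle_rotation (blend F 0)"
    unfolding F_def
  proof (rule circle_rotation_interpolate)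
    show "w j < w (Suc j)" if "j < l'" for j
      using l by (auto simp: w_def divide_strict_right_mono)
    show "w l' = w 0 + 1" using l by (auto simp: w_def l'_def of_nat_diff)
  qed (simp add: l'_def)
  define \<theta> where "\<theta> = raise \<beta> \<circ> rotate_circles (blend F 0)"
  have ext': "exterior_map (?K \<union> \<psi> ` {polar s r |s r. 0 \<le> s \<and> s < 1 \<and> 1 < r \<and> r \<le> 1 + \<beta> s}) (\<psi> \<circ> \<theta>)"
    unfolding \<theta>_def using ext \<beta> rot by (rule exterior_map_raise)
  have sphere: "\<psi> z \<in> ?K" if "norm z = 1" for z
  proof -
    have "(\<Union>d\<in>set (u @ x @ v). path_image (ar (fst d))) \<subseteq> ?K"
      using edge_path_darts[OF u] edge_path_darts[OF v] edge_path_darts[OF x]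
      by (auto simp: complex_image_def skeleton_image_def)
    then show ?thesis using traces_sphere[OF tr _ that] bd(2) by auto
  qed
  have in_K': "\<psi> (lens \<mu> h w) \<in> ?K \<union> \<psi> ` {polar s r |s r. 0 \<le> s \<and> s < 1 \<and> 1 < r \<and> r \<le> 1 + \<beta> s}"
    if "norm w \<le> 1" for w
    using lens_cases[OF h that] sphere unfolding \<beta>_def by blast
  \<comment> \<open>The cell with its new edge fills the region below the graph of
    \<open>\<beta>\<close>; what else the closed lens contains lies on the unit circle and is sent
    into the old complex.\<close>
  have "?K \<union> \<psi> ` {polar s r |s r. 0 \<le> s \<and> s < 1 \<and> 1 < r \<and> r \<le> 1 + \<beta> s} = complex_image D2 pt ar1 ch2"
    (is "?K' = _")
  proof -
    have "H w \<in> ?K'" if "norm w \<le> 1" for w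
      using in_K'[of "Q w"] that by (simp add: H_def normQ)
    then have "H ` cball 0 1 \<subseteq> ?K'" by (simp add: image_subset_iff)
    moreover have "path_image \<gamma> \<subseteq> ?K'"
    proof
      fix z assume "z \<in> path_image \<gamma>"
      then obtain \<tau> where \<tau>: "z = \<gamma> \<tau>" "0 \<le> \<tau>" "\<tau> \<le> 1"
        by (auto simp: path_image_def)
      define w where "w = Complex (2 * \<tau> - 1) (sqrt (1 - (2 * \<tau> - 1)\<^sup>2))"
      have "norm w = 1" using sq'[OF \<tau>(2,3)] by (simp add: w_def cmod_def)
      moreover have "z = \<psi> (lens \<mu> h w)" by (simp add: \<tau> \<gamma>_def lens_def w_def)
      ultimately show "z \<in> ?K'" using in_K'[of w] by simp
    qed
    moreover have "\<psi> (polar s r) \<in> H ` cball 0 1" if rs: "1 < r" "r \<le> 1 + \<beta> s" for s r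
    proof -
      obtain w where w: "norm w \<le> 1" "lens \<mu> h w = polar s r"
        using lens_onto[OF h(1) rs[unfolded \<beta>_def]] by blast
      have "\<exists>w0. norm w0 = norm w \<and> Q w0 = w"
      proof (cases "w = 0")
        case True
        then show ?thesis using normQ[of 0] by auto
      next
        case False
        then show ?thesis unfolding Q_def by (rule circle_rotation.rotate_circles_surj[OF rotQ])
      qed
      then obtain w0 where "norm w0 = norm w" "Q w0 = w" by blast
      then show ?thesis using w by (intro image_eqI[of _ H w0]) (simp_all add: H_def)
    qed
    ultimately show ?thesis unfolding 2(2) 1(2) by auto
  qed
  then have ext': "exterior_map (complex_image D2 pt ar1 ch2) (\<psi> \<circ> \<theta>)" using ext' by simp

  let ?ds = "u @ [(m, True)] @ v"
  have tr': "(\<psi> \<circ> \<theta>) (polar ((real j + \<tau>) / real l') 1) = dart_arc ar1 (?ds ! j) \<tau>"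
    if j: "j < l'" and \<tau>: "0 \<le> \<tau>" "\<tau> \<le> 1" for j \<tau>
  proof -
    define \<sigma> where "\<sigma> = w j + \<tau> * (w (Suc j) - w j)"
    have R: "rotate_circles (blend F 0) (polar ((real j + \<tau>) / real l') 1) = polar \<sigma> 1"
      unfolding F_def \<sigma>_def using rot j \<tau> unfolding F_def
      by (subst rotate_circles_interpolate) auto
    have \<theta>: "\<theta> (polar ((real j + \<tau>) / real l') 1) = polar \<sigma> (1 + \<beta> \<sigma>)" if "0 \<le> \<sigma>" "\<sigma> \<le> 1"
      unfolding \<theta>_def o_def R using that by (subst bump.raise_polar[OF \<beta>]) auto
    have flat: "\<beta> \<sigma> = 0" if "h \<le> \<bar>\<sigma> - \<mu>\<bar>"
    proof -
      have "1 \<le> \<bar>(\<sigma> - \<mu>) / h\<bar>" using that h(1) by (simp add: abs_divide)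
      then have "1 \<le> ((\<sigma> - \<mu>) / h)\<^sup>2" by (metis abs_le_square_iff abs_one one_power2)
      then show ?thesis by (simp add: \<beta>_def lens_height_def)
    qed
    have \<mu>h: "\<mu> - h = real j0 / real l" "\<mu> + h = (real j0 + real k) / real l"
      using l by (auto simp: \<mu>_def h_def field_simps)
    consider "j < j0" | "j = j0" | "j0 < j" by linarith
    then show ?thesis
    proof cases
      case 1
      have "\<sigma> = (real j + \<tau>) / real l" using 1 l by (simp add: \<sigma>_def w_def field_simps)
      moreover from this have "0 \<le> \<sigma>" "\<sigma> \<le> \<mu> - h"
        using 1 \<tau> l unfolding \<mu>h by (auto simp: divide_le_cancel)
      ultimately have "\<theta> (polar ((real j + \<tau>) / real l') 1) = polar ((real j + \<tau>) / real l) 1"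
        using \<theta> flat h by simp
      moreover have "?ds ! j = (u @ x @ v) ! j" using 1 by (simp add: nth_append j0_def)
      ultimately show ?thesis using old_edge[of j] 1 l \<tau> by simp
    next
      case 2
      have \<sigma>: "\<sigma> = \<mu> + h * (2 * \<tau> - 1)" using 2 l
        by (simp add: \<sigma>_def w_def \<mu>_def h_def field_simps)
      have "\<bar>2 * \<tau> - 1\<bar> \<le> 1" using \<tau> by auto
      then have \<beta>\<sigma>: "\<beta> \<sigma> = sqrt (1 - (2 * \<tau> - 1)\<^sup>2)"
        using h(1) unfolding \<beta>_def \<sigma> by (subst lens_height_eq) auto
      have "0 \<le> h * \<tau>" "h * \<tau> \<le> h" using h(1) \<tau> by (auto simp: mult_left_le)
      moreover have "h * (2 * \<tau> - 1) = 2 * (h * \<tau>) - h" by (simp add: algebra_simps)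
      ultimately have "0 \<le> \<sigma>" "\<sigma> \<le> 1" using h unfolding \<sigma> by linarith+
      then have "\<psi> (\<theta> (polar ((real j + \<tau>) / real l') 1)) = \<gamma> \<tau>"
        using \<theta> \<beta>\<sigma> by (simp add: \<gamma>_def \<sigma>)
      then show ?thesis using 2 by (simp add: nth_append j0_def ar1_def dart_arc_def)
    next
      case 3
      define i where "i = j - 1 + k"
      have i: "j0 + k \<le> i" "i < l" "real i = real j - 1 + real k" using 3 j l
        by (auto simp: i_def l'_def)
      have "\<sigma> = (real i + \<tau>) / real l" using 3 l unfolding i(3)
        by (simp add: \<sigma>_def w_def field_simps)
      moreover from this have "\<mu> + h \<le> \<sigma>" "\<sigma> \<le> 1"
        using i(1,2) \<tau> l unfolding \<mu>h by (auto simp: divide_le_cancel)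
      ultimately have "\<theta> (polar ((real j + \<tau>) / real l') 1) = polar ((real i + \<tau>) / real l) 1"
        using \<theta> flat h by simp
      moreover have "?ds ! j = (u @ x @ v) ! i"
      proof -
        obtain e where "j = Suc (j0 + e)" using 3 less_iff_Suc_add by auto
        then show ?thesis by (simp add: i_def nth_append j0_def k_def)
      qed
      ultimately show ?thesis using old_edge[of i] i \<tau> by simp
    qed
  qed
  have "length ?ds = l'" by (simp add: l_def l'_def k_def)
  then have "traces ar1 (\<psi> \<circ> \<theta>) ?ds"
    unfolding traces_iff using tr' by simp
  moreover have "edge_path D2 (basepoint D2) ?ds (basepoint D2)"
  proof -
    have "edge_path D1 (basepoint D) ?ds (basepoint D)"
      using paths new edge_path_append[OF labeled_complex_edges[OF 1(3)]] by blast
    then show ?thesis using edge_path_extend[of D1 _ _ _ D2 "[]"] by (simp add: D2_def D1_def)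
  qed
  ultimately have "realized A (D2\<lparr>boundary := ?ds\<rparr>)"
    by (intro realized_boundaryI[OF 2(3,1) ext']) auto
  moreover have "D2\<lparr>boundary := ?ds\<rparr> = D\<lparr>edges := edges D @ [(s, a, t)], cells := cells D @ [x @ [(m, False)]],
    boundary := ?ds\<rparr>"
    by (simp add: D2_def D1_def)
  ultimately show ?thesis by simp
qed

section \<open>The point and its first spike\<close>

definition point_diagram :: "'a diagram" where
  "point_diagram = \<lparr>nverts = 1, edges = [], cells = [], basepoint = 0, boundary = []\<rparr>"

lemma realized_point: "realized A point_diagram"
proof -
  define \<psi> where "\<psi> z = complex_of_real ((norm z - 1) / (2 * norm z)) * z" for z :: complex
  let ?D = "point_diagram :: 'a diagram"
  have image: "complex_image ?D (\<lambda>_. 0) (\<lambda>_ _. 0) (\<lambda>_ _. 0) = {0}"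
    by (simp add: complex_image_def skeleton_image_def point_diagram_def lessThan_Suc)
  show ?thesis
    unfolding realized_def
  proof (intro conjI exI[of _ "\<lambda>_::nat. 0::complex"]
      exI[of _ "\<lambda>(_::nat) _. 0::complex"] exI[of _ \<psi>])
    show "labeled_complex A ?D" by (simp add: labeled_complex_def point_diagram_def)
    show "plane_realization ?D (\<lambda>_. 0) (\<lambda>_ _. 0) (\<lambda>_ _. 0)"
      by (simp add: plane_realization_def point_diagram_def disjoint_family_on_def lessThan_Suc)
    show "exterior_map (complex_image ?D (\<lambda>_. 0) (\<lambda>_ _. 0) (\<lambda>_ _. 0)) \<psi>"
      unfolding image \<psi>_def[abs_def] by (rule exterior_map_point)
    show "\<psi> 1 = 0" by (simp add: \<psi>_def)
    show "traces (\<lambda>_ _. 0) \<psi> (boundary ?D)" by (simp add: traces_def point_diagram_def)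
    have "\<psi> z = 0" if "norm z = 1" for z using that by (simp add: \<psi>_def)
    then have "\<psi> ` sphere 0 1 \<subseteq> {0}" by auto
    moreover have "0 \<in> \<psi> ` sphere 0 1"
      by (rule image_eqI[of 0 \<psi> 1]) (simp_all add: \<psi>_def)
    ultimately have "\<psi> ` sphere 0 1 = {0}" by blast
    then show "boundary ?D = [] \<longrightarrow> \<psi> ` sphere 0 1 = {0}" ..
  qed
qed

text \<open>The boundary of a point has no darts, hence no subdivided circle to slit. The first
  spike is given outright as the segment from 1 to -1. Its exterior map is the Joukowski map, which
  on the unit circle is the cosine and runs along the segment and back.\<close>

lemma realized_point_spike:
  assumes a: "a \<in> A"
  shows "realized A (point_diagram\<lparr>nverts := 2, edges := [(0, a, 1)], boundary := [(0, True), (0, False)]\<rparr>)"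
proof -
  let ?D0 = "\<lparr>nverts = 2, edges = [(0, a, 1)], cells = [], basepoint = 0, boundary = []\<rparr>"
  define pt :: "nat \<Rightarrow> complex" where "pt i = (if i = 0 then 1 else -1)" for i
  define ar :: "nat \<Rightarrow> real \<Rightarrow> complex" where "ar i t = of_real (cos (pi * t))" for i t
  let ?\<psi> = "\<lambda>z::complex. (z + inverse z) / 2"
  have cos_eq: "s = t" if "cos (pi * s) = cos (pi * t)" "s \<in> {0..1}" "t \<in> {0..1}" for s t :: real
    using that cos_inj_pi[of "pi * s" "pi * t"] by (auto simp: mult_left_le)
  have "ar i ` {0..1} = of_real ` {-1..1}" for i
  proof (intro subset_antisym subsetI)
    fix z :: complex assume "z \<in> of_real ` {-1..1::real}"
    then obtain y where y: "z = of_real y" "-1 \<le> y" "y \<le> 1" by auto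
    then have "z = ar i (arccos y / pi)" by (simp add: ar_def cos_arccos)
    moreover have "arccos y / pi \<in> {0..1}" using y arccos_lbound[of y] arccos_ubound[of y] by auto
    ultimately show "z \<in> ar i ` {0..1}" by blast
  qed (auto simp: ar_def)
  moreover have pt_image: "pt ` {..<2} = {-1, 1}"
    by (simp add: numeral_2_eq_2 lessThan_Suc pt_def)
  moreover have "- 1 \<in> complex_of_real ` {-1..1}" "1 \<in> complex_of_real ` {-1..1}"
    by (rule image_eqI[of _ _ "-1"], simp_all)
  ultimately have image: "complex_image ?D0 pt ar ch = of_real ` {-1..1}" for ch
    by (simp add: complex_image_def skeleton_image_def path_image_def insert_absorb lessThan_Suc)
  have D0: "labeled_complex A ?D0"
    using a by (simp add: labeled_complex_def)
  have "arc (ar i)" for i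
    unfolding arc_def path_def ar_def using cos_eq by (auto intro!: continuous_intros inj_onI)
  moreover have "ar 0 ` {0<..<1} \<inter> pt ` {..<2} = {}"
  proof -
    have "ar 0 t \<noteq> 1" "ar 0 t \<noteq> - 1" if "t \<in> {0<..<1}" for t
      using that cos_eq[of t 0] cos_eq[of t 1] by (auto simp: ar_def complex_eq_iff)
    then show ?thesis unfolding pt_image by fastforce
  qed
  ultimately have r: "plane_realization ?D0 pt ar ch" for ch
    unfolding plane_realization_def
    by (auto simp: arc_imp_simple_path pathstart_def pathfinish_def ar_def pt_def dart_source_def dart_target_def
        disjoint_family_on_def inj_on_def less_2_cases_iff)
  have cis: "?\<psi> (cis t) = of_real (cos t)" for t
    by (simp add: complex_eq_iff)
  have tr: "traces ar ?\<psi> [(0, True), (0, False)]"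
    unfolding traces_def cis
  proof (intro allI impI ballI)
    fix j and t :: real assume "j < length [(0::nat, True), (0, False)]"
    then consider "j = 0" | "j = 1" by force
    then show "of_real (cos (2 * pi * (real j + t) / real (length [(0::nat, True), (0, False)]))) =
        dart_arc ar ([(0, True), (0, False)] ! j) t"
    proof cases
      case 2
      have "cos (2 * pi * (1 + t) / 2) = - cos (pi * t)"
      proof -
        have "2 * pi * (1 + t) / 2 = pi * t + pi" by (simp add: field_simps)
        then show ?thesis using cos_periodic_pi[of "pi * t"] by simp
      qed
      moreover have "cos (pi * (1 - t)) = - cos (pi * t)"
        using cos_periodic_pi2[of "- (pi * t)"] by (simp add: algebra_simps)
      ultimately show ?thesis using 2 by (simp add: dart_arc_def ar_def reversepath_def)
    qed (simp add: dart_arc_def ar_def)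
  qed
  have ext: "exterior_map (complex_image ?D0 pt ar ch) ?\<psi>" for ch
    unfolding image by (rule exterior_map_segment)
  have "realized A (?D0\<lparr>boundary := [(0, True), (0, False)]\<rparr>)"
    by (rule realized_boundaryI[OF D0 r ext tr]) (auto simp: dart_source_def dart_target_def)
  then show ?thesis by (simp add: point_diagram_def)
qed

section \<open>Programming with partial recursive functions\<close>

lemma computes_Comp1: "computes q xs y \<Longrightarrow> computes p [y] z \<Longrightarrow> computes (Comp p [q]) xs z"
  by (rule computes.intros(4)[where ys = "[y]"]) auto

lemma computes_Comp2:
  "computes q xs y \<Longrightarrow> computes q' xs y' \<Longrightarrow> computes p [y, y'] z \<Longrightarrow> computes (Comp p [q, q']) xs z"
  by (rule computes.intros(4)[where ys = "[y, y']"]) auto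

lemma computes_Proj: "i < length xs \<Longrightarrow> y = xs ! i \<Longrightarrow> computes (Proj i) xs y"
  by (simp add: computes.intros(3))

lemma computes_PrimRec:
  assumes "computes p xs (h 0)" "\<And>n. computes q (n # h n # xs) (h (Suc n))"
  shows "computes (PrimRec p q) (n # xs) (h n)"
  by (induction n) (auto intro: computes.intros(5,6) assms)

lemma computes_Mu:
  assumes "\<And>m. computes p (m # xs) (h m)" "h n = 0" "\<And>m. m < n \<Longrightarrow> h m \<noteq> 0"
  shows "computes (Mu p) xs n"
  using assms by (intro computes.intros(7)) (metis, metis not0_implies_Suc)

lemma computes_const: "\<exists>p. \<forall>xs. computes p xs n"
  by (induction n) (blast intro: computes.intros(1), blast intro: computes_Comp1 computes.intros(2))

lemma computes_add: "\<exists>p. \<forall>m n. computes p [m, n] (m + n)"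
proof (intro exI allI)
  fix m n
  show "computes (PrimRec (Proj 0) (Comp Succ [Proj 1])) [m, n] (m + n)"
    by (rule computes_PrimRec) (auto intro!: computes_Proj computes_Comp1 computes.intros(2))
qed

lemma computes_pred: "\<exists>p. \<forall>n. computes p [n] (n - 1)"
proof (intro exI allI)
  fix n
  show "computes (PrimRec Zero (Proj 0)) [n] (n - 1)"
    by (rule computes_PrimRec) (auto intro!: computes_Proj computes.intros(1))
qed

text \<open>Primitive recursion runs over the first argument, so the subtrahend comes first.\<close>

lemma computes_diff: "\<exists>p. \<forall>m n. computes p [m, n] (n - m)"
proof -
  obtain p where p: "\<And>n. computes p [n] (n - 1)"
    using computes_pred by blast
  have "computes (PrimRec (Proj 0) (Comp p [Proj 1])) [m, n] (n - m)" for m n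
  proof (rule computes_PrimRec)
    fix k
    show "computes (Comp p [Proj 1]) [k, n - k, n] (n - Suc k)"
      using p[of "n - k"] by (auto intro!: computes_Comp1 computes_Proj)
  qed (auto intro: computes_Proj)
  then show ?thesis by blast
qed

lemma computes_triangle: "\<exists>p. \<forall>n. computes p [n] (triangle n)"
proof -
  obtain p where p: "\<And>m n. computes p [m, n] (m + n)"
    using computes_add by blast
  have "computes (PrimRec Zero (Comp p [Proj 1, Comp Succ [Proj 0]])) [n] (triangle n)" for n
  proof (rule computes_PrimRec)
    fix n
    have "computes p [triangle n, Suc n] (triangle (Suc n))"
      using p[of "triangle n" "Suc n"] by simp
    then show "computes (Comp p [Proj 1, Comp Succ [Proj 0]]) [n, triangle n] (triangle (Suc n))"
      by (auto intro!: computes_Comp2 computes_Comp1 computes_Proj computes.intros(2))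
  qed (auto intro: computes.intros(1))
  then show ?thesis by blast
qed

lemma computes_prod_encode: "\<exists>p. \<forall>m n. computes p [m, n] (prod_encode (m, n))"
proof -
  obtain p where p: "\<And>m n. computes p [m, n] (m + n)"
    using computes_add by blast
  obtain t where t: "\<And>n. computes t [n] (triangle n)"
    using computes_triangle by blast
  have "computes (Comp p [Comp t [p], Proj 0]) [m, n] (prod_encode (m, n))" for m n
    unfolding prod_encode_def prod.case
    by (rule computes_Comp2[OF computes_Comp1[OF p t] _ p]) (auto intro: computes_Proj)
  then show ?thesis by blast
qed

lemma triangle_mono: "m \<le> n \<Longrightarrow> triangle m \<le> triangle n"
  unfolding triangle_def by (intro div_le_mono mult_le_mono) auto

text \<open>The code of (m, n) is the triangular number of m + n plus m. Hence m + n is the least k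
  for which the code is below the triangular number of k + 1, and \<open>Mu\<close> finds
  it.\<close>

lemma computes_triangle_root:
  "\<exists>p. \<forall>m n. computes p [prod_encode (m, n)] (m + n)"
proof -
  obtain d where d: "\<And>m n. computes d [m, n] (n - m)"
    using computes_diff by blast
  obtain t where t: "\<And>n. computes t [n] (triangle n)"
    using computes_triangle by blast
  define q where "q = Comp d [Comp t [Comp Succ [Proj 0]], Comp Succ [Proj 1]]"
  have q: "computes q [k, x] (Suc x - triangle (Suc k))" for k x
    unfolding q_def
    by (rule computes_Comp2[OF computes_Comp1[OF computes_Comp1 t] computes_Comp1 d];
        (rule computes.intros(2) | rule computes_Proj); simp)
  have "computes (Mu q) [prod_encode (m, n)] (m + n)" for m n
  proof (rule computes_Mu[OF q])
    show "Suc (prod_encode (m, n)) - triangle (Suc (m + n)) = 0"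
      by (simp add: prod_encode_def)
    fix k assume "k < m + n"
    then show "Suc (prod_encode (m, n)) - triangle (Suc k) \<noteq> 0"
      using triangle_mono[of "Suc k" "m + n"] by (simp add: prod_encode_def del: triangle_Suc)
  qed
  then show ?thesis by blast
qed

lemma shows computes_prod_decode_fst: "\<exists>p. \<forall>m n. computes p [prod_encode (m, n)] m"
    and computes_prod_decode_snd: "\<exists>p. \<forall>m n. computes p [prod_encode (m, n)] n"
proof -
  obtain d where d: "\<And>m n. computes d [m, n] (n - m)"
    using computes_diff by blast
  obtain t where t: "\<And>n. computes t [n] (triangle n)"
    using computes_triangle by blast
  obtain r where r: "\<And>m n. computes r [prod_encode (m, n)] (m + n)"
    using computes_triangle_root by blast
  define f where "f = Comp d [Comp t [r], Proj 0]"
  have f: "computes f [prod_encode (m, n)] m" for m n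
  proof -
    have "computes d [triangle (m + n), prod_encode (m, n)] m"
      using d[of "triangle (m + n)" "prod_encode (m, n)"] by (simp add: prod_encode_def)
    then show ?thesis
      unfolding f_def by (intro computes_Comp2[OF computes_Comp1[OF r t]] computes_Proj) auto
  qed
  then show "\<exists>p. \<forall>m n. computes p [prod_encode (m, n)] m" by blast
  have "computes (Comp d [f, r]) [prod_encode (m, n)] n" for m n
    using computes_Comp2[OF f r, of d m n n] d[of m "m + n"] by simp
  then show "\<exists>p. \<forall>m n. computes p [prod_encode (m, n)] n" by blast
qed


section \<open>Computable functions on coded types\<close>

text \<open>The codes of numbers, Booleans, pairs and lists are chosen as in the encodings of words,
  triples and diagrams, so that computable functions apply to these encodings without
  translation.\<close>

class coded =
  fixes code_of :: "'a \<Rightarrow> nat"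
  assumes inj_code_of: "inj code_of"

instantiation nat :: coded
begin
definition "code_of (n :: nat) = n"
instance by standard (simp add: code_of_nat_def inj_on_def)
end

instantiation bool :: coded
begin
definition "code_of b = (if b then 1 else 0 :: nat)"
instance by standard (simp add: code_of_bool_def inj_on_def)
end

instantiation prod :: (coded, coded) coded
begin
definition "code_of x = prod_encode (code_of (fst x), code_of (snd x))"
instance
  by standard (auto simp: code_of_prod_def inj_on_def dest!: injD[OF inj_code_of])
end

instantiation list :: (coded) coded
begin
definition "code_of xs = list_encode (map code_of xs)"
instance
  by standard (auto simp: code_of_list_def inj_on_def list_encode_eq dest!: map_injective intro: inj_code_of)
end

section \<open>Closure properties of the computable functions\<close>

lemma code_of_eq_iff: "code_of x = code_of y \<longleftrightarrow> x = y"
  using inj_code_of by (auto dest: injD)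

definition computable :: "('a::coded \<Rightarrow> 'b::coded) \<Rightarrow> bool" where
  "computable f \<longleftrightarrow> (\<exists>p. \<forall>x. computes p [code_of x] (code_of (f x)))"

named_theorems computable_intros

lemma computableI: "(\<And>x. computes p [code_of x] (code_of (f x))) \<Longrightarrow> computable f"
  unfolding computable_def by blast

lemma computableE:
  assumes "computable f" obtains p where "\<And>x. computes p [code_of x] (code_of (f x))"
  using assms unfolding computable_def by blast

lemma computable_compose: "computable g \<Longrightarrow> computable f \<Longrightarrow> computable (\<lambda>x. g (f x))"
  by (elim computableE) (rule computableI, rule computes_Comp1)

lemma computable_id [computable_intros]: "computable (\<lambda>x. x)"
  by (rule computableI[where p = "Proj 0"]) (auto intro: computes_Proj)

lemma computable_const [computable_intros]: "computable (\<lambda>x. c)"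
  using computes_const[of "code_of c"] by (auto intro: computableI)

lemma computable_code_of [computable_intros]:
  assumes "computable f" shows "computable (\<lambda>x. code_of (f x))"
proof -
  have "computable (code_of :: 'b \<Rightarrow> nat)"
    by (rule computableI[where p = "Proj 0"]) (auto intro: computes_Proj simp: code_of_nat_def)
  then show ?thesis using computable_compose assms by blast
qed

lemma computable_Pair [computable_intros]:
  assumes "computable f" "computable g" shows "computable (\<lambda>x. (f x, g x))"
proof -
  obtain p where p: "\<And>m n. computes p [m, n] (prod_encode (m, n))"
    using computes_prod_encode by blast
  show ?thesis
    using assms
    by (elim computableE) (rule computableI, simp only: code_of_prod_def fst_conv snd_conv,
        rule computes_Comp2[OF _ _ p])
qed

lemma computable_fst [computable_intros]:
  assumes "computable f" shows "computable (\<lambda>x. fst (f x))"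
proof -
  have "computable (fst :: 'b \<times> 'c \<Rightarrow> 'b)"
    unfolding computable_def code_of_prod_def using computes_prod_decode_fst by auto
  then show ?thesis using computable_compose assms by blast
qed

lemma computable_snd [computable_intros]:
  assumes "computable f" shows "computable (\<lambda>x. snd (f x))"
proof -
  have "computable (snd :: 'b \<times> 'c \<Rightarrow> 'c)"
    unfolding computable_def code_of_prod_def using computes_prod_decode_snd by auto
  then show ?thesis using computable_compose assms by blast
qed

lemma computable_nat2I:
  assumes "\<exists>p. \<forall>m n. computes p [m, n] (h m n)" "computable f" "computable g"
  shows "computable (\<lambda>x. h (f x) (g x) :: nat)"
proof -
  obtain p where p: "\<And>m n. computes p [m, n] (h m n)"
    using assms(1) by blast
  from assms(2,3) show ?thesis
    by (elim computableE) (rule computableI, simp add: code_of_nat_def,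
        rule computes_Comp2[OF _ _ p])
qed

lemma computable_diff [computable_intros]:
  "computable f \<Longrightarrow> computable g \<Longrightarrow> computable (\<lambda>x. f x - g x :: nat)"
  using computable_nat2I[where h = "\<lambda>m n. n - m", OF computes_diff] by blast

lemma computable_add [computable_intros]:
  "computable f \<Longrightarrow> computable g \<Longrightarrow> computable (\<lambda>x. f x + g x :: nat)"
  using computable_nat2I[where h = "\<lambda>m n. m + n", OF computes_add] by blast

lemma computable_Suc [computable_intros]: "computable f \<Longrightarrow> computable (\<lambda>x. Suc (f x))"
  by (elim computableE) (rule computableI[OF computes_Comp1], assumption, simp add: code_of_nat_def,
      rule computes.intros(2))

text \<open>The body is computable as a function of one coded triple; the program assembles this
  triple from the counter, the previous value and the parameter.\<close>

lemma computable_rec_nat [computable_intros]: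
  fixes i :: "'a::coded \<Rightarrow> 'b::coded"
  assumes i: "computable i" and k: "computable k"
    and g: "computable (\<lambda>y. g (fst y) (fst (snd y)) (snd (snd y)))"
  shows "computable (\<lambda>x. rec_nat (i x) (\<lambda>n r. g x n r) (k x))"
proof -
  obtain pi where pi: "\<And>x. computes pi [code_of x] (code_of (i x))"
    using computableE[OF i] by blast
  obtain pk where pk: "\<And>x. computes pk [code_of x] (k x)"
    using computableE[OF k] unfolding code_of_nat_def by blast
  obtain pg where pg: "\<And>x n r. computes pg [prod_encode (code_of x, prod_encode (n, code_of r))] (code_of (g x n r))"
    using computableE[OF g]
    unfolding code_of_prod_def code_of_nat_def split_paired_All split_paired_all fst_conv snd_conv
    by metis
  obtain pp where pp: "\<And>m n. computes pp [m, n] (prod_encode (m, n))"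
    using computes_prod_encode by blast
  define q where "q = Comp pg [Comp pp [Proj 2, Comp pp [Proj 0, Proj 1]]]"
  have q: "computes q [n, code_of r, code_of x] (code_of (g x n r))" for n r x
    unfolding q_def
    by (rule computes_Comp1[OF computes_Comp2[OF _ computes_Comp2[OF _ _ pp] pp] pg])
      (auto intro!: computes_Proj)
  have "computes (PrimRec pi q) [n, code_of x] (code_of (rec_nat (i x) (g x) n))" for n x
    by (rule computes_PrimRec) (auto simp: pi q)
  then have "computes (Comp (PrimRec pi q) [pk, Proj 0]) [code_of x] (code_of (rec_nat (i x) (g x) (k x)))" for x
    by (intro computes_Comp2[OF pk]) (auto intro: computes_Proj)
  then show ?thesis by (rule computableI)
qed

text \<open>A Boolean has code 0 or 1, so the choice is a recursion of at most one round.\<close>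

lemma computable_If [computable_intros]:
  assumes "computable b" "computable f" "computable g"
  shows "computable (\<lambda>x. if b x then f x else g x)"
proof -
  have "computable (\<lambda>x. code_of (b x))"
    using assms(1) by (rule computable_code_of)
  then have "computable (\<lambda>x. rec_nat (g x) (\<lambda>n r. f x) (code_of (b x)))"
    by (intro computable_intros assms computable_compose[OF assms(2)])
  moreover have "rec_nat (g x) (\<lambda>n r. f x) (code_of (b x)) = (if b x then f x else g x)" for x
    by (simp add: code_of_bool_def)
  ultimately show ?thesis by simp
qed

lemma computable_conj [computable_intros]:
  assumes "computable b" "computable c" shows "computable (\<lambda>x. b x \<and> c x)"
proof -
  have "computable (\<lambda>x. if b x then c x else False)"
    by (intro computable_intros assms)
  also have "(\<lambda>x. if b x then c x else False) = (\<lambda>x. b x \<and> c x)" by auto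
  finally show ?thesis .
qed

lemma computable_not [computable_intros]:
  assumes "computable b" shows "computable (\<lambda>x. \<not> b x)"
proof -
  have "computable (\<lambda>x. if b x then False else True)"
    by (intro computable_intros assms)
  also have "(\<lambda>x. if b x then False else True) = (\<lambda>x. \<not> b x)" by auto
  finally show ?thesis .
qed

lemma computable_le [computable_intros]:
  assumes "computable f" "computable g" shows "computable (\<lambda>x. f x \<le> (g x :: nat))"
proof -
  have *: "computable (\<lambda>x. rec_nat True (\<lambda>_ _. False) (f x - g x))"
    by (intro computable_intros assms)
  have "rec_nat True (\<lambda>_ _. False) n \<longleftrightarrow> n = 0" for n :: nat
    by (cases n) auto
  with * show ?thesis by simp
qed

lemma computable_eq [computable_intros]:
  assumes "computable f" "computable g" shows "computable (\<lambda>x. f x = g x)"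
proof -
  have "computable (\<lambda>x. code_of (f x) \<le> code_of (g x) \<and> code_of (g x) \<le> code_of (f x))"
    by (intro computable_intros assms)
  then show ?thesis by (simp add: code_of_eq_iff flip: eq_iff)
qed

subsection \<open>Lists\<close>

lemma code_of_Nil [simp]: "code_of [] = 0"
  and code_of_Cons: "code_of (x # xs) = Suc (prod_encode (code_of x, code_of xs))"
  by (simp_all add: code_of_list_def)

lemma computable_Cons [computable_intros]:
  assumes "computable f" "computable g" shows "computable (\<lambda>x. f x # g x)"
proof -
  have "computable (\<lambda>x. Suc (code_of (f x, g x)))"
    by (intro computable_intros assms)
  then show ?thesis
    unfolding computable_def by (simp add: code_of_Cons code_of_nat_def code_of_prod_def)
qed

text \<open>The default element replaces the unspecified \<open>hd []\<close>.\<close>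

lemma computable_hd [computable_intros]:
  assumes "computable f" "computable d"
  shows "computable (\<lambda>x. if f x = [] then d x else hd (f x))"
proof -
  obtain q where q: "\<And>m n. computes q [prod_encode (m, n)] m"
    using computes_prod_decode_fst by blast
  obtain pf where pf: "\<And>x. computes pf [code_of x] (code_of (f x))"
    using computableE[OF assms(1)] by blast
  obtain pd where pd: "\<And>x. computes pd [code_of x] (code_of (d x))"
    using computableE[OF assms(2)] by blast
  define h where "h = PrimRec (Proj 0) (Comp q [Proj 0])"
  have h: "computes h [code_of xs, code_of y] (code_of (if xs = [] then y else hd xs))" for xs y
  proof (cases xs)
    case Nil
    then show ?thesis
      by (auto simp: h_def intro!: computes.intros(5) computes_Proj)
  next
    case (Cons z zs)
    \<comment> \<open>Primitive recursion passes through all smaller numbers before it reaches the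
      code of the list. Its values there are discarded, but the program must halt on them.\<close>
    have "\<exists>r. computes h [n, code_of y] r" for n
    proof (induction n)
      case 0
      then show ?case by (auto simp: h_def intro!: computes.intros(5) computes_Proj exI)
    next
      case (Suc n)
      moreover obtain m k where "n = prod_encode (m, k)"
        by (metis prod_decode_inverse surj_pair)
      then have "computes (Comp q [Proj 0]) [n, r, code_of y] m" for r
        using q by (intro computes_Comp1[OF _ q]) (auto intro!: computes_Proj)
      ultimately show ?case unfolding h_def by (blast intro: computes.intros(6))
    qed
    then obtain r where "computes h [prod_encode (code_of z, code_of zs), code_of y] r"
      by blast
    then have "computes h [Suc (prod_encode (code_of z, code_of zs)), code_of y] (code_of z)"
      unfolding h_def
      by (rule computes.intros(6)) (auto intro!: computes_Comp1[OF _ q] computes_Proj)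
    then show ?thesis using Cons by (simp add: code_of_Cons)
  qed
  show ?thesis
    by (rule computableI, rule computes_Comp2[OF pf pd h])
qed

lemma computable_tl [computable_intros]:
  assumes "computable f" shows "computable (\<lambda>x. tl (f x))"
proof -
  obtain p where p: "\<And>n. computes p [n] (n - 1)"
    using computes_pred by blast
  obtain q where q: "\<And>m n. computes q [prod_encode (m, n)] n"
    using computes_prod_decode_snd by blast
  obtain pf where pf: "\<And>x. computes pf [code_of x] (code_of (f x))"
    using computableE[OF assms(1)] by blast
  \<comment> \<open>Since 0 codes both the empty list and the pair (0, 0), the program for the tail
    also sends the empty list to itself.\<close>
  have z: "prod_encode (0, 0) = 0"
    by (simp add: prod_encode_def)
  have "computes (Comp q [p]) [code_of xs] (code_of (tl xs))" for xs :: "'b list"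
    by (cases xs; rule computes_Comp1[OF p]; simp add: code_of_Cons q)
      (metis q z)
  then show ?thesis
    by (intro computableI, rule computes_Comp1[OF pf])
qed

text \<open>A fold over a list takes at most as many rounds as its code says, so primitive recursion
  over the code can carry it out.\<close>

lemma length_le_code_of: "length xs \<le> code_of xs"
proof (induction xs)
  case (Cons x xs)
  then show ?case using le_prod_encode_2[of "code_of xs" "code_of x"] by (simp add: code_of_Cons)
qed simp

text \<open>Each round consumes one element; once the list is used up, further rounds change
  nothing.\<close>

lemma foldl_eq_iterate:
  "length xs \<le> n \<Longrightarrow>
   rec_nat (s, xs) (\<lambda>_ r. if snd r = [] then r else (g (fst r) (hd (snd r)), tl (snd r))) n
   = (foldl g s xs, [])"
proof -
  let ?f = "\<lambda>r. if snd r = [] then r else (g (fst r) (hd (snd r)), tl (snd r))"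
  have "rec_nat r0 (\<lambda>_. ?f) n = (?f ^^ n) r0" for r0 n
    by (induction n) auto
  moreover have "length xs \<le> n \<Longrightarrow> (?f ^^ n) (s, xs) = (foldl g s xs, [])"
  proof (induction xs arbitrary: n s)
    case Nil
    show ?case by (induction n) auto
  next
    case (Cons x xs)
    then obtain m where "n = Suc m" by (cases n) auto
    with Cons show ?case by (simp add: funpow_Suc_right del: funpow.simps)
  qed
  ultimately show "length xs \<le> n \<Longrightarrow> ?thesis" by simp
qed

lemma computable_foldl [computable_intros]:
  assumes "computable i" "computable l"
    and g: "computable (\<lambda>y. g (fst y) (fst (snd y)) (snd (snd y)))"
  shows "computable (\<lambda>x. foldl (\<lambda>s e. g x s e) (i x) (l x))"
proof -
  have g': "computable (\<lambda>y. g (a y) (b y) (c y))"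
    if "computable a" "computable b" "computable c" for a :: "'z::coded \<Rightarrow> 'a" and b c
    using computable_compose[OF g, of "\<lambda>y. (a y, b y, c y)"] that by (simp add: computable_intros)
  \<comment> \<open>The default \<open>undefined\<close> gives the term the form of
    \<open>computable_hd\<close>; the surrounding condition excludes the empty list.\<close>
  have "computable (\<lambda>x. rec_nat (i x, l x)
     (\<lambda>_ r. if snd r = [] then r else (g x (fst r) (if snd r = [] then undefined else hd (snd r)), tl (snd r)))
     (code_of (l x)))"
    by (intro computable_intros g' assms)
  also have "(\<lambda>x. rec_nat (i x, l x)
     (\<lambda>_ r. if snd r = [] then r else (g x (fst r) (if snd r = [] then undefined else hd (snd r)), tl (snd r)))
     (code_of (l x))) = (\<lambda>x. (foldl (\<lambda>s e. g x s e) (i x) (l x), []))"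
    by (subst foldl_eq_iterate[symmetric, OF length_le_code_of]) (simp cong: if_cong)
  finally have "computable (\<lambda>x. fst (foldl (\<lambda>s e. g x s e) (i x) (l x), [] :: 'c list))"
    by (rule computable_fst)
  then show ?thesis by simp
qed

lemma computable_rev [computable_intros]:
  assumes "computable f" shows "computable (\<lambda>x. rev (f x))"
proof -
  have "foldl (\<lambda>s e. e # s) ys xs = rev xs @ ys" for xs ys :: "'b list"
    by (induction xs arbitrary: ys) auto
  moreover have "computable (\<lambda>x. foldl (\<lambda>s e. e # s) [] (f x))"
    by (intro computable_intros assms)
  ultimately show ?thesis by simp
qed

lemma computable_append [computable_intros]:
  assumes "computable f" "computable g" shows "computable (\<lambda>x. f x @ g x)"
proof -
  have "foldl (\<lambda>s e. e # s) ys (rev xs) = xs @ ys" for xs ys :: "'b list"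
    by (induction xs arbitrary: ys) auto
  moreover have "computable (\<lambda>x. foldl (\<lambda>s e. e # s) (g x) (rev (f x)))"
    by (intro computable_intros assms)
  ultimately show ?thesis by simp
qed

lemma computable_map [computable_intros]:
  fixes g :: "'a::coded \<Rightarrow> 'b::coded \<Rightarrow> 'c::coded"
  assumes "computable l" and g: "computable (\<lambda>y. g (fst y) (snd y))"
  shows "computable (\<lambda>x. map (\<lambda>e. g x e) (l x))"
proof -
  have g': "computable (\<lambda>y. g (a y) (b y))"
    if "computable a" "computable b" for a :: "'z::coded \<Rightarrow> 'a" and b
    using computable_compose[OF g, of "\<lambda>y. (a y, b y)"] that by (simp add: computable_intros)
  have "foldl (\<lambda>s e. s @ [h e]) ys xs = ys @ map h xs" for xs :: "'b list" and h :: "'b \<Rightarrow> 'c" and ys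
    by (induction xs arbitrary: ys) auto
  moreover have "computable (\<lambda>x. foldl (\<lambda>s e. s @ [g x e]) [] (l x))"
    by (intro computable_intros assms g')
  ultimately show ?thesis by simp
qed

lemma computable_length [computable_intros]:
  assumes "computable f" shows "computable (\<lambda>x. length (f x))"
proof -
  have "foldl (\<lambda>s e. Suc s) n xs = n + length xs" for xs :: "'b list" and n
    by (induction xs arbitrary: n) auto
  moreover have "computable (\<lambda>x. foldl (\<lambda>s e. Suc s) 0 (f x))"
    by (intro computable_intros assms)
  ultimately show ?thesis by simp
qed

lemma computable_drop [computable_intros]:
  assumes "computable k" "computable f" shows "computable (\<lambda>x. drop (k x) (f x))"
proof -
  have "rec_nat xs (\<lambda>_ r. tl r) n = drop n xs" for xs :: "'b list" and n
    by (induction n) (auto simp: drop_Suc tl_drop)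
  moreover have "computable (\<lambda>x. rec_nat (f x) (\<lambda>_ r. tl r) (k x))"
    by (intro computable_intros assms)
  ultimately show ?thesis by simp
qed

lemma computable_take [computable_intros]:
  assumes "computable k" "computable f" shows "computable (\<lambda>x. take (k x) (f x))"
proof -
  have "take n xs = rev (drop (length xs - n) (rev xs))" for xs :: "'b list" and n
    by (cases "n \<le> length xs") (simp_all add: drop_rev) 
  moreover have "computable (\<lambda>x. rev (drop (length (f x) - k x) (rev (f x))))"
    by (intro computable_intros assms)
  ultimately show ?thesis by simp
qed

section \<open>Finite tables, decidable sets and unbounded search\<close>

lemma computable_finite_support:
  fixes f :: "nat \<Rightarrow> 'b::coded"
  assumes "finite S" "\<And>n. n \<notin> S \<Longrightarrow> f n = d"
  shows "computable f"
  using assms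
proof (induction S arbitrary: f rule: finite_induct)
  case empty
  then have "f = (\<lambda>_. d)" by auto
  then show ?case by (simp add: computable_const)
next
  case (insert a S)
  have "computable (\<lambda>n. if n = a then f a else (f(a := d)) n)"
    by (intro computable_intros insert.IH) (use insert.prems in auto)
  also have "(\<lambda>n. if n = a then f a else (f(a := d)) n) = f" by auto
  finally show ?case .
qed

lemma computable_recursive_set:
  assumes "recursive_set X" "computable f" shows "computable (\<lambda>x. f x \<in> X)"
proof -
  have "computable (\<lambda>n. n \<in> X)"
    using assms(1) unfolding recursive_set_def computable_def code_of_nat_def code_of_bool_def .
  then show ?thesis using computable_compose assms(2) by blast
qed

text \<open>As the coding of candidates is surjective, \<open>Mu\<close> can run through all numbers
  and test the candidate coded by each. The one found need not be the one whose existence was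
  known.\<close>

lemma computes_search:
  fixes P :: "'a::coded \<times> 'b::coded \<Rightarrow> bool" and f :: "'a \<times> 'b \<Rightarrow> 'c::coded"
  assumes "computable P" "computable f" and surj: "surj (code_of :: 'b \<Rightarrow> nat)"
  shows "\<exists>p. \<forall>x. (\<exists>y. P (x, y)) \<longrightarrow> (\<exists>y. P (x, y) \<and> computes p [code_of x] (code_of (f (x, y))))"
proof -
  have "computable (\<lambda>x. \<not> P x)"
    by (intro computable_intros assms)
  then obtain p where p: "\<And>x. computes p [code_of x] (code_of (\<not> P x))"
    using computableE by blast
  obtain q where q: "\<And>x. computes q [code_of x] (code_of (f x))"
    using computableE[OF assms(2)] by blast
  obtain pp where pp: "\<And>m n. computes pp [m, n] (prod_encode (m, n))"
    using computes_prod_encode by blast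
  define d :: "nat \<Rightarrow> 'b" where "d = inv_into UNIV code_of"
  have d: "code_of (d n) = n" for n
    unfolding d_def using surj by (rule surj_f_inv_f)
  have pair: "prod_encode (code_of x, n) = code_of (x, d n)" for x :: 'a and n
    by (simp add: code_of_prod_def d)
  define r where "r = Mu (Comp p [Comp pp [Proj 1, Proj 0]])"
  have "\<exists>y. P (x, y) \<and> computes (Comp q [Comp pp [Proj 0, r]]) [code_of x] (code_of (f (x, y)))"
    if "P (x, y)" for x y
  proof -
    define n where "n = (LEAST n. P (x, d n))"
    have "P (x, d (code_of y))"
      using that d[of "code_of y"] by (simp add: code_of_eq_iff)
    then have n: "P (x, d n)" "m < n \<Longrightarrow> \<not> P (x, d m)" for m
      unfolding n_def by (auto intro: LeastI dest: not_less_Least)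
    have "computes (Comp p [Comp pp [Proj 1, Proj 0]]) [m, code_of x] (code_of (\<not> P (x, d m)))" for m
      by (rule computes_Comp1[OF computes_Comp2[OF _ _ pp]])
        (auto intro!: computes_Proj simp: p pair)
    then have "computes r [code_of x] n"
      unfolding r_def by (rule computes_Mu) (use n in \<open>auto simp: code_of_bool_def\<close>)
    then have "computes (Comp q [Comp pp [Proj 0, r]]) [code_of x] (code_of (f (x, d n)))"
      by (intro computes_Comp1[OF computes_Comp2[OF _ _ pp]]) (auto intro!: computes_Proj simp: q pair)
    with n(1) show ?thesis by blast
  qed
  then show ?thesis by blast
qed

lemma surj_code_of_nat: "surj (code_of :: nat \<Rightarrow> nat)"
  by (rule surjI[where f = id]) (simp add: code_of_nat_def)

lemma surj_code_of_prod:
  assumes "surj (code_of :: 'a::coded \<Rightarrow> nat)" "surj (code_of :: 'b::coded \<Rightarrow> nat)"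
  shows "surj (code_of :: 'a \<times> 'b \<Rightarrow> nat)"
proof (rule surjI)
  fix n
  show "code_of (map_prod (inv_into UNIV code_of) (inv_into UNIV code_of) (prod_decode n) :: 'a \<times> 'b) = n"
    using assms by (simp add: code_of_prod_def surj_f_inv_f)
qed

lemma surj_code_of_list:
  assumes "surj (code_of :: 'a::coded \<Rightarrow> nat)"
  shows "surj (code_of :: 'a list \<Rightarrow> nat)"
proof (rule surjI)
  fix n
  show "code_of (map (inv_into UNIV code_of) (list_decode n) :: 'a list) = n"
    using assms by (simp add: code_of_list_def surj_f_inv_f o_def)
qed

section \<open>Rewriting along a stacking\<close>

locale stacked_group =
  fixes G :: "('g, 'm) monoid_scheme" and A :: "'a set" and \<iota> :: "'a \<Rightarrow> 'a" and \<pi> :: "'a \<Rightarrow> 'g"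
    and N :: "'a list set" and c :: "'g \<times> 'a \<Rightarrow> 'a list"
  assumes is_group: "group G" and generators: "symmetric_generating_set G A \<iota> \<pi>"
    and is_stacking: "stacking G A \<iota> \<pi> N c"
begin

sublocale group G by (rule is_group)

abbreviation "val \<equiv> word_value G \<pi>"
abbreviation "nf \<equiv> normal_form G \<pi> N"
abbreviation "E \<equiv> recursive_edges G A \<iota> \<pi> N"
abbreviation "order_c \<equiv> stacking_order G A \<iota> \<pi> N c"

lemma finite_letters: "finite A"
  and inverse_letter: "a \<in> A \<Longrightarrow> \<iota> a \<in> A" "a \<in> A \<Longrightarrow> \<iota> (\<iota> a) = a"
  and letter_value: "a \<in> A \<Longrightarrow> \<pi> a \<in> carrier G" "a \<in> A \<Longrightarrow> \<pi> a \<noteq> \<one>\<^bsub>G\<^esub>"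
  using generators by (auto simp: symmetric_generating_set_def)

lemma val_Nil [simp]: "val [] = \<one>\<^bsub>G\<^esub>" and val_Cons [simp]: "val (a # w) = \<pi> a \<otimes>\<^bsub>G\<^esub> val w"
  by (simp_all add: word_value_def)

lemma val_closed: "w \<in> lists A \<Longrightarrow> val w \<in> carrier G"
  by (induction w) (auto simp: letter_value)

lemma nf_props:
  assumes "g \<in> carrier G" shows "nf g \<in> lists A" "val (nf g) = g"
proof -
  have N: "N \<subseteq> lists A" "\<exists>!y. y \<in> N \<and> val y = g"
    using is_stacking assms by (auto simp: stacking_def normal_form_set_def)
  have "nf g \<in> N \<and> val (nf g) = g"
    unfolding normal_form_def by (rule theI'[OF N(2)])
  with N(1) show "nf g \<in> lists A" "val (nf g) = g" by auto
qed

lemma nf_one: "nf \<one>\<^bsub>G\<^esub> = []"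
  using is_stacking by (simp add: stacking_def)

lemma recursive_edgeD:
  assumes "(g, a) \<in> E"
  shows "g \<in> carrier G" "a \<in> A" "c (g, a) \<in> lists A" "val (c (g, a)) = \<pi> a" "c (g, a) \<noteq> []"
    "c (g, a) \<noteq> [a]"
proof -
  show g: "g \<in> carrier G" "a \<in> A"
    using assms by (auto simp: recursive_edges_def cayley_edges_def)
  show "c (g, a) \<in> lists A"
    using is_stacking assms by (auto simp: stacking_def image_subset_iff)
  show val: "val (c (g, a)) = \<pi> a"
    using is_stacking assms by (auto simp: stacking_def)
  show "c (g, a) \<noteq> []"
    using val letter_value(2)[OF g(2)] by auto
  show "c (g, a) \<noteq> [a]"
  proof
    assume "c (g, a) = [a]"
    then have "(g, a) \<in> path_edges G \<pi> g (c (g, a))"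
      using g by (simp add: path_edges_def)
    then have "((g, a), (g, a)) \<in> order_c"
      using assms by (auto simp: stacking_order_def)
    then show False
      using is_stacking by (auto simp: stacking_def irrefl_def)
  qed
qed

text \<open>Finitely many edges lie below an edge, and strictly fewer below a smaller one, so
  induction on their number works.\<close>

lemma recursive_edge_induct [consumes 1, case_names edge]:
  assumes "e \<in> E" and step: "\<And>e. e \<in> E \<Longrightarrow> (\<And>e'. (e', e) \<in> order_c \<Longrightarrow> P e') \<Longrightarrow> P e"
  shows "P e"
  using assms(1)
proof (induction "card {e'. (e', e) \<in> order_c}" arbitrary: e rule: less_induct)
  case less
  show ?case
  proof (rule step[OF less.prems])
    fix e' assume e': "(e', e) \<in> order_c"
    have tr: "trans order_c" "irrefl order_c" "finite {e'. (e', e) \<in> order_c}"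
      using is_stacking less.prems by (auto simp: stacking_def)
    have "{e''. (e'', e') \<in> order_c} \<subset> {e'. (e', e) \<in> order_c}"
    proof (rule psubsetI)
      show "{e''. (e'', e') \<in> order_c} \<subseteq> {e'. (e', e) \<in> order_c}"
        using e' transD[OF tr(1)] by blast
      have "e' \<notin> {e''. (e'', e') \<in> order_c}" using tr(2) by (cases e') (simp add: irrefl_def)
      then show "{e''. (e'', e') \<in> order_c} \<noteq> {e'. (e', e) \<in> order_c}" using e' by blast
    qed
    then have "card {e''. (e'', e') \<in> order_c} < card {e'. (e', e) \<in> order_c}"
      using tr(3) by (intro psubset_card_mono)
    moreover have "e' \<in> E"
      using e' by (auto simp: stacking_order_def dest: tranclD)
    ultimately show "P e'" by (rule less.hyps)
  qed
qed

text \<open>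
  Read backwards, these rules reduce a word to the empty word without ever inserting a pair of
  inverse letters; read forwards, they only add edges and cells to the outside of a diagram.
\<close>

inductive derivable :: "'a list \<Rightarrow> bool" where
  empty: "derivable []"
| spike: "derivable (u @ v) \<Longrightarrow> u \<in> lists A \<Longrightarrow> v \<in> lists A \<Longrightarrow> a \<in> A \<Longrightarrow> derivable (u @ [a, \<iota> a] @ v)"
| cell: "derivable (u @ c (val u, a) @ v) \<Longrightarrow> u \<in> lists A \<Longrightarrow> v \<in> lists A \<Longrightarrow> (val u, a) \<in> E \<Longrightarrow>
    derivable (u @ [a] @ v)"

lemma path_edges_Cons:
  assumes "g \<in> carrier G" "a \<in> A" "w \<in> lists A"
  shows "path_edges G \<pi> g (a # w) = insert (g, a) (path_edges G \<pi> (g \<otimes>\<^bsub>G\<^esub> \<pi> a) w)"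
proof -
  have "val (take i w) \<in> carrier G" for i
    using assms(3) by (intro val_closed) (meson in_lists_conv_set in_set_takeD)
  then have *: "(g \<otimes>\<^bsub>G\<^esub> val (take (Suc i) (a # w)), (a # w) ! Suc i) =
      ((g \<otimes>\<^bsub>G\<^esub> \<pi> a) \<otimes>\<^bsub>G\<^esub> val (take i w), w ! i)" for i
    using assms letter_value by (simp add: m_assoc)
  have "{i. i < length (a # w)} = insert 0 (Suc ` {i. i < length w})"
    by (auto simp: image_iff less_Suc_eq_0_disj)
  then have "path_edges G \<pi> g (a # w) =
      (\<lambda>i. (g \<otimes>\<^bsub>G\<^esub> val (take i (a # w)), (a # w) ! i)) ` insert 0 (Suc ` {i. i < length w})"
    unfolding path_edges_def by (auto simp: setcompr_eq_image)
  also have "\<dots> = insert (g, a) (path_edges G \<pi> (g \<otimes>\<^bsub>G\<^esub> \<pi> a) w)"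
    unfolding image_insert image_image * using assms(1) by (simp add: path_edges_def setcompr_eq_image)
  finally show ?thesis .
qed

text \<open>With the normal form of the current vertex in front, the statement composes along paths:
  each edge is treated at the front while the rest of the word stays untouched.\<close>

definition reaches_back :: "'g \<times> 'a \<Rightarrow> bool" where
  "reaches_back e \<longleftrightarrow> (\<forall>v \<in> lists A.
     derivable (nf (fst e \<otimes>\<^bsub>G\<^esub> \<pi> (snd e)) @ v) \<longrightarrow> derivable (nf (fst e) @ snd e # v))"

lemma derivable_along_path:
  assumes "g \<in> carrier G" "x \<in> lists A" "\<forall>e \<in> path_edges G \<pi> g x. reaches_back e" "v \<in> lists A"
    and "derivable (nf (g \<otimes>\<^bsub>G\<^esub> val x) @ v)"
  shows "derivable (nf g @ x @ v)"
  using assms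
proof (induction x arbitrary: g)
  case (Cons a x)
  then have a: "a \<in> A" "x \<in> lists A" by auto
  have path: "path_edges G \<pi> g (a # x) = insert (g, a) (path_edges G \<pi> (g \<otimes>\<^bsub>G\<^esub> \<pi> a) x)"
    using Cons.prems(1) a by (rule path_edges_Cons)
  have "derivable (nf (g \<otimes>\<^bsub>G\<^esub> \<pi> a) @ x @ v)"
  proof (rule Cons.IH)
    show "derivable (nf ((g \<otimes>\<^bsub>G\<^esub> \<pi> a) \<otimes>\<^bsub>G\<^esub> val x) @ v)"
      using Cons.prems a letter_value val_closed by (simp add: m_assoc)
  qed (use Cons.prems a letter_value path in auto)
  moreover have "reaches_back (g, a)" using Cons.prems(3) path by simp
  ultimately show ?case
    using a Cons.prems(4) by (simp add: reaches_back_def)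
qed simp

lemma reaches_back_edge:
  assumes "g \<in> carrier G" "a \<in> A" shows "reaches_back (g, a)"
proof -
  have degenerate: "reaches_back (g, a)" if ga: "g \<in> carrier G" "a \<in> A" "(g, a) \<notin> E" for g a
    unfolding reaches_back_def
  proof (intro ballI impI, simp only: fst_conv snd_conv)
    fix v assume v: "v \<in> lists A" "derivable (nf (g \<otimes>\<^bsub>G\<^esub> \<pi> a) @ v)"
    have h: "g \<otimes>\<^bsub>G\<^esub> \<pi> a \<in> carrier G" using ga letter_value by simp
    consider "nf g @ [a] = nf (g \<otimes>\<^bsub>G\<^esub> \<pi> a)" | "nf g = nf (g \<otimes>\<^bsub>G\<^esub> \<pi> a) @ [\<iota> a]"
      using ga by (auto simp: recursive_edges_def degenerate_edges_def cayley_edges_def)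
    then show "derivable (nf g @ a # v)"
    proof cases
      case 1
      then show ?thesis using v(2) by (metis append.assoc append_Cons append_Nil)
    next
      case 2
      \<comment> \<open>The spike is used with the letter \<open>\<iota> a\<close>, whose inverse is
        \<open>a\<close>: the normal form of \<open>g\<close> ends with \<open>\<iota> a\<close>,
        and the letter that follows cancels it.\<close>
      have "derivable (nf (g \<otimes>\<^bsub>G\<^esub> \<pi> a) @ [\<iota> a, \<iota> (\<iota> a)] @ v)"
        using v nf_props(1)[OF h] inverse_letter ga by (intro derivable.spike) auto
      then show ?thesis using 2 inverse_letter ga by simp
    qed
  qed
  have "reaches_back e" if "e \<in> E" for e
    using that
  proof (induction rule: recursive_edge_induct)
    case (edge e)
    obtain g a where e: "e = (g, a)" by (cases e)
    note ga = recursive_edgeD[OF edge.hyps[unfolded e]]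
    let ?x = "c (g, a)"
    have "reaches_back e'" if e': "e' \<in> path_edges G \<pi> g ?x" for e'
    proof (cases "e' \<in> E")
      case True
      then have "(e', e) \<in> order_c"
        using e' edge.hyps unfolding e stacking_order_def by auto
      then show ?thesis by (rule edge.IH)
    next
      case False
      obtain i where "i < length ?x" "e' = (g \<otimes>\<^bsub>G\<^esub> val (take i ?x), ?x ! i)"
        using e' by (auto simp: path_edges_def)
      moreover have "take i ?x \<in> lists A"
        using ga(3) by (meson in_lists_conv_set in_set_takeD)
      moreover have "?x ! i \<in> A" using ga(3) \<open>i < length ?x\<close>
        by (auto simp: in_lists_conv_set)
      ultimately show ?thesis
        using degenerate False ga(1) val_closed by simp
    qed
    then have "derivable (nf g @ ?x @ v)" if "v \<in> lists A" "derivable (nf (g \<otimes>\<^bsub>G\<^esub> \<pi> a) @ v)" for v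
      using that ga by (intro derivable_along_path) auto
    then show ?case
      using derivable.cell[of "nf g" a] nf_props[OF ga(1)] edge.hyps
      unfolding e reaches_back_def by simp
  qed
  then show ?thesis using degenerate assms by blast
qed

text \<open>The path of \<open>w\<close> starts and ends at the identity, whose normal form is
  empty, so nothing is left in front at either end.\<close>

lemma derivable_identity:
  assumes "w \<in> lists A" "val w = \<one>\<^bsub>G\<^esub>" shows "derivable w"
proof -
  have "reaches_back e" if e: "e \<in> path_edges G \<pi> \<one>\<^bsub>G\<^esub> w" for e
  proof -
    obtain i where "i < length w" "e = (\<one>\<^bsub>G\<^esub> \<otimes>\<^bsub>G\<^esub> val (take i w), w ! i)"
      using e by (auto simp: path_edges_def)
    moreover have "take i w \<in> lists A"
      using assms(1) by (meson in_lists_conv_set in_set_takeD)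
    moreover have "w ! i \<in> A" using assms(1) \<open>i < length w\<close>
      by (auto simp: in_lists_conv_set)
    ultimately show ?thesis
      using reaches_back_edge val_closed by simp
  qed
  then have "derivable (nf \<one>\<^bsub>G\<^esub> @ w @ [])"
    using assms nf_one derivable.empty by (intro derivable_along_path) auto
  then show ?thesis by (simp add: nf_one)
qed

end

section \<open>The diagram of a derivation\<close>

text \<open>
  A diagram under construction: a flag recording that all steps were legal, the number of vertices,
  the edges, the cells, and the boundary path, each dart of which is stored together with its
  source and its label.  Letters are represented by their numbers.  The basepoint is the vertex 0.
\<close>

type_synonym construction =
  "bool \<times> nat \<times> (nat \<times> nat \<times> nat) list \<times> (nat \<times> bool) list list \<times> (nat \<times> (nat \<times> bool) \<times> nat) list"

text \<open>The boundary is a closed path at vertex 0, so an empty remainder of it starts at 0;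
  hence the default.\<close>

definition path_start :: "(nat \<times> (nat \<times> bool) \<times> nat) list \<Rightarrow> nat" where
  "path_start bd = fst (if bd = [] then (0, (0, False), 0) else hd bd)"

definition letters :: "(nat \<times> (nat \<times> bool) \<times> nat) list \<Rightarrow> nat list" where
  "letters bd = map (\<lambda>e. snd (snd e)) bd"

definition darts :: "(nat \<times> (nat \<times> bool) \<times> nat) list \<Rightarrow> (nat \<times> bool) list" where
  "darts bd = map (\<lambda>e. fst (snd e)) bd"

definition spike_step :: "(nat \<Rightarrow> nat) \<Rightarrow> nat set \<Rightarrow> nat \<Rightarrow> nat \<Rightarrow> construction \<Rightarrow> construction" where
  "spike_step I L a j st = (case st of (ok, n, es, cs, bd) \<Rightarrow>
     (ok \<and> a \<in> L, Suc n, es @ [(path_start (drop j bd), a, n)], cs,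
      take j bd @ [(path_start (drop j bd), (length es, True), a), (n, (length es, False), I a)] @ drop j bd))"

text \<open>The boundary word before position \<open>j\<close> is the word that names the start of
  the edge. The last test rejects the triples of degenerate edges.\<close>

definition cell_step :: "nat set \<Rightarrow> nat \<Rightarrow> nat \<Rightarrow> nat \<Rightarrow> construction \<Rightarrow> construction" where
  "cell_step S a j k st = (case st of (ok, n, es, cs, bd) \<Rightarrow>
     (ok \<and> code_of (letters (take j bd), a, letters (take k (drop j bd))) \<in> S \<and>
        letters (take k (drop j bd)) \<noteq> [a], n,
      es @ [(path_start (drop j bd), a, path_start (drop (j + k) bd))],
      cs @ [darts (take k (drop j bd)) @ [(length es, False)]],
      take j bd @ [(path_start (drop j bd), (length es, True), a)] @ drop (j + k) bd))"

text \<open>Length 0 is free to mark a spike, because \<open>c\<close> has no empty value on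
  recursive edges.\<close>

definition step :: "(nat \<Rightarrow> nat) \<Rightarrow> nat set \<Rightarrow> nat set \<Rightarrow> construction \<Rightarrow> nat \<times> nat \<times> nat \<Rightarrow> construction" where
  "step I L S st s = (if snd (snd s) = 0 then spike_step I L (fst s) (fst (snd s)) st
     else cell_step S (fst s) (fst (snd s)) (snd (snd s)) st)"

definition construct :: "(nat \<Rightarrow> nat) \<Rightarrow> nat set \<Rightarrow> nat set \<Rightarrow> (nat \<times> nat \<times> nat) list \<Rightarrow> construction" where
  "construct I L S ss = foldl (\<lambda>st s. step I L S st s) (True, 1, [], [], []) ss"

definition boundary_of :: "construction \<Rightarrow> (nat \<times> (nat \<times> bool) \<times> nat) list" where
  "boundary_of st = snd (snd (snd (snd st)))"

definition certifies :: "(nat \<Rightarrow> nat) \<Rightarrow> nat set \<Rightarrow> nat set \<Rightarrow> nat list \<times> (nat \<times> nat \<times> nat) list \<Rightarrow> bool" where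
  "certifies I L S x \<longleftrightarrow> fst (construct I L S (snd x)) \<and> letters (boundary_of (construct I L S (snd x))) = fst x"

definition diagram_codes :: "construction \<Rightarrow> nat list" where
  "diagram_codes st = (case st of (ok, n, es, cs, bd) \<Rightarrow> [n, code_of es, code_of cs, 0, code_of (darts bd)])"

section \<open>Computability of the construction\<close>

lemma computable_finite_set:
  assumes "finite L" "computable f" shows "computable (\<lambda>x. f x \<in> (L :: nat set))"
proof -
  have "computable (\<lambda>n. n \<in> L)"
    using assms(1) by (rule computable_finite_support[where d = False]) simp
  then show ?thesis using computable_compose assms(2) by blast
qed

lemma computable_path_start:
  assumes "computable f" shows "computable (\<lambda>x. path_start (f x))"
  unfolding path_start_def by (intro computable_fst computable_hd computable_const assms)

lemma computable_letters:
  assumes "computable f" shows "computable (\<lambda>x. letters (f x))"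
  unfolding letters_def by (intro computable_intros assms)

lemma computable_darts:
  assumes "computable f" shows "computable (\<lambda>x. darts (f x))"
  unfolding darts_def by (intro computable_intros assms)

lemma computable_step:
  assumes "computable I" "finite L" "recursive_set S" and f: "computable f" and g: "computable g"
  shows "computable (\<lambda>x. step I L S (f x) (g x))"
proof -
  note fg = f g
  note intros = computable_intros computable_path_start computable_letters computable_darts
    computable_compose[OF assms(1)] computable_finite_set[OF assms(2)] computable_recursive_set[OF assms(3)]
  have spike: "computable (\<lambda>x. spike_step I L (a x) (j x) (st x))"
    if "computable a" "computable j" "computable st" for a j :: "'a \<Rightarrow> nat" and st
    unfolding spike_step_def case_prod_unfold by (intro intros that)
  have cell: "computable (\<lambda>x. cell_step S (a x) (j x) (k x) (st x))"
    if "computable a" "computable j" "computable k" "computable st" for a j k :: "'a \<Rightarrow> nat" and st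
    unfolding cell_step_def case_prod_unfold by (intro intros that)
  show ?thesis
    unfolding step_def
    by (intro computable_If spike cell computable_eq computable_const computable_fst computable_snd fg)
qed

lemma computable_construct:
  assumes "computable I" "finite L" "recursive_set S" and f: "computable f"
  shows "computable (\<lambda>x. construct I L S (f x))"
  unfolding construct_def
  by (intro computable_foldl computable_const f computable_step[OF assms(1-3)] computable_fst computable_snd computable_id)

lemma computable_certifies:
  assumes "computable I" "finite L" "recursive_set S"
  shows "computable (certifies I L S)"
proof -
  have "computable (\<lambda>x. fst (construct I L S (snd x)) \<and>
      map (\<lambda>e. snd (snd e)) (snd (snd (snd (snd (construct I L S (snd x)))))) = fst x)"
    by (intro computable_intros computable_construct assms)
  then show ?thesis by (simp add: certifies_def[abs_def] letters_def boundary_of_def)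
qed

lemma computable_diagram_codes:
  assumes "computable f" shows "computable (\<lambda>x. diagram_codes (f x))"
  unfolding diagram_codes_def case_prod_unfold by (intro computable_intros computable_darts assms)

lemma construct_snoc: "construct I L S (ss @ [s]) = step I L S (construct I L S ss) s"
  by (simp add: construct_def)

lemma letters_simps [simp]:
  "letters (xs @ ys) = letters xs @ letters ys" "letters [] = []" "letters (x # xs) = snd (snd x) # letters xs"
  "letters (take j xs) = take j (letters xs)" "letters (drop j xs) = drop j (letters xs)"
  by (simp_all add: letters_def take_map drop_map)

lemma fst_step_spike [simp]: "fst (spike_step I L a j st) \<longleftrightarrow> fst st \<and> a \<in> L"
  by (simp add: spike_step_def split: prod.splits)

lemma fst_step_cell [simp]:
  "fst (cell_step S a j k st) \<longleftrightarrow> fst st \<and>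
     code_of (take j (letters (boundary_of st)), a, take k (drop j (letters (boundary_of st)))) \<in> S \<and>
     take k (drop j (letters (boundary_of st))) \<noteq> [a]"
  by (simp add: cell_step_def boundary_of_def split: prod.splits)

lemma letters_step:
  "letters (boundary_of (spike_step I L a j st)) =
     take j (letters (boundary_of st)) @ [a, I a] @ drop j (letters (boundary_of st))"
  "letters (boundary_of (cell_step S a j k st)) =
     take j (letters (boundary_of st)) @ [a] @ drop (j + k) (letters (boundary_of st))"
  by (simp_all add: spike_step_def cell_step_def boundary_of_def split: prod.splits)

section \<open>Completeness and correctness of the construction\<close>

locale coded_stacked_group = stacked_group G A \<iota> \<pi> N c
  for G :: "('g, 'm) monoid_scheme" and A :: "'a set" and \<iota> :: "'a \<Rightarrow> 'a" and \<pi> :: "'a \<Rightarrow> 'g"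
    and N :: "'a list set" and c :: "'g \<times> 'a \<Rightarrow> 'a list" +
  fixes enc :: "'a \<Rightarrow> nat"
  assumes enc: "inj_on enc A"
    and algorithmic: "recursive_set (encode_triple enc ` stacking_graph G A \<iota> \<pi> N c)"
begin

text \<open>The constant value outside the alphabet makes the formal inversion a finite table, hence
  computable.\<close>

definition "inverse_code n = (if n \<in> enc ` A then enc (\<iota> (inv_into A enc n)) else 0)"

abbreviation "L \<equiv> enc ` A"
abbreviation "S \<equiv> encode_triple enc ` stacking_graph G A \<iota> \<pi> N c"
abbreviation "R \<equiv> stacking_relators G A \<iota> \<pi> N c"
abbreviation "construction \<equiv> construct inverse_code L S"

lemma inverse_code: "a \<in> A \<Longrightarrow> inverse_code (enc a) = enc (\<iota> a)"
  using enc by (simp add: inverse_code_def)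

lemma computable_inverse_code: "computable inverse_code"
  by (rule computable_finite_support[where S = L and d = 0]) (simp_all add: finite_letters inverse_code_def)

lemma encode_triple_eq: "encode_triple enc (w, a, x) = code_of (map enc w, enc a, map enc x)"
  by (simp add: encode_triple_def encode_word_def code_of_prod_def code_of_list_def code_of_nat_def o_def)

lemma map_enc_eq: "u \<in> lists A \<Longrightarrow> w \<in> lists A \<Longrightarrow> map enc u = map enc w \<Longrightarrow> u = w"
  by (rule map_inj_on[of enc]) (auto intro: inj_on_subset[OF enc])

text \<open>The numbering is injective on words over \<open>A\<close>, so the code determines the
  edge. A degenerate edge would have its own letter as the last entry.\<close>

lemma in_stacking_graph:
  assumes "u \<in> lists A" "x \<in> lists A" "code_of (map enc u, n, map enc x) \<in> S" "map enc x \<noteq> [n]"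
  obtains a where "n = enc a" "(val u, a) \<in> E" "c (val u, a) = x"
proof -
  obtain w a where wa: "w \<in> lists A" "a \<in> A"
    and "code_of (map enc u, n, map enc x) = encode_triple enc (w, a, extended_stacking_map G A \<iota> \<pi> N c (val w, a))"
    using assms(3) by (auto simp: stacking_graph_def)
  then have eq: "map enc u = map enc w" "n = enc a"
    "map enc x = map enc (extended_stacking_map G A \<iota> \<pi> N c (val w, a))"
    by (auto simp: encode_triple_eq code_of_eq_iff)
  have "u = w" using map_enc_eq assms(1) wa(1) eq(1) by blast
  have E: "(val u, a) \<in> E"
    using assms(4) eq \<open>u = w\<close> by (auto simp: extended_stacking_map_def split: if_splits)
  have "map enc x = map enc (c (val u, a))"
    using eq(3) E \<open>u = w\<close> by (simp add: extended_stacking_map_def)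
  then have "x = c (val u, a)"
    by (rule map_enc_eq[OF assms(2) recursive_edgeD(3)[OF E]])
  then show ?thesis using that eq(2) E by blast
qed

text \<open>Each rule of a derivation appends one legal operation, at the position given by the
  length of \<open>u\<close>.\<close>

lemma derivable_imp_construction:
  "derivable w \<Longrightarrow> \<exists>ss. fst (construction ss) \<and> letters (boundary_of (construction ss)) = map enc w"
proof (induction rule: derivable.induct)
  case empty
  show ?case by (rule exI[of _ "[]"]) (simp add: construct_def boundary_of_def)
next
  case (spike u v a)
  then obtain ss where ss: "fst (construction ss)" "letters (boundary_of (construction ss)) = map enc (u @ v)"
    by blast
  then show ?case
    using spike.hyps
    by (intro exI[of _ "ss @ [(enc a, length u, 0)]"]) (simp add: construct_snoc step_def letters_step inverse_code)
next
  case (cell u a v)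
  let ?x = "c (val u, a)"
  note E = recursive_edgeD[OF cell.hyps(4)]
  obtain ss where ss: "fst (construction ss)" "letters (boundary_of (construction ss)) = map enc (u @ ?x @ v)"
    using cell.IH by blast
  have "(u, a, ?x) \<in> stacking_graph G A \<iota> \<pi> N c"
    using cell.hyps E(2) by (auto simp: stacking_graph_def extended_stacking_map_def)
  then have "code_of (map enc u, enc a, map enc ?x) \<in> S"
    by (metis encode_triple_eq imageI)
  moreover have "map enc ?x \<noteq> [enc a]"
    using map_enc_eq[of ?x "[a]"] E by auto
  ultimately show ?case
    using ss E(5)
    by (intro exI[of _ "ss @ [(enc a, length u, length ?x)]"]) (simp add: construct_snoc step_def letters_step)
qed

abbreviation boundary_entry :: "'a diagram \<Rightarrow> dart \<Rightarrow> nat \<times> dart \<times> nat" where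
  "boundary_entry D d \<equiv> (dart_source D d, d, enc (dart_label \<iota> D d))"

text \<open>The clause on an empty boundary makes the point the only diagram without a subdivided
  circle, which is the case covered by \<open>realized_point_spike\<close>.\<close>

definition represents :: "construction \<Rightarrow> 'a diagram \<Rightarrow> bool" where
  "represents st D \<longleftrightarrow> realized A D \<and> basepoint D = 0 \<and>
     (\<forall>ds \<in> set (cells D). map (dart_label \<iota> D) ds \<in> R) \<and> (boundary D = [] \<longrightarrow> D = point_diagram) \<and>
     snd st = (nverts D, map (\<lambda>(s, a, t). (s, enc a, t)) (edges D), cells D,
       map (boundary_entry D) (boundary D))"

lemma dart_label_in: "labeled_complex A D \<Longrightarrow> fst d < length (edges D) \<Longrightarrow> dart_label \<iota> D d \<in> A"
proof -
  assume D: "labeled_complex A D" and d: "fst d < length (edges D)"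
  obtain s a t where e: "edges D ! fst d = (s, a, t)" by (cases "edges D ! fst d")
  then have "(s, a, t) \<in> set (edges D)" using nth_mem[OF d] by simp
  then have "a \<in> A" using D by (auto simp: labeled_complex_def)
  then show ?thesis using e inverse_letter by (auto simp: dart_label_def split: prod.splits)
qed

lemma boundary_label_in:
  assumes "labeled_complex A D" shows "map (dart_label \<iota> D) (boundary D) \<in> lists A"
proof -
  have "edge_path D (basepoint D) (boundary D) (basepoint D)"
    using assms by (simp add: labeled_complex_def)
  then have "dart_label \<iota> D d \<in> A" if "d \<in> set (boundary D)" for d
    using dart_label_in[OF assms] edge_path_darts that by blast
  then show ?thesis by auto
qed

lemma path_start_boundary:
  assumes "edge_path D q v 0"
  shows "path_start (map (boundary_entry D) v) = q"
  using assms by (cases v) (auto simp: path_start_def)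

lemma letters_boundary:
  "letters (map (boundary_entry D) ds) = map enc (map (dart_label \<iota> D) ds)"
  by (simp add: letters_def)

lemma map_darts_extend:
  assumes "edge_path D q ds q'" "edges D' = edges D @ es"
  shows "map (boundary_entry D') ds =
      map (boundary_entry D) ds"
    "map (dart_label \<iota> D') ds = map (dart_label \<iota> D) ds"
  using dart_simps_append[OF edge_path_darts[OF assms(1)] assms(2)] by (simp_all cong: map_cong)

lemma split_boundary:
  assumes "labeled_complex A D" "boundary D = u @ v"
  obtains q where "edge_path D (basepoint D) u q" "edge_path D q v (basepoint D)"
  using assms edge_path_append[OF labeled_complex_edges[OF assms(1)]] unfolding labeled_complex_def by metis

lemma cells_extend:
  assumes "labeled_complex A D" "edges D' = edges D @ es"
    "\<forall>ds \<in> set (cells D). map (dart_label \<iota> D) ds \<in> R"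
  shows "\<forall>ds \<in> set (cells D). map (dart_label \<iota> D') ds \<in> R"
proof
  fix ds assume ds: "ds \<in> set (cells D)"
  then obtain q where "edge_path D q ds q" using assms(1) by (auto simp: labeled_complex_def)
  then show "map (dart_label \<iota> D') ds \<in> R"
    using map_darts_extend(2)[OF _ assms(2)] assms(3) ds by metis
qed

lemma represents_spike:
  assumes st: "represents st D" and a: "a \<in> A"
  shows "\<exists>D'. represents (spike_step inverse_code L (enc a) j st) D'"
proof -
  have D: "realized A D" "labeled_complex A D" "basepoint D = 0"
    using st by (simp_all add: represents_def) (simp add: realized_def)
  define u where "u = take j (boundary D)"
  define v where "v = drop j (boundary D)"
  have bd: "boundary D = u @ v" by (simp add: u_def v_def)
  obtain q where q: "edge_path D (basepoint D) u q" "edge_path D q v (basepoint D)"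
    using split_boundary[OF D(2) bd] .
  define n where "n = nverts D"
  define m where "m = length (edges D)"
  define D' where "D' = D\<lparr>nverts := Suc n, edges := edges D @ [(q, a, n)], boundary := u @ [(m, True), (m, False)] @ v\<rparr>"
  have "realized A D'"
  proof (cases "u @ v = []")
    case True
    then have "D = point_diagram" using st bd by (simp add: represents_def)
    moreover have "q = 0" using q True D(3) by simp
    ultimately show ?thesis
      using realized_point_spike[OF a] True unfolding D'_def n_def m_def
      by (simp add: point_diagram_def numeral_2_eq_2)
  next
    case False
    then show ?thesis
      unfolding D'_def n_def m_def using D(1) bd q a by (intro realized_spike)
  qed
  moreover have edges: "edges D' = edges D @ [(q, a, n)]" by (simp add: D'_def)
  moreover have "snd (spike_step inverse_code L (enc a) j st) =
    (Suc n, map (\<lambda>(s, a, t). (s, enc a, t)) (edges D'), cells D',  map (boundary_entry D') (boundary D'))"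
  proof -
    have snd_st: "snd st = (n, map (\<lambda>(s, a, t). (s, enc a, t)) (edges D), cells D, map (boundary_entry D) (u @ v))"
      using st bd by (simp add: represents_def n_def)
    have "map (boundary_entry D') [(m, True), (m, False)] = [(q, (m, True), enc a), (n, (m, False), enc (\<iota> a))]"
      by (simp add: edges dart_source_def dart_label_def m_def)
    moreover have "take j (map (boundary_entry D) (u @ v)) = map (boundary_entry D) u" "drop j (map (boundary_entry D) (u @ v)) = map (boundary_entry D) v"
      unfolding bd[symmetric] take_map drop_map by (simp_all add: u_def v_def)
    moreover have "path_start (map (boundary_entry D) v) = q"
      using path_start_boundary q(2) D(3) by simp
    ultimately show ?thesis
      using snd_st inverse_code[OF a] map_darts_extend(1)[OF q(1) edges] map_darts_extend(1)[OF q(2) edges]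
      by (cases st) (simp add: spike_step_def D'_def m_def)
  qed
  moreover have "\<forall>ds \<in> set (cells D'). map (dart_label \<iota> D') ds \<in> R"
    using cells_extend[OF D(2) edges] st by (simp add: represents_def D'_def)
  ultimately have "represents (spike_step inverse_code L (enc a) j st) D'"
    using D(3) by (simp add: represents_def D'_def)
  then show ?thesis ..
qed

text \<open>The test supplies a recursive edge that starts at the value of the boundary word before
  \<open>x\<close>. The new cell reads \<open>c\<close> of this edge followed by the inverse of its
  letter, which is a relator.\<close>

lemma represents_cell:
  assumes st: "represents st D"
    and ok: "fst (cell_step S n j k st)"
  shows "\<exists>D'. represents (cell_step S n j k st) D'"
proof -
  have D: "realized A D" "labeled_complex A D" "basepoint D = 0"
    using st by (simp_all add: represents_def) (simp add: realized_def)
  define u where "u = take j (boundary D)"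
  define x where "x = take k (drop j (boundary D))"
  define v where "v = drop (j + k) (boundary D)"
  have xv: "drop j (boundary D) = x @ v"
    unfolding x_def v_def using append_take_drop_id[of k "drop j (boundary D)"] by (simp add: add.commute)
  then have bd: "boundary D = u @ x @ v"
    unfolding u_def using append_take_drop_id[of j "boundary D"] by simp
  obtain s where s: "edge_path D (basepoint D) u s" "edge_path D s (x @ v) (basepoint D)"
    using split_boundary[OF D(2) bd] .
  then obtain t where t: "edge_path D s x t" "edge_path D t v (basepoint D)"
    using edge_path_append[OF labeled_complex_edges[OF D(2)]] by blast
  have snd_st: "snd st = (nverts D, map (\<lambda>(s, a, t). (s, enc a, t)) (edges D), cells D, map (boundary_entry D) (boundary D))"
    using st by (simp add: represents_def)
  have parts: "take j (map (boundary_entry D) (boundary D)) = map (boundary_entry D) u"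
    "take k (drop j (map (boundary_entry D) (boundary D))) = map (boundary_entry D) x"
    "drop (j + k) (map (boundary_entry D) (boundary D)) = map (boundary_entry D) v"
    unfolding take_map drop_map by (simp_all add: u_def v_def x_def)
  have rest: "drop j (map (boundary_entry D) (boundary D)) = map (boundary_entry D) (x @ v)"
    by (simp only: drop_map xv)
  let ?u = "map (dart_label \<iota> D) u" and ?x = "map (dart_label \<iota> D) x"
  have lists: "?u \<in> lists A" "?x \<in> lists A"
    using boundary_label_in[OF D(2)] unfolding bd by auto
  have "code_of (map enc ?u, n, map enc ?x) \<in> S" "map enc ?x \<noteq> [n]"
    using ok snd_st unfolding cell_step_def
    by (cases st; simp add: parts letters_boundary del: letters_simps map_map)+
  then obtain a where a: "n = enc a" "(val ?u, a) \<in> E" "c (val ?u, a) = ?x"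
    using in_stacking_graph[OF lists] by blast
  have x: "x \<noteq> []" and "a \<in> A" using recursive_edgeD[OF a(2)] a(3) by auto
  define m where "m = length (edges D)"
  define D' where "D' = D\<lparr>edges := edges D @ [(s, a, t)], cells := cells D @ [x @ [(m, False)]],
    boundary := u @ [(m, True)] @ v\<rparr>"
  have edges: "edges D' = edges D @ [(s, a, t)]" by (simp add: D'_def)
  have new: "boundary_entry D' (m, True) = (s, (m, True), enc a)" "dart_label \<iota> D' (m, False) = \<iota> a"
    by (simp_all add: edges dart_source_def dart_label_def m_def)
  have "realized A D'"
    unfolding D'_def m_def using D(1) bd x s(1) t \<open>a \<in> A\<close> by (rule realized_cell)
  moreover have "snd (cell_step S n j k st) =
    (nverts D', map (\<lambda>(s, a, t). (s, enc a, t)) (edges D'), cells D', map (boundary_entry D') (boundary D'))"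
  proof -
    have start: "path_start (map (boundary_entry D) (x @ v)) = s" "path_start (map (boundary_entry D) v) = t"
      using path_start_boundary s(2) t(2) D(3) by (simp_all del: map_append)
    have "darts (map (boundary_entry D) x) = x" by (simp add: darts_def o_def)
    moreover obtain ok where "st = (ok, nverts D, map (\<lambda>(s, a, t). (s, enc a, t)) (edges D), cells D,
        map (boundary_entry D) (boundary D))"
      using snd_st by (cases st) auto
    ultimately have "snd (cell_step S n j k st) = (nverts D, map (\<lambda>(s, a, t). (s, enc a, t)) (edges D) @ [(s, n, t)],
        cells D @ [x @ [(m, False)]], map (boundary_entry D) u @ [(s, (m, True), n)] @ map (boundary_entry D) v)"
      unfolding cell_step_def
      by (simp only: prod.case snd_conv parts rest parts(2)[unfolded rest] start length_map m_def)
    moreover have "map (boundary_entry D') (boundary D') = map (boundary_entry D) u @ [(s, (m, True), n)] @ map (boundary_entry D) v"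
    proof -
      have "map (boundary_entry D') (boundary D') = map (boundary_entry D') u @ [boundary_entry D' (m, True)] @ map (boundary_entry D') v"
        by (simp add: D'_def)
      then show ?thesis
        unfolding map_darts_extend(1)[OF s(1) edges] map_darts_extend(1)[OF t(2) edges] new(1) a(1) .
    qed
    ultimately show ?thesis by (simp add: D'_def a(1))
  qed
  moreover have "\<forall>ds \<in> set (cells D'). map (dart_label \<iota> D') ds \<in> R"
  proof -
    have "map (dart_label \<iota> D') (x @ [(m, False)]) = c (val ?u, a) @ [\<iota> a]"
      using map_darts_extend(2)[OF t(1) edges] new(2) a(3) by simp
    then have "map (dart_label \<iota> D') (x @ [(m, False)]) \<in> R"
      using stacking_relators.relator[OF a(2)] by simp
    then show ?thesis
      using cells_extend[OF D(2) edges] st by (simp add: represents_def D'_def)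
  qed
  ultimately have "represents (cell_step S n j k st) D'"
    using D(3) by (simp add: represents_def D'_def)
  then show ?thesis ..
qed

lemma represents_construction: "fst (construction ss) \<Longrightarrow> \<exists>D. represents (construction ss) D"
proof (induction ss rule: rev_induct)
  case Nil
  have "represents (construction []) point_diagram"
    using realized_point by (simp add: represents_def construct_def) (simp add: point_diagram_def)
  then show ?case ..
next
  case (snoc s ss)
  obtain n j k where s: "s = (n, j, k)" by (cases s)
  have "fst (construction ss)"
    using snoc.prems by (simp add: construct_snoc step_def s split: if_splits)
  then obtain D where D: "represents (construction ss) D" using snoc.IH by blast
  show ?case
  proof (cases "k = 0")
    case True
    then obtain a where "n = enc a" "a \<in> A"
      using snoc.prems by (auto simp: construct_snoc step_def s)
    then show ?thesis
      using represents_spike[OF D] True by (simp add: construct_snoc step_def s)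
  next
    case False
    then show ?thesis
      using represents_cell[OF D] snoc.prems by (simp add: construct_snoc step_def s del: fst_step_cell)
  qed
qed

lemma encode_diagram_eq:
  assumes "represents st D" shows "encode_diagram enc D = code_of (diagram_codes st)"
proof -
  have path: "encode_dart_path = code_of"
  proof -
    have *: "(code_of :: dart \<Rightarrow> nat) = (\<lambda>(i, b). prod_encode (i, if b then 1 else 0))"
      by (simp add: fun_eq_iff code_of_prod_def code_of_nat_def code_of_bool_def)
    show ?thesis by (rule HOL.ext) (simp only: encode_dart_path_def code_of_list_def *)
  qed
  have "darts (map (boundary_entry D) (boundary D)) = boundary D"
    by (simp add: darts_def o_def)
  moreover have "list_encode (map (\<lambda>(s, a, t). prod_encode (s, prod_encode (enc a, t))) (edges D)) =
      code_of (map (\<lambda>(s, a, t). (s, enc a, t)) (edges D))"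
    by (simp add: code_of_list_def code_of_prod_def code_of_nat_def case_prod_unfold o_def)
  moreover have "list_encode (map code_of (cells D)) = code_of (cells D)"
    by (simp add: code_of_list_def)
  ultimately show ?thesis
    using assms unfolding represents_def encode_diagram_def path
    by (cases st) (simp add: diagram_codes_def code_of_list_def[of "[_, _, _, _, _]"] code_of_nat_def)
qed

text \<open>Derivability guarantees that the search ends. The list found may differ from the one
  that comes from a derivation, but every legal list has a diagram, and the test ensures that its
  boundary reads \<open>w\<close>.\<close>

lemma van_kampen_program:
  "\<exists>p. \<forall>w \<in> lists A. val w = \<one>\<^bsub>G\<^esub> \<longrightarrow>
     (\<exists>D. van_kampen_diagram A \<iota> R w D \<and> computes p [encode_word enc w] (encode_diagram enc D))"
proof -
  have surj: "surj (code_of :: (nat \<times> nat \<times> nat) list \<Rightarrow> nat)"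
    by (intro surj_code_of_list surj_code_of_prod surj_code_of_nat)
  have "computable (certifies inverse_code L S)"
    using finite_letters algorithmic by (intro computable_certifies computable_inverse_code finite_imageI)
  moreover have "computable (\<lambda>x :: nat list \<times> (nat \<times> nat \<times> nat) list. diagram_codes (construction (snd x)))"
    using finite_letters algorithmic
    by (intro computable_diagram_codes computable_construct computable_inverse_code finite_imageI computable_intros)
  ultimately obtain p where p: "\<And>x. \<exists>ss. certifies inverse_code L S (x, ss) \<Longrightarrow>
      \<exists>ss. certifies inverse_code L S (x, ss) \<and> computes p [code_of x] (code_of (diagram_codes (construction ss)))"
    using computes_search[OF _ _ surj] by (metis (no_types, lifting) snd_conv)
  have "\<exists>D. van_kampen_diagram A \<iota> R w D \<and> computes p [encode_word enc w] (encode_diagram enc D)"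
    if w: "w \<in> lists A" "val w = \<one>\<^bsub>G\<^esub>" for w
  proof -
    have "\<exists>ss. certifies inverse_code L S (map enc w, ss)"
      using derivable_imp_construction[OF derivable_identity[OF w]] by (simp add: certifies_def)
    then obtain ss where ss: "certifies inverse_code L S (map enc w, ss)"
      and prog: "computes p [code_of (map enc w)] (code_of (diagram_codes (construction ss)))"
      using p by blast
    obtain D where D: "represents (construction ss) D"
      using ss represents_construction by (auto simp: certifies_def)
    have "labeled_complex A D" using D by (simp add: represents_def realized_def)
    moreover have "map enc (map (dart_label \<iota> D) (boundary D)) = map enc w"
      using ss D unfolding certifies_def represents_def boundary_of_def
      by (simp add: letters_boundary del: map_map)
    ultimately have "map (dart_label \<iota> D) (boundary D) = w"
      using map_enc_eq boundary_label_in w(1) by blast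
    moreover have "van_kampen_diagram A \<iota> R (map (dart_label \<iota> D) (boundary D)) D"
      using D by (intro realized_imp_van_kampen) (simp_all add: represents_def)
    moreover have "encode_word enc w = code_of (map enc w)"
      by (simp add: encode_word_def code_of_list_def code_of_nat_def o_def)
    ultimately show ?thesis
      using prog encode_diagram_eq[OF D] by auto
  qed
  then show ?thesis by blast
qed

end

theorem proposition1p11:
  fixes G :: "('g, 'm) monoid_scheme"
    and A :: "'a set" and \<iota> :: "'a \<Rightarrow> 'a" and \<pi> :: "'a \<Rightarrow> 'g"
    and N :: "'a list set" and c :: "'g \<times> 'a \<Rightarrow> 'a list"
    and enc :: "'a \<Rightarrow> nat"
  assumes "group G"
    and "symmetric_generating_set G A \<iota> \<pi>"
    and "inj_on enc A"
    and "algorithmic_stacking enc G A \<iota> \<pi> N c"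
  shows "\<exists>p. \<forall>w \<in> lists A. word_value G \<pi> w = \<one>\<^bsub>G\<^esub> \<longrightarrow>
           (\<exists>D. van_kampen_diagram A \<iota> (stacking_relators G A \<iota> \<pi> N c) w D \<and>
                computes p [encode_word enc w] (encode_diagram enc D))"
proof -
  interpret coded_stacked_group G A \<iota> \<pi> N c enc
    using assms by (intro coded_stacked_group.intro stacked_group.intro coded_stacked_group_axioms.intro)
      (simp_all add: algorithmic_stacking_def)
  show ?thesis by (rule van_kampen_program)
qed

end
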